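(* For each $n\ge 1$ let $\mathcal{C}_n=\bigcup_k B(T_n^{(k)},X_n^{(k)}\sqrt n)\subset\mathbb{R}^n$ be the Boolean model built on a homogeneous Poisson point process of intensity $e^{n\rho_n}$ in $\mathbb{R}^n$, with $\rho_n\to\rho\in\mathbb{R}$, and with i.i.d. marks $X_n^{(k)}\stackrel{d}{=}\bar X_n\ge 0$ independent of the points. Assume that $R^*:=\lim_{n\to\infty}\mathbb{E}[\bar X_n]$ exists with $0<R^*<\infty$, that $\bar X_n\to R^*$ in probability, that $(\bar X_n)_{n\ge1}$ satisfies a large deviations principle (speed $n$) with good convex rate function $I$, and that $\limsup_{n\to\infty}\mathbb{E}[(\bar X_n)^{\gamma n}]^{1/n}<\infty$ for some $\gamma>1$. Then the percolation threshold is given by $$\tau_p=-\tfrac12\log(2\pi e)+\inf_{R\ge R^*}\bigl(I(R)-\log(R+R^* )\bigr).$$ That is, for $\rho<\tau_p$, $\theta_n\to0$ as $n\to\infty$, whereas for $\rho>\tau_p$, $\liminf_{n\to\infty}\theta_n>0$.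
   Context: $\log$ is the natural logarithm. $B(t,r)$ is the closed Euclidean ball of center $t\in\mathbb{R}^n$ and radius $r\ge0$; $\underline{0}$ is the origin; $T_n^{(k)}$, $k\ge1$, enumerates the points of the Poisson process in dimension $n$. $\mathbb{P}^0_n$ is the Palm probability of the marked Poisson process in dimension $n$: under $\mathbb{P}^0_n$ the marked process is distributed as the superposition of the stationary marked Poisson process and an independent single point at $\underline{0}$ carrying a ball whose radius has the law of $\bar X_n\sqrt n$ (this ball is included in $\mathcal{C}_n$). $K_n$ is the set of points of the point process lying in the connected component of $\mathcal{C}_n$ containing the origin, and $\theta_n:=\mathbb{P}^0_n(|K_n|=\infty)$ is the percolation probability. The percolation threshold is the number $\tau_p$ such that $\theta_n\to0$ for $\rho<\tau_p$ and $\liminf_n\theta_n>0$ for $\rho>\tau_p$. A good rate function is a lower semicontinuous function $I:\mathbb{R}\to[0,\infty]$ with compact sublevel sets. Under the assumptions, $I(R^* )=0$. *)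

theory Defs
  imports "HOL-Probability.Probability"
begin

subsection \<open>Euclidean space of dimension \<open>n\<close>\<close>

text \<open>
  The dimension varies along the sequences below, so points of \<open>n\<close>-dimensional space are functions
  on \<open>{..<n}\<close>, extensional (\<open>undefined\<close> outside \<open>{..<n}\<close>) as for the library's finite products of
  measures and of topologies.
\<close>

type_synonym point = "nat \<Rightarrow> real"

definition space_n :: "nat \<Rightarrow> point set" where
  "space_n n = {..<n} \<rightarrow>\<^sub>E UNIV"

definition lebesgue_n :: "nat \<Rightarrow> point measure" where
  "lebesgue_n n = PiM {..<n} (\<lambda>_. lborel)"

definition euclidean_top :: "nat \<Rightarrow> point topology" where
  "euclidean_top n = product_topology (\<lambda>_. euclideanreal) {..<n}"

definition origin :: "nat \<Rightarrow> point" where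
  "origin n = (\<lambda>i\<in>{..<n}. 0)"

definition closed_ball :: "nat \<Rightarrow> point \<Rightarrow> real \<Rightarrow> point set" where
  "closed_ball n t r = {y \<in> space_n n. L2_set (\<lambda>i. y i - t i) {..<n} \<le> r}"

subsection \<open>Marked Poisson processes\<close>

text \<open>Number of points in \<open>A\<close>, counted with multiplicity and possibly infinite.\<close>

definition num_points :: "(nat \<Rightarrow> 'w \<Rightarrow> point) \<Rightarrow> point set \<Rightarrow> 'w \<Rightarrow> ennreal" where
  "num_points T A \<omega> = emeasure (count_space UNIV) {k. T k \<omega> \<in> A}"

text \<open>
  Independence of two random elements. The library's \<open>indep_var\<close> would force their values
  to have the same type.
\<close>

definition indep_random_elements ::
  "'w measure \<Rightarrow> 'a measure \<Rightarrow> ('w \<Rightarrow> 'a) \<Rightarrow> 'b measure \<Rightarrow> ('w \<Rightarrow> 'b) \<Rightarrow> bool" where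
  "indep_random_elements M N Y N' Y' \<longleftrightarrow>
     Y \<in> measurable M N \<and> Y' \<in> measurable M N' \<and>
     prob_space.indep_set M
       {Y -` A \<inter> space M | A. A \<in> sets N} {Y' -` B \<inter> space M | B. B \<in> sets N'}"

text \<open>
  \<open>T 0, T 1, \<dots>\<close> enumerates a homogeneous Poisson process of intensity \<open>lam\<close> in dimension \<open>n\<close>.
  The Poisson probabilities are written out because \<^const>\<open>poisson_pmf\<close> excludes the rate \<open>0\<close>,
  which occurs for null sets.
\<close>

definition poisson_process ::
  "'w measure \<Rightarrow> nat \<Rightarrow> real \<Rightarrow> (nat \<Rightarrow> 'w \<Rightarrow> point) \<Rightarrow> bool" where
  "poisson_process M n lam T \<longleftrightarrow>
     prob_space M \<and>
     (\<forall>k. T k \<in> measurable M (lebesgue_n n)) \<and>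
     (\<forall>A \<in> sets (lebesgue_n n). emeasure (lebesgue_n n) A < \<infinity> \<longrightarrow>
        (\<forall>j. measure M {\<omega> \<in> space M. num_points T A \<omega> = of_nat j} =
             (lam * measure (lebesgue_n n) A) ^ j / fact j * exp (- (lam * measure (lebesgue_n n) A)))) \<and>
     (\<forall>(J :: nat set) A. finite J \<longrightarrow> disjoint_family_on A J \<longrightarrow>
        (\<forall>i\<in>J. A i \<in> sets (lebesgue_n n) \<and> emeasure (lebesgue_n n) (A i) < \<infinity>) \<longrightarrow>
        prob_space.indep_vars M (\<lambda>_. borel) (\<lambda>i. num_points T (A i)) J)"

definition marked_poisson_process ::
  "'w measure \<Rightarrow> nat \<Rightarrow> real \<Rightarrow> real measure \<Rightarrow> (nat \<Rightarrow> 'w \<Rightarrow> point) \<Rightarrow> (nat \<Rightarrow> 'w \<Rightarrow> real) \<Rightarrow> bool" where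
  "marked_poisson_process M n lam \<mu> T X \<longleftrightarrow>
     poisson_process M n lam T \<and>
     prob_space.indep_vars M (\<lambda>_. borel) X UNIV \<and>
     (\<forall>k. distr M borel (X k) = \<mu>) \<and>
     indep_random_elements M
       (PiM UNIV (\<lambda>_. lebesgue_n n)) (\<lambda>\<omega> k. T k \<omega>)
       (PiM UNIV (\<lambda>_. borel)) (\<lambda>\<omega> k. X k \<omega>)"

text \<open>
  Under the Palm probability the marked process is the superposition of the stationary one,
  \<open>(T, X)\<close>, with an independent point at the origin, whose mark is \<open>X0\<close>.
\<close>

definition palm_marked_process ::
  "'w measure \<Rightarrow> nat \<Rightarrow> real \<Rightarrow> real measure \<Rightarrow>
   (nat \<Rightarrow> 'w \<Rightarrow> point) \<Rightarrow> (nat \<Rightarrow> 'w \<Rightarrow> real) \<Rightarrow> ('w \<Rightarrow> real) \<Rightarrow> bool" where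
  "palm_marked_process M n lam \<mu> T X X0 \<longleftrightarrow>
     marked_poisson_process M n lam \<mu> T X \<and>
     X0 \<in> borel_measurable M \<and> distr M borel X0 = \<mu> \<and>
     indep_random_elements M
       borel X0
       (PiM UNIV (\<lambda>_. lebesgue_n n \<Otimes>\<^sub>M borel)) (\<lambda>\<omega> k. (T k \<omega>, X k \<omega>))"

subsection \<open>The Boolean model and its percolation threshold\<close>

definition boolean_model :: "nat \<Rightarrow> (nat \<Rightarrow> point) \<Rightarrow> (nat \<Rightarrow> real) \<Rightarrow> point set" where
  "boolean_model n t x = (\<Union>k. closed_ball n (t k) (x k * sqrt (real n)))"

definition palm_boolean_model :: "nat \<Rightarrow> (nat \<Rightarrow> point) \<Rightarrow> (nat \<Rightarrow> real) \<Rightarrow> real \<Rightarrow> point set" where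
  "palm_boolean_model n t x x0 =
     closed_ball n (origin n) (x0 * sqrt (real n)) \<union> boolean_model n t x"

definition origin_cluster :: "nat \<Rightarrow> (nat \<Rightarrow> point) \<Rightarrow> (nat \<Rightarrow> real) \<Rightarrow> real \<Rightarrow> point set" where
  "origin_cluster n t x x0 =
     {p \<in> insert (origin n) (range t).
        connected_component_of (subtopology (euclidean_top n) (palm_boolean_model n t x x0)) (origin n) p}"

text \<open>
  The completion matters: the balls are locally finite only almost surely, and for exceptional
  configurations the connected component need not be described by countably many conditions, so the
  event is only claimed to be measurable up to a null set.
\<close>

definition percolation_probability ::
  "'w measure \<Rightarrow> nat \<Rightarrow> (nat \<Rightarrow> 'w \<Rightarrow> point) \<Rightarrow> (nat \<Rightarrow> 'w \<Rightarrow> real) \<Rightarrow> ('w \<Rightarrow> real) \<Rightarrow> real" where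
  "percolation_probability M n T X X0 =
     measure (completion M)
       {\<omega> \<in> space M. infinite (origin_cluster n (\<lambda>k. T k \<omega>) (\<lambda>k. X k \<omega>) (X0 \<omega>))}"

text \<open>
  \<open>\<mu> n\<close> is the common law of the marks in dimension \<open>n\<close>. The percolation probability depends only on
  the law of the marked process; the first argument is the type of the sample spaces on which the
  processes are realised.
\<close>

definition is_percolation_threshold ::
  "'w itself \<Rightarrow> (nat \<Rightarrow> real measure) \<Rightarrow> real \<Rightarrow> bool" where
  "is_percolation_threshold (_ :: 'w itself) \<mu> \<tau> \<longleftrightarrow>
     (\<forall>(\<rho>s :: nat \<Rightarrow> real) (\<rho> :: real) (M :: nat \<Rightarrow> 'w measure) T X X0.
        \<rho>s \<longlonglongrightarrow> \<rho> \<longrightarrow>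
        (\<forall>n\<ge>1. palm_marked_process (M n) n (exp (real n * \<rho>s n)) (\<mu> n) (T n) (X n) (X0 n)) \<longrightarrow>
        (let \<theta> = (\<lambda>n. percolation_probability (M n) n (T n) (X n) (X0 n)) in
           (\<rho> < \<tau> \<longrightarrow> \<theta> \<longlonglongrightarrow> 0) \<and>
           (\<rho> > \<tau> \<longrightarrow> liminf (\<lambda>n. ereal (\<theta> n)) > 0)))"

subsection \<open>Large deviations\<close>

definition ereal_log :: "real \<Rightarrow> ereal" where
  "ereal_log x = (if x > 0 then ereal (ln x) else - \<infinity>)"

definition good_rate_function :: "(real \<Rightarrow> ereal) \<Rightarrow> bool" where
  "good_rate_function I \<longleftrightarrow>
     (\<forall>x. 0 \<le> I x) \<and>
     (\<forall>x. I x \<le> Liminf (at x) I) \<and>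
     (\<forall>a::real. compact {x. I x \<le> ereal a})"

definition convex_rate :: "(real \<Rightarrow> ereal) \<Rightarrow> bool" where
  "convex_rate I \<longleftrightarrow>
     (\<forall>x y u v. 0 \<le> u \<longrightarrow> 0 \<le> v \<longrightarrow> u + v = 1 \<longrightarrow>
        I (u * x + v * y) \<le> ereal u * I x + ereal v * I y)"

text \<open>Large deviations principle with speed \<open>n\<close> for random variables with laws \<open>\<mu> n\<close>.\<close>

definition large_deviations_principle :: "(nat \<Rightarrow> real measure) \<Rightarrow> (real \<Rightarrow> ereal) \<Rightarrow> bool" where
  "large_deviations_principle \<mu> I \<longleftrightarrow>
     (\<forall>F. closed F \<longrightarrow>
        limsup (\<lambda>n. ereal (1 / real n) * ereal_log (measure (\<mu> n) F)) \<le> - (INF x\<in>F. I x)) \<and>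
     (\<forall>G. open G \<longrightarrow>
        - (INF x\<in>G. I x) \<le> liminf (\<lambda>n. ereal (1 / real n) * ereal_log (measure (\<mu> n) G)))"

text \<open>Powers with a positive exponent, extended to \<open>\<infinity>\<close>.\<close>

definition ennreal_power :: "ennreal \<Rightarrow> real \<Rightarrow> ennreal" where
  "ennreal_power x a = (if x = \<infinity> then \<infinity> else ennreal (enn2real x powr a))"

end

theory Submission
  imports Defs "HOL-Real_Asymp.Real_Asymp"
begin

text \<open>
  The expected number of balls that meet the ball of radius \<open>(Rs + \<epsilon>) \<surd>n\<close> around the origin is
  \<open>exp (n (\<rho> + ln (2 \<pi> e) / 2 + sup (ln (R + Rs) - I R) + o(1)))\<close>, by Campbell's formula and a Laplace
  estimate. Below the threshold it tends to \<open>0\<close>, so that the origin is isolated.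

  Above the threshold some \<open>R \<ge> Rs\<close> is such that, for \<open>\<epsilon>\<close> small, the balls of radius
  \<open>(R + Rs - \<epsilon>) \<surd>n\<close> contain in the mean exponentially many points with mark near \<open>R\<close>, and also
  exponentially many with mark near \<open>Rs\<close>; this remains true for the part of such a ball that lies in a
  prescribed unit square of the first two coordinates and in a ball of radius \<open>A \<surd>n\<close> of the other
  coordinates, \<open>A\<close> large. The void probabilities being doubly exponentially small, a union bound over a
  finite grid shows that each unit square is good with probability tending to \<open>1\<close>, in the sense that both
  kinds of points are found around every position over it or its neighbours. Goodness of distinct
  squares is independent, and a nearest neighbour path of good squares can be followed by a chain of
  touching balls whose marks alternate between \<open>R\<close> and \<open>Rs\<close>. Hence percolation reduces to
  site percolation with parameter close to \<open>1\<close>, which is settled by renormalisation: a \<open>3 \<times> 3\<close> block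
  is bad if two of its nine parts are bad.
\<close>

text \<open>Percolation is a topological event, while probabilities are computed for a graph on
  indices, linked when their balls touch. The two agree when the balls are locally finite; by
  Borel-Cantelli this holds almost surely once the integral of \<open>(c + x) ^ n\<close> is finite,
  which the moment assumption gives for all large \<open>n\<close>. Independence is used only
  through product bounds for finite sets of bad sites. The void bound loses a factor 2 in its
  exponent and the grid has about \<open>(C * sqrt n) ^ n\<close> positions; both are harmless
  against doubly exponential decay. Restricting two coordinates to a unit square costs only a
  subexponential factor of volume, so dimension \<open>n - 2\<close> has the same exponent.
  Confinement to the ball of radius \<open>A * sqrt n\<close> makes the grid finite, but a ball
  centred near its boundary could lose almost all its volume. Moving the centre towards the origin
  by a fraction \<open>s\<close> of its distance costs at most \<open>s * A * sqrt n\<close> of the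
  radius and keeps half of the shifted ball inside; for \<open>A\<close> large this cost is as small
  as desired.\<close>

section \<open>Site percolation with few bad sites\<close>

text \<open>Union bound over the \<open>card C ^ card Q\<close> functions that choose a witness
  \<open>c\<close> for each \<open>q\<close>. Only a joint bound per choice function enters, so the
  lemma serves both the renormalisation step, where \<open>c\<close> is a pair of subblocks, and the
  cells, where \<open>c\<close> is a grid position with a set of marks.\<close>

lemma (in prob_space) prob_choice_bound:
  fixes E :: "'q \<Rightarrow> 'c \<Rightarrow> 'a set"
  assumes Q: "finite Q" and C: "finite C"
    and meas: "\<And>q c. q \<in> Q \<Longrightarrow> c \<in> C \<Longrightarrow> E q c \<in> events"
    and bound: "\<And>f. f \<in> Q \<rightarrow>\<^sub>E C \<Longrightarrow> prob {\<omega> \<in> space M. \<forall>q\<in>Q. \<omega> \<in> E q (f q)} \<le> b"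
  shows "prob {\<omega> \<in> space M. \<forall>q\<in>Q. \<exists>c\<in>C. \<omega> \<in> E q c} \<le> real (card C) ^ card Q * b"
proof -
  let ?A = "\<lambda>f. {\<omega> \<in> space M. \<forall>q\<in>Q. \<omega> \<in> E q (f q)}"
  have fin: "finite (Q \<rightarrow>\<^sub>E C)" using Q C by (simp add: finite_PiE)
  have A: "?A f \<in> events" if "f \<in> Q \<rightarrow>\<^sub>E C" for f
    using that meas Q by (intro sets.sets_Collect_finite_All) (auto simp: PiE_iff Int_def[symmetric] sets.sets_into_space intro!: sets.Int_space_eq1)
  have "{\<omega> \<in> space M. \<forall>q\<in>Q. \<exists>c\<in>C. \<omega> \<in> E q c} \<subseteq> (\<Union>f\<in>Q \<rightarrow>\<^sub>E C. ?A f)"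
  proof
    fix \<omega> assume w: "\<omega> \<in> {\<omega> \<in> space M. \<forall>q\<in>Q. \<exists>c\<in>C. \<omega> \<in> E q c}"
    then have "\<forall>q\<in>Q. \<exists>c. c \<in> C \<and> \<omega> \<in> E q c" by auto
    then obtain f where f: "\<forall>q\<in>Q. f q \<in> C \<and> \<omega> \<in> E q (f q)"
      by (auto simp: bchoice_iff)
    then have "restrict f Q \<in> Q \<rightarrow>\<^sub>E C" "\<omega> \<in> ?A (restrict f Q)" using w by auto
    then show "\<omega> \<in> (\<Union>f\<in>Q \<rightarrow>\<^sub>E C. ?A f)" by blast
  qed
  then have "prob {\<omega> \<in> space M. \<forall>q\<in>Q. \<exists>c\<in>C. \<omega> \<in> E q c} \<le> prob (\<Union>f\<in>Q \<rightarrow>\<^sub>E C. ?A f)"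
    using A fin by (intro finite_measure_mono sets.finite_UN) auto
  also have "\<dots> \<le> (\<Sum>f\<in>Q \<rightarrow>\<^sub>E C. prob (?A f))"
    using fin A by (intro finite_measure_subadditive_finite) auto
  also have "\<dots> \<le> (\<Sum>f\<in>Q \<rightarrow>\<^sub>E C. b)" by (intro sum_mono bound)
  also have "\<dots> = real (card C) ^ card Q * b" using Q by (simp add: card_PiE)
  finally show ?thesis .
qed

type_synonym site = "nat \<times> nat"

definition subsite :: "site \<Rightarrow> site \<Rightarrow> site" where
  "subsite p i = (3 * fst p + fst i, 3 * snd p + snd i)"

definition offsets :: "site set" where
  "offsets = {..<3} \<times> {..<3}"

text \<open>Blocks of level \<open>k\<close> have side \<open>3 ^ k\<close> and are anchored at the
  corner of the quadrant, so \<open>(0, 0)\<close> denotes at every level the block that contains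
  the site \<open>(0, 0)\<close>.\<close>

primrec bad_block :: "(site \<Rightarrow> bool) \<Rightarrow> nat \<Rightarrow> site \<Rightarrow> bool" where
  "bad_block \<beta> 0 p = \<beta> p"
| "bad_block \<beta> (Suc k) p = (\<exists>i\<in>offsets. \<exists>j\<in>offsets. i \<noteq> j \<and>
     bad_block \<beta> k (subsite p i) \<and> bad_block \<beta> k (subsite p j))"

lemma subsite_inject:
  assumes "i \<in> offsets" "j \<in> offsets"
  shows "subsite p i = subsite q j \<longleftrightarrow> p = q \<and> i = j"
  using assms unfolding subsite_def offsets_def prod_eq_iff mem_Times_iff by (auto; presburger)

lemma card_offsets: "card offsets = 9" "finite offsets"
  by (auto simp: offsets_def card_cartesian_product)

text \<open>The part of independence that the renormalisation uses: joint badness of finitely many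
  sites obeys a product bound. In this form the property passes from one level to the next.\<close>

definition sparse_events :: "'w measure \<Rightarrow> ('w \<Rightarrow> site \<Rightarrow> bool) \<Rightarrow> real \<Rightarrow> bool" where
  "sparse_events M \<beta> \<epsilon> \<longleftrightarrow> (\<forall>p. {\<omega> \<in> space M. \<beta> \<omega> p} \<in> sets M) \<and>
     (\<forall>Q. finite Q \<longrightarrow> measure M {\<omega> \<in> space M. \<forall>q\<in>Q. \<beta> \<omega> q} \<le> \<epsilon> ^ card Q)"

text \<open>If \<open>e\<close> is the parameter at level \<open>k\<close>, the next one is
  \<open>81 * e ^ 2\<close>: there are at most 81 pairs of offsets, and each prescribes two bad
  subblocks. Thus \<open>81 * e\<close> is squared at each level, whence the closed form.\<close>

lemma (in prob_space) sparse_events_bad_block: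
  assumes "sparse_events M \<beta> \<epsilon>" "\<epsilon> \<ge> 0"
  shows "sparse_events M (\<lambda>\<omega>. bad_block (\<beta> \<omega>) k) ((81 * \<epsilon>) ^ (2 ^ k) / 81)"
proof (induction k)
  case 0
  then show ?case using assms by simp
next
  case (Suc k)
  let ?b = "\<lambda>\<omega>. bad_block (\<beta> \<omega>) k"
  let ?e = "(81 * \<epsilon>) ^ (2 ^ k) / 81"
  let ?C = "{(i, j). i \<in> offsets \<and> j \<in> offsets \<and> i \<noteq> j}"
  let ?E = "\<lambda>p c. {\<omega> \<in> space M. ?b \<omega> (subsite p (fst c)) \<and> ?b \<omega> (subsite p (snd c))}"
  have m: "{\<omega> \<in> space M. ?b \<omega> p} \<in> events" for p
    using Suc unfolding sparse_events_def by blast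
  have bnd: "prob {\<omega> \<in> space M. \<forall>q\<in>Q. ?b \<omega> q} \<le> ?e ^ card Q" if "finite Q" for Q
    using Suc that unfolding sparse_events_def by blast
  have E: "?E p c \<in> events" for p c
    using m by (intro sets.sets_Collect_conj)
  have finC: "finite ?C" by (rule finite_subset[of _ "offsets \<times> offsets"]) (auto simp: card_offsets)
  have cardC: "card ?C \<le> 81"
    using card_mono[of "offsets \<times> offsets" ?C] by (auto simp: card_offsets card_cartesian_product)
  have pairs: "(\<exists>c\<in>?C. P (fst c) (snd c)) \<longleftrightarrow> (\<exists>i\<in>offsets. \<exists>j\<in>offsets. i \<noteq> j \<and> P i j)" for P
    by force
  have eq: "bad_block (\<beta> \<omega>) (Suc k) p \<longleftrightarrow> (\<exists>c\<in>?C. \<omega> \<in> ?E p c)" if "\<omega> \<in> space M" for \<omega> p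
    unfolding bad_block.simps
    using that pairs[of "\<lambda>i j. ?b \<omega> (subsite p i) \<and> ?b \<omega> (subsite p j)"] by blast
  have e0: "?e \<ge> 0" using assms by simp
  show ?case unfolding sparse_events_def
  proof (intro conjI allI impI)
    fix p
    have "{\<omega> \<in> space M. bad_block (\<beta> \<omega>) (Suc k) p} = (\<Union>c\<in>?C. ?E p c)" (is "?L = ?R")
    proof (rule set_eqI)
      fix \<omega> show "\<omega> \<in> ?L \<longleftrightarrow> \<omega> \<in> ?R" using eq[of \<omega> p] by blast
    qed
    then show "{\<omega> \<in> space M. bad_block (\<beta> \<omega>) (Suc k) p} \<in> events"
      using E finC by (simp only:) (intro sets.finite_UN; blast)
  next
    fix Q :: "site set" assume Q: "finite Q"
    have "prob {\<omega> \<in> space M. \<forall>q\<in>Q. \<exists>c\<in>?C. \<omega> \<in> ?E q c} \<le> real (card ?C) ^ card Q * (?e ^ 2) ^ card Q"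
    proof (rule prob_choice_bound[OF Q finC E])
      fix f assume f: "f \<in> Q \<rightarrow>\<^sub>E ?C"
      let ?Q1 = "(\<lambda>q. subsite q (fst (f q))) ` Q" and ?Q2 = "(\<lambda>q. subsite q (snd (f q))) ` Q"
      have fC: "fst (f q) \<in> offsets" "snd (f q) \<in> offsets" "fst (f q) \<noteq> snd (f q)" if "q \<in> Q" for q
        using f that by (fastforce simp: PiE_iff)+
      have i1: "inj_on (\<lambda>q. subsite q (fst (f q))) Q" "inj_on (\<lambda>q. subsite q (snd (f q))) Q"
        using fC by (auto intro!: inj_onI simp: subsite_inject)
      \<comment> \<open>The subblocks chosen in the blocks of \<open>Q\<close> are pairwise
        distinct, so \<open>2 * card Q\<close> blocks of the lower level are bad at once.\<close>
      have "?Q1 \<inter> ?Q2 = {}"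
      proof (intro equals0I, elim IntE imageE)
        fix x q q' assume h: "x = subsite q (fst (f q))" "q \<in> Q" "x = subsite q' (snd (f q'))" "q' \<in> Q"
        then have "q = q' \<and> fst (f q) = snd (f q')" using fC by (metis subsite_inject)
        then show False using h(2) fC(3) by metis
      qed
      then have "card (?Q1 \<union> ?Q2) = 2 * card Q"
        using Q i1 by (simp add: card_Un_disjoint card_image)
      moreover have "{\<omega> \<in> space M. \<forall>q\<in>Q. \<omega> \<in> ?E q (f q)} = {\<omega> \<in> space M. \<forall>q\<in>?Q1 \<union> ?Q2. ?b \<omega> q}"
        by blast
      ultimately show "prob {\<omega> \<in> space M. \<forall>q\<in>Q. \<omega> \<in> ?E q (f q)} \<le> (?e ^ 2) ^ card Q"
        using bnd[of "?Q1 \<union> ?Q2"] Q by (simp add: power_mult)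
    qed
    also have "\<dots> \<le> 81 ^ card Q * (?e ^ 2) ^ card Q"
      using cardC e0 by (intro mult_right_mono power_mono) auto
    also have "\<dots> = ((81 * \<epsilon>) ^ (2 ^ Suc k) / 81) ^ card Q"
    proof -
      have "(81 * \<epsilon>) ^ (2 ^ Suc k) = ((81 * \<epsilon>) ^ (2 ^ k)) ^ 2" by (metis power_Suc2 power_mult)
      then have "81 * ?e ^ 2 = (81 * \<epsilon>) ^ (2 ^ Suc k) / 81" by (simp only:) (simp add: power2_eq_square)
      then show ?thesis by (simp only: flip: power_mult_distrib)
    qed
    finally have le: "prob {\<omega> \<in> space M. \<forall>q\<in>Q. \<exists>c\<in>?C. \<omega> \<in> ?E q c} \<le> ((81 * \<epsilon>) ^ (2 ^ Suc k) / 81) ^ card Q" .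
    show "prob {\<omega> \<in> space M. \<forall>q\<in>Q. bad_block (\<beta> \<omega>) (Suc k) q} \<le> ((81 * \<epsilon>) ^ (2 ^ Suc k) / 81) ^ card Q"
    proof -
      have "{\<omega> \<in> space M. \<forall>q\<in>Q. bad_block (\<beta> \<omega>) (Suc k) q} =
          {\<omega> \<in> space M. \<forall>q\<in>Q. \<exists>c\<in>?C. \<omega> \<in> ?E q c}"
        by (intro Collect_cong conj_cong refl ball_cong eq)
      with le show ?thesis by (simp only:)
    qed
  qed
qed

section \<open>Clusters of good sites\<close>

definition adjacent :: "site \<Rightarrow> site \<Rightarrow> bool" where
  "adjacent p q \<longleftrightarrow> (fst p = fst q \<and> (snd p = Suc (snd q) \<or> snd q = Suc (snd p))) \<or>
     (snd p = snd q \<and> (fst p = Suc (fst q) \<or> fst q = Suc (fst p)))"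

definition good_connected :: "(site \<Rightarrow> bool) \<Rightarrow> site \<Rightarrow> site \<Rightarrow> bool" where
  "good_connected \<beta> = (\<lambda>p q. \<not> \<beta> p \<and> \<not> \<beta> q \<and> adjacent p q)\<^sup>*\<^sup>*"

lemma good_connected_sym: "good_connected \<beta> p q \<Longrightarrow> good_connected \<beta> q p"
  unfolding good_connected_def
  by (rule sympD[OF symp_rtranclp]) (auto simp: symp_def adjacent_def)

lemma good_connected_trans: "good_connected \<beta> p q \<Longrightarrow> good_connected \<beta> q r \<Longrightarrow> good_connected \<beta> p r"
  unfolding good_connected_def by (rule rtranclp_trans)

text \<open>The sites whose enclosing subblocks, at all levels below \<open>k\<close>, are good. The
  block \<open>p\<close> itself is not tested, so its goodness is a hypothesis wherever
  connectedness is claimed.\<close>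

primrec backbone :: "(site \<Rightarrow> bool) \<Rightarrow> nat \<Rightarrow> site \<Rightarrow> site set" where
  "backbone \<beta> 0 p = {p}"
| "backbone \<beta> (Suc k) p =
     (\<Union>i \<in> {i \<in> offsets. \<not> bad_block \<beta> k (subsite p i)}. backbone \<beta> k (subsite p i))"

lemma backbone_ge:
  assumes "q \<in> backbone \<beta> k p" shows "3 ^ k * fst p \<le> fst q" "3 ^ k * snd p \<le> snd q"
proof -
  have "3 ^ k * fst p \<le> fst q \<and> 3 ^ k * snd p \<le> snd q" using assms
  proof (induction k arbitrary: p)
    case (Suc k)
    then obtain i where i: "i \<in> offsets" "q \<in> backbone \<beta> k (subsite p i)" by auto
    from Suc.IH[OF i(2)] show ?case by (auto simp: subsite_def algebra_simps)
  qed auto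
  then show "3 ^ k * fst p \<le> fst q" "3 ^ k * snd p \<le> snd q" by auto
qed

text \<open>A \<open>3 \<times> 3\<close> array with at most one bad entry stays connected, since the rows and columns
  that avoid the bad entry meet each other; and of the three bonds between two such arrays that
  share a side, one joins good entries.\<close>

definition backbones_linked :: "(site \<Rightarrow> bool) \<Rightarrow> nat \<Rightarrow> bool" where
  "backbones_linked \<beta> k \<longleftrightarrow>
     (\<forall>p. \<not> bad_block \<beta> k p \<longrightarrow> backbone \<beta> k p \<noteq> {}) \<and>
     (\<forall>p. \<not> bad_block \<beta> k p \<longrightarrow> (\<forall>u\<in>backbone \<beta> k p. \<forall>v\<in>backbone \<beta> k p. good_connected \<beta> u v)) \<and>
     (\<forall>p q. \<not> bad_block \<beta> k p \<longrightarrow> \<not> bad_block \<beta> k q \<longrightarrow> adjacent p q \<longrightarrow>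
       (\<forall>u\<in>backbone \<beta> k p. \<forall>v\<in>backbone \<beta> k q. good_connected \<beta> u v))"

lemma backbones_linked: "backbones_linked \<beta> k"
proof (induction k)
  case 0
  show ?case by (auto simp: backbones_linked_def good_connected_def)
next
  case (Suc k)
  \<comment> \<open>\<open>R\<close> says that two good blocks have mutually connected backbones. By
    the induction hypothesis it is an equivalence relation on good blocks that contains adjacency;
    transitivity uses that the middle backbone is nonempty.\<close>
  define R where "R p q \<longleftrightarrow> \<not> bad_block \<beta> k p \<and> \<not> bad_block \<beta> k q \<and>
    (\<forall>u\<in>backbone \<beta> k p. \<forall>v\<in>backbone \<beta> k q. good_connected \<beta> u v)" for p q
  note ih = Suc.IH[unfolded backbones_linked_def]
  note IH = conjunct1[OF ih, rule_format] conjunct1[OF conjunct2[OF ih], rule_format]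
    conjunct2[OF conjunct2[OF ih], rule_format]
  have Rsym: "R q p" if "R p q" for p q
    unfolding R_def
  proof (intro conjI ballI)
    show "\<not> bad_block \<beta> k q" "\<not> bad_block \<beta> k p" using that by (simp_all add: R_def)
  next
    fix u v assume "u \<in> backbone \<beta> k q" "v \<in> backbone \<beta> k p"
    then have "good_connected \<beta> v u" using that by (simp add: R_def)
    then show "good_connected \<beta> u v" by (rule good_connected_sym)
  qed
  have Rtrans: "R p r" if pqr: "R p q" "R q r" for p q r
    unfolding R_def
  proof (intro conjI ballI)
    show "\<not> bad_block \<beta> k p" "\<not> bad_block \<beta> k r" using that by (simp_all add: R_def)
  next
    fix u v assume uv: "u \<in> backbone \<beta> k p" "v \<in> backbone \<beta> k r"
    obtain w where "w \<in> backbone \<beta> k q" using IH(1)[of q] pqr by (auto simp: R_def)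
    then have "good_connected \<beta> u w" "good_connected \<beta> w v" using uv that by (simp_all add: R_def)
    then show "good_connected \<beta> u v" by (rule good_connected_trans)
  qed
  have Rrefl: "R p p" if "\<not> bad_block \<beta> k p" for p using that IH(2) by (simp add: R_def)
  have Radj: "R p q" if "\<not> bad_block \<beta> k p" "\<not> bad_block \<beta> k q" "adjacent p q" for p q
    using that IH(3) by (simp add: R_def)
  define B where "B p i j = bad_block \<beta> k (subsite p (i, j))" for p i j
  \<comment> \<open>The pair \<open>(a, b)\<close> locates the bad entry if there is one; otherwise
    it is arbitrary.\<close>
  have one_bad: "\<exists>a b. \<forall>i j. i < 3 \<longrightarrow> j < 3 \<longrightarrow> B p i j \<longrightarrow> i = a \<and> j = b"
    if "\<not> bad_block \<beta> (Suc k) p" for p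
  proof (cases "\<exists>i<3. \<exists>j<3. B p i j")
    case True
    then obtain a b where ab: "a < 3" "b < 3" "B p a b" by blast
    have "i = a \<and> j = b" if "i < 3" "j < 3" "B p i j" for i j
    proof (rule ccontr)
      assume "\<not> (i = a \<and> j = b)"
      then have "(i, j) \<noteq> (a, b)" by simp
      moreover have "(i, j) \<in> offsets" "(a, b) \<in> offsets" using that ab by (auto simp: offsets_def)
      ultimately show False
        using ab that \<open>\<not> bad_block \<beta> (Suc k) p\<close> unfolding B_def bad_block.simps by blast
    qed
    then show ?thesis by blast
  qed blast
  have row: "R (subsite p (i, j)) (subsite p (i', j))"
    if "\<forall>i<3. \<not> B p i j" "i < 3" "i' < 3" for p i i' j
  proof -
    have nb: "\<not> bad_block \<beta> k (subsite p (0, j))" "\<not> bad_block \<beta> k (subsite p (1, j))" "\<not> bad_block \<beta> k (subsite p (2, j))"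
      using that(1) by (simp_all add: B_def)
    have s01: "R (subsite p (0, j)) (subsite p (1, j))"
      by (intro Radj nb) (simp add: adjacent_def subsite_def)
    have s12: "R (subsite p (1, j)) (subsite p (2, j))"
      by (intro Radj nb) (simp add: adjacent_def subsite_def)
    have z: "R (subsite p (0, j)) (subsite p (i, j))" if m: "i < 3" for i
    proof -
      consider "i = 0" | "i = 1" | "i = 2" using m by linarith
      then show ?thesis using s01 Rtrans[OF s01 s12] Rrefl[OF nb(1)] by cases simp_all
    qed
    show ?thesis using z[of i] z[of i'] that Rsym Rtrans by blast
  qed
  have col: "R (subsite p (i, j)) (subsite p (i, j'))"
    if "\<forall>j<3. \<not> B p i j" "j < 3" "j' < 3" for p i j j'
  proof -
    have nb: "\<not> bad_block \<beta> k (subsite p (i, 0))" "\<not> bad_block \<beta> k (subsite p (i, 1))" "\<not> bad_block \<beta> k (subsite p (i, 2))"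
      using that(1) by (simp_all add: B_def)
    have s01: "R (subsite p (i, 0)) (subsite p (i, 1))"
      by (intro Radj nb) (simp add: adjacent_def subsite_def)
    have s12: "R (subsite p (i, 1)) (subsite p (i, 2))"
      by (intro Radj nb) (simp add: adjacent_def subsite_def)
    have z: "R (subsite p (i, 0)) (subsite p (i, j))" if m: "j < 3" for j
    proof -
      consider "j = 0" | "j = 1" | "j = 2" using m by linarith
      then show ?thesis using s01 Rtrans[OF s01 s12] Rrefl[OF nb(1)] by cases simp_all
    qed
    show ?thesis using z[of j] z[of j'] that Rsym Rtrans by blast
  qed
  have inner: "R (subsite p x) (subsite p y)"
    if p: "\<not> bad_block \<beta> (Suc k) p" and xy: "x \<in> offsets" "y \<in> offsets"
      "\<not> bad_block \<beta> k (subsite p x)" "\<not> bad_block \<beta> k (subsite p y)" for p x y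
  proof -
    obtain a b where ab: "\<And>i j. i < 3 \<Longrightarrow> j < 3 \<Longrightarrow> B p i j \<Longrightarrow> i = a \<and> j = b"
      using one_bad[OF p] by blast
    \<comment> \<open>The two lines through \<open>(i0, j0)\<close> avoid the possibly bad entry, so
      this entry serves as a hub. A good entry reaches it along whichever of its own lines avoids
      \<open>(a, b)\<close>; if the entry is \<open>(a, b)\<close> itself, then the whole array is
      good.\<close>
    obtain i0 where i0: "i0 < 3" "i0 \<noteq> a"
      using that by (cases "a = 0") (auto intro: that[of 1] that[of 0])
    obtain j0 where j0: "j0 < 3" "j0 \<noteq> b"
      using that by (cases "b = 0") (auto intro: that[of 1] that[of 0])
    have *: "R (subsite p (i, j)) (subsite p (i0, j0))"
      if "i < 3" "j < 3" "\<not> B p i j" for i j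
    proof (cases "j = b")
      case False
      then have "R (subsite p (i, j)) (subsite p (i0, j))" using ab that i0 by (intro row) auto
      moreover have "R (subsite p (i0, j)) (subsite p (i0, j0))" using ab that i0 j0 by (intro col) auto
      ultimately show ?thesis by (rule Rtrans)
    next
      case True
      show ?thesis
      proof (cases "i = a")
        case False
        then have "R (subsite p (i, j)) (subsite p (i, j0))" using ab that j0 by (intro col) auto
        moreover have "R (subsite p (i, j0)) (subsite p (i0, j0))" using ab that i0 j0 by (intro row) auto
        ultimately show ?thesis by (rule Rtrans)
      next
        case True
        then have nb: "\<not> B p i' j'" if "i' < 3" "j' < 3" for i' j'
          using ab[OF that] \<open>j = b\<close> \<open>\<not> B p i j\<close> by blast
        then have "R (subsite p (i, j)) (subsite p (i0, j))" using that i0 by (intro row) auto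
        moreover have "R (subsite p (i0, j)) (subsite p (i0, j0))" using nb that i0 j0 by (intro col) auto
        ultimately show ?thesis by (rule Rtrans)
      qed
    qed
    have "R (subsite p x) (subsite p (i0, j0))" "R (subsite p y) (subsite p (i0, j0))"
      using *[of "fst x" "snd x"] *[of "fst y" "snd y"] xy unfolding B_def offsets_def
      by (simp_all add: mem_Times_iff)
    then show ?thesis using Rsym Rtrans by blast
  qed
  have bridge: "\<exists>x y. x \<in> offsets \<and> y \<in> offsets \<and> R (subsite p x) (subsite q y)"
    if pq: "\<not> bad_block \<beta> (Suc k) p" "\<not> bad_block \<beta> (Suc k) q"
      "(fst p = fst q \<and> snd q = Suc (snd p)) \<or> (snd p = snd q \<and> fst q = Suc (fst p))" for p q
  proof -
    obtain a b where ab: "\<And>i j. i < 3 \<Longrightarrow> j < 3 \<Longrightarrow> B p i j \<Longrightarrow> i = a \<and> j = b"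
      using one_bad[OF pq(1)] by blast
    obtain c d where cd: "\<And>i j. i < 3 \<Longrightarrow> j < 3 \<Longrightarrow> B q i j \<Longrightarrow> i = c \<and> j = d"
      using one_bad[OF pq(2)] by blast
    \<comment> \<open>Of the three bonds across the common side, each array blocks at most
      one.\<close>
    have third: "\<exists>m<3. m \<noteq> x \<and> m \<noteq> y" for x y :: nat
      by presburger
    obtain i where i: "i < 3" "i \<noteq> a" "i \<noteq> c" using third by blast
    obtain j where j: "j < 3" "j \<noteq> b" "j \<noteq> d" using third by blast
    show ?thesis using pq(3)
    proof
      assume h: "fst p = fst q \<and> snd q = Suc (snd p)"
      have "R (subsite p (i, 2)) (subsite q (i, 0))"
        using ab[of i 2] cd[of i 0] i h by (intro Radj) (auto simp: B_def adjacent_def subsite_def)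
      then show ?thesis using i by (intro exI[of _ "(i, 2)"] exI[of _ "(i, 0)"]) (auto simp: offsets_def)
    next
      assume h: "snd p = snd q \<and> fst q = Suc (fst p)"
      have "R (subsite p (2, j)) (subsite q (0, j))"
        using ab[of 2 j] cd[of 0 j] j h by (intro Radj) (auto simp: B_def adjacent_def subsite_def)
      then show ?thesis using j by (intro exI[of _ "(2, j)"] exI[of _ "(0, j)"]) (auto simp: offsets_def)
    qed
  qed
  have bridge': "\<exists>x y. x \<in> offsets \<and> y \<in> offsets \<and> R (subsite p x) (subsite q y)"
    if pq: "\<not> bad_block \<beta> (Suc k) p" "\<not> bad_block \<beta> (Suc k) q" "adjacent p q" for p q
  proof -
    have "(fst p = fst q \<and> snd q = Suc (snd p)) \<or> (snd p = snd q \<and> fst q = Suc (fst p)) \<or>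
        (fst q = fst p \<and> snd p = Suc (snd q)) \<or> (snd q = snd p \<and> fst p = Suc (fst q))"
      using pq(3) by (auto simp: adjacent_def)
    then show ?thesis using bridge[OF pq(1,2)] bridge[OF pq(2,1)] Rsym by meson
  qed
  show ?case unfolding backbones_linked_def
  proof (intro conjI allI impI ballI)
    fix p assume p: "\<not> bad_block \<beta> (Suc k) p"
    obtain a b where ab: "\<And>i j. i < 3 \<Longrightarrow> j < 3 \<Longrightarrow> B p i j \<Longrightarrow> i = a \<and> j = b"
      using one_bad[OF p] by blast
    have "\<not> B p 0 0 \<or> \<not> B p 0 1" using ab[of 0 0] ab[of 0 1] by auto
    then obtain j where "j < 3" "\<not> B p 0 j"
      by (meson less_numeral_extra(1) zero_less_numeral one_less_numeral_iff semiring_norm(77))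
    then have "backbone \<beta> k (subsite p (0, j)) \<noteq> {}"
      using IH(1) unfolding B_def by blast
    then obtain w where "w \<in> backbone \<beta> k (subsite p (0, j))" by (auto simp only: ex_in_conv[symmetric])
    moreover have "(0, j) \<in> {i \<in> offsets. \<not> bad_block \<beta> k (subsite p i)}"
      using \<open>j < 3\<close> \<open>\<not> B p 0 j\<close> by (simp add: offsets_def B_def)
    ultimately have "w \<in> backbone \<beta> (Suc k) p" unfolding backbone.simps by (rule UN_I[rotated])
    then show "backbone \<beta> (Suc k) p \<noteq> {}" by blast
  next
    fix p u v assume p: "\<not> bad_block \<beta> (Suc k) p" and u: "u \<in> backbone \<beta> (Suc k) p"
      and v: "v \<in> backbone \<beta> (Suc k) p"
    obtain x where x: "x \<in> offsets" "\<not> bad_block \<beta> k (subsite p x)" "u \<in> backbone \<beta> k (subsite p x)"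
      using u unfolding backbone.simps by blast
    obtain y where y: "y \<in> offsets" "\<not> bad_block \<beta> k (subsite p y)" "v \<in> backbone \<beta> k (subsite p y)"
      using v unfolding backbone.simps by blast
    have "R (subsite p x) (subsite p y)" using inner[OF p] x y by blast
    then show "good_connected \<beta> u v" using x(3) y(3) unfolding R_def by blast
  next
    fix p q u v assume p: "\<not> bad_block \<beta> (Suc k) p" and q: "\<not> bad_block \<beta> (Suc k) q"
      and pq: "adjacent p q" and u: "u \<in> backbone \<beta> (Suc k) p" and v: "v \<in> backbone \<beta> (Suc k) q"
    from bridge'[OF p q pq]
    obtain x y where xy: "x \<in> offsets" "y \<in> offsets" "R (subsite p x) (subsite q y)"
      by (elim exE conjE)
    obtain x' where x': "x' \<in> offsets" "\<not> bad_block \<beta> k (subsite p x')" "u \<in> backbone \<beta> k (subsite p x')"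
      using u unfolding backbone.simps by blast
    obtain y' where y': "y' \<in> offsets" "\<not> bad_block \<beta> k (subsite q y')" "v \<in> backbone \<beta> k (subsite q y')"
      using v unfolding backbone.simps by blast
    have "\<not> bad_block \<beta> k (subsite p x)" "\<not> bad_block \<beta> k (subsite q y)" using xy(3) unfolding R_def by blast+
    then have "R (subsite p x') (subsite p x)" "R (subsite q y) (subsite q y')"
      using inner[OF p] inner[OF q] x' y' xy by blast+
    then have "R (subsite p x') (subsite q y')" using xy(3) Rtrans by blast
    then show "good_connected \<beta> u v" using x'(3) y'(3) unfolding R_def by blast
  qed
qed

lemma backbone_nonempty: "\<not> bad_block \<beta> k p \<Longrightarrow> backbone \<beta> k p \<noteq> {}"
  using backbones_linked unfolding backbones_linked_def by blast

lemma backbone_connected: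
  "\<not> bad_block \<beta> k p \<Longrightarrow> u \<in> backbone \<beta> k p \<Longrightarrow> v \<in> backbone \<beta> k p \<Longrightarrow> good_connected \<beta> u v"
  using backbones_linked unfolding backbones_linked_def by blast

text \<open>Some subblock of the corner block of level \<open>k + 1\<close> other than the corner is
  good, as otherwise two bad subblocks would make the block bad. Its backbone is connected to
  \<open>(0, 0)\<close>, and its sites have coordinate sum at least \<open>3 ^ k\<close>, for every
  \<open>k\<close>.\<close>

lemma infinite_good_cluster:
  assumes good: "\<And>k. \<not> bad_block \<beta> k (0, 0)"
  shows "infinite {q. good_connected \<beta> (0, 0) q}"
proof
  assume fin: "finite {q. good_connected \<beta> (0, 0) q}"
  have z: "subsite (0, 0) (0, 0) = (0, 0)" by (simp add: subsite_def)
  have zero: "(0, 0) \<in> backbone \<beta> k (0, 0)" for k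
  proof (induction k)
    case (Suc k)
    have "(0, 0) \<in> {i \<in> offsets. \<not> bad_block \<beta> k (subsite (0, 0) i)}"
      using good[of k] z by (simp add: offsets_def)
    then show ?case unfolding backbone.simps using Suc z by (intro UN_I[of "(0, 0)"]) simp_all
  qed simp
  have "\<exists>q. good_connected \<beta> (0, 0) q \<and> k < fst q + snd q" for k
  proof -
    have "\<exists>i\<in>offsets. i \<noteq> (0, 0) \<and> \<not> bad_block \<beta> k (subsite (0, 0) i)"
    proof (rule ccontr)
      assume "\<not> ?thesis"
      moreover have "(0, 1) \<in> offsets" "(1, 0) \<in> offsets" by (simp_all add: offsets_def)
      ultimately have "bad_block \<beta> k (subsite (0, 0) (0, 1))" "bad_block \<beta> k (subsite (0, 0) (1, 0))"
        by (metis prod.inject zero_neq_one)+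
      with \<open>(0, 1) \<in> offsets\<close> \<open>(1, 0) \<in> offsets\<close> have "bad_block \<beta> (Suc k) (0, 0)"
        unfolding bad_block.simps by (metis prod.inject zero_neq_one)
      then show False using good[of "Suc k"] by simp
    qed
    then obtain i where i: "i \<in> offsets" "i \<noteq> (0, 0)" "\<not> bad_block \<beta> k (subsite (0, 0) i)" by blast
    then obtain q where q: "q \<in> backbone \<beta> k (subsite (0, 0) i)" using backbone_nonempty by blast
    then have "q \<in> backbone \<beta> (Suc k) (0, 0)" unfolding backbone.simps using i by blast
    then have "good_connected \<beta> (0, 0) q" using backbone_connected[OF good zero] by blast
    moreover have "k < 3 ^ k" by (induction k) auto
    moreover have "3 ^ k * 1 \<le> 3 ^ k * (fst i + snd i)" using i(2) by (intro mult_le_mono2) (cases i; auto)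
    ultimately show ?thesis using backbone_ge[OF q] by (intro exI[of _ q]) (auto simp: subsite_def algebra_simps)
  qed
  then obtain f where f: "\<And>k. good_connected \<beta> (0, 0) (f k) \<and> k < fst (f k) + snd (f k)" by metis
  define m where "m = Max ((\<lambda>q. fst q + snd q) ` {q. good_connected \<beta> (0, 0) q})"
  have "fst (f m) + snd (f m) \<le> m" unfolding m_def using fin f by (intro Max_ge) auto
  then show False using f[of m] by simp
qed

section \<open>Clusters of locally finite families of balls\<close>

definition edist :: "nat \<Rightarrow> point \<Rightarrow> point \<Rightarrow> real" where
  "edist n s t = L2_set (\<lambda>i. t i - s i) {..<n}"

lemma edist_nonneg [simp]: "0 \<le> edist n s t"
  by (simp add: edist_def)

lemma edist_self [simp]: "edist n t t = 0"
  by (simp add: edist_def L2_set_def)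

lemma edist_commute: "edist n s t = edist n t s"
  by (simp add: edist_def L2_set_def power2_commute)

lemma edist_triangle: "edist n s u \<le> edist n s t + edist n t u"
  using L2_set_triangle_ineq[of "\<lambda>i. t i - s i" "\<lambda>i. u i - t i" "{..<n}"] by (simp add: edist_def)

lemma closed_ball_edist: "closed_ball n t r = {y \<in> space_n n. edist n t y \<le> r}"
  by (simp add: closed_ball_def edist_def)

definition segment_n :: "nat \<Rightarrow> point \<Rightarrow> point \<Rightarrow> real \<Rightarrow> point" where
  "segment_n n a b s = (\<lambda>i\<in>{..<n}. (1 - s) * a i + s * b i)"

lemma edist_segment_left: "0 \<le> s \<Longrightarrow> edist n a (segment_n n a b s) = s * edist n a b"
  unfolding edist_def segment_n_def
  by (subst L2_set_right_distrib) (auto intro!: L2_set_cong simp: algebra_simps)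

lemma edist_segment_right: "s \<le> 1 \<Longrightarrow> edist n b (segment_n n a b s) = (1 - s) * edist n a b"
  unfolding edist_def[of n b] edist_commute[of n a b] unfolding edist_def segment_n_def
  by (subst L2_set_right_distrib) (auto intro!: L2_set_cong simp: algebra_simps)

lemma segment_n_space: "segment_n n a b s \<in> space_n n"
  by (simp add: segment_n_def space_n_def)

text \<open>When the distance \<open>d\<close> of the centres exceeds \<open>r\<close>, the point at
  fraction \<open>r / d\<close> of the segment lies in both balls; otherwise the second centre
  does.\<close>

lemma closed_ball_Int_nonempty_iff:
  assumes "a \<in> space_n n" "b \<in> space_n n" "0 \<le> r" "0 \<le> q"
  shows "closed_ball n a r \<inter> closed_ball n b q \<noteq> {} \<longleftrightarrow> edist n a b \<le> r + q"
proof
  assume "closed_ball n a r \<inter> closed_ball n b q \<noteq> {}"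
  then obtain y where "edist n a y \<le> r" "edist n b y \<le> q" by (auto simp: closed_ball_edist)
  then show "edist n a b \<le> r + q" using edist_triangle[of n a b y] edist_commute[of n b y] by simp
next
  assume le: "edist n a b \<le> r + q"
  show "closed_ball n a r \<inter> closed_ball n b q \<noteq> {}"
  proof (cases "edist n a b \<le> r")
    case True
    then have "b \<in> closed_ball n a r \<inter> closed_ball n b q" using assms by (simp add: closed_ball_edist)
    then show ?thesis by blast
  next
    case False
    define d where "d = edist n a b"
    have d: "d > 0" "r \<le> d" using False assms by (auto simp: d_def)
    have "segment_n n a b (r / d) \<in> closed_ball n a r"
      using d assms by (simp add: closed_ball_edist segment_n_space edist_segment_left flip: d_def)
    moreover have "(1 - r / d) * d \<le> q" using d le by (simp add: algebra_simps flip: d_def)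
    then have "segment_n n a b (r / d) \<in> closed_ball n b q"
      using d by (simp add: closed_ball_edist segment_n_space edist_segment_right flip: d_def)
    ultimately show ?thesis by blast
  qed
qed

lemma topspace_euclidean_top [simp]: "topspace (euclidean_top n) = space_n n"
  by (simp add: euclidean_top_def space_n_def)

lemma continuous_map_edist: "continuous_map (euclidean_top n) euclideanreal (edist n t)"
proof -
  have "continuous_map (euclidean_top n) euclideanreal (\<lambda>y. \<Sum>i<n. (y i - t i)\<^sup>2)"
    unfolding euclidean_top_def
    by (intro continuous_map_sum continuous_map_real_pow continuous_map_diff
        continuous_map_product_projection continuous_map_const[THEN iffD2]) auto
  then show ?thesis unfolding edist_def[abs_def] L2_set_def
    using continuous_map_compose[of _ euclideanreal _ euclideanreal sqrt]
    by (auto simp: comp_def continuous_on_real_sqrt[OF continuous_on_id] )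
qed

lemma closedin_closed_ball: "closedin (euclidean_top n) (closed_ball n t r)"
  using closedin_continuous_map_preimage[OF continuous_map_edist, of "{..r}" n t]
  by (simp add: closed_ball_edist)

lemma connectedin_closed_ball: "connectedin (euclidean_top n) (closed_ball n t r)"
proof (rule path_connectedin_imp_connectedin, unfold path_connectedin, intro conjI ballI)
  show "closed_ball n t r \<subseteq> topspace (euclidean_top n)" by (auto simp: closed_ball_edist)
next
  fix a b assume ab: "a \<in> closed_ball n t r" "b \<in> closed_ball n t r"
  have "pathin (euclidean_top n) (segment_n n a b)"
    unfolding pathin_def euclidean_top_def continuous_map_componentwise segment_n_def
    by (auto intro!: continuous_intros)
  moreover have "segment_n n a b s \<in> closed_ball n t r" if s: "0 \<le> s" "s \<le> 1" for s
  proof -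
    have "edist n t (segment_n n a b s) = L2_set (\<lambda>i. (1 - s) * (a i - t i) + s * (b i - t i)) {..<n}"
      unfolding edist_def segment_n_def by (intro L2_set_cong) (auto simp: algebra_simps)
    also have "\<dots> \<le> (1 - s) * edist n t a + s * edist n t b"
      unfolding edist_def using L2_set_triangle_ineq s by (simp add: L2_set_right_distrib)
    also have "\<dots> \<le> (1 - s) * r + s * r" using ab s
      by (intro add_mono mult_left_mono) (auto simp: closed_ball_edist)
    also have "\<dots> = r" by (simp add: algebra_simps)
    finally show ?thesis by (simp add: closed_ball_edist segment_n_space)
  qed
  moreover have "segment_n n a b 0 = a" "segment_n n a b 1 = b"
    using ab by (auto simp: segment_n_def closed_ball_edist space_n_def PiE_iff extensional_def fun_eq_iff)
  ultimately show "\<exists>g. pathin (euclidean_top n) g \<and> g \<in> {0..1} \<rightarrow> closed_ball n t r \<and> g 0 = a \<and> g 1 = b"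
    by (intro exI[of _ "segment_n n a b"]) auto
qed

text \<open>The ball carried by the origin has index \<^term>\<open>None\<close>.\<close>

definition touching :: "nat \<Rightarrow> (nat \<Rightarrow> point) \<Rightarrow> (nat \<Rightarrow> real) \<Rightarrow> real \<Rightarrow> nat option \<Rightarrow> nat option \<Rightarrow> bool" where
  "touching n t x x0 i j \<longleftrightarrow>
     edist n (case_option (origin n) t i) (case_option (origin n) t j)
       \<le> (case_option x0 x i + case_option x0 x j) * sqrt (real n)"

text \<open>Reachability in a graph on countably many indices involves countably many measurable
  conditions, in contrast to the topological component.\<close>

definition touching_cluster :: "nat \<Rightarrow> (nat \<Rightarrow> point) \<Rightarrow> (nat \<Rightarrow> real) \<Rightarrow> real \<Rightarrow> nat option set" where
  "touching_cluster n t x x0 = {i. (touching n t x x0)\<^sup>*\<^sup>* None i}"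

lemma origin_space_n [simp]: "origin n \<in> space_n n"
  by (simp add: origin_def space_n_def)

text \<open>The balls reached from the origin and the remaining ones have disjoint unions
  \<open>U\<close> and \<open>V\<close>, both closed by local finiteness; a connected subset of the
  model that contains the origin therefore stays in \<open>U\<close>. Conversely a chain of touching
  balls is connected.\<close>

theorem infinite_origin_cluster_iff:
  assumes t: "\<And>k. t k \<in> space_n n" and x: "\<And>k. 0 \<le> x k" "0 \<le> x0"
    and locally_finite: "\<And>R :: nat. finite {k. edist n (origin n) (t k) \<le> real R + x k * sqrt (real n)}"
  shows "infinite (origin_cluster n t x x0) \<longleftrightarrow> infinite (touching_cluster n t x x0)"
proof -
  let ?X = "euclidean_top n"
  define c where "c = case_option (origin n) t"
  define r where "r i = case_option x0 x i * sqrt (real n)" for i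
  define b where "b i = closed_ball n (c i) (r i)" for i
  define S where "S = touching_cluster n t x x0"
  define U where "U = (\<Union>i\<in>S. b i)"
  define V where "V = (\<Union>i\<in>-S. b i)"
  have cs: "c i \<in> space_n n" and r0: "0 \<le> r i" for i
    using t x by (auto simp: c_def r_def split: option.split)
  have cb: "c i \<in> b i" for i using cs r0 by (simp add: b_def closed_ball_edist)
  have touch: "touching n t x x0 i j \<longleftrightarrow> b i \<inter> b j \<noteq> {}" for i j
    unfolding b_def closed_ball_Int_nonempty_iff[OF cs cs r0 r0]
    by (simp add: touching_def c_def r_def algebra_simps)
  have lf: "finite {i. edist n (origin n) (c i) \<le> R + r i}" for R
  proof -
    obtain m :: nat where m: "R \<le> real m" using real_arch_simple by blast
    have "{i. edist n (origin n) (c i) \<le> R + r i} \<subseteq>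
        insert None (Some ` {k. edist n (origin n) (t k) \<le> real m + x k * sqrt (real n)})"
    proof
      fix i assume "i \<in> {i. edist n (origin n) (c i) \<le> R + r i}"
      then show "i \<in> insert None (Some ` {k. edist n (origin n) (t k) \<le> real m + x k * sqrt (real n)})"
        using m by (cases i) (auto simp: c_def r_def)
    qed
    then show ?thesis using locally_finite[of m] by (simp add: finite_subset)
  qed
  \<comment> \<open>A ball that meets the open ball of radius \<open>R\<close> around the origin has
    its centre within \<open>R + r i\<close> of the origin, and by \<open>lf\<close> there are
    finitely many such \<open>i\<close>. Hence the family is locally finite.\<close>
  have closedU: "closedin ?X (\<Union>i\<in>J. b i)" for J
  proof (rule closedin_locally_finite_Union)
    show "closedin ?X S" if "S \<in> b ` J" for S using that by (auto simp: b_def closedin_closed_ball)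
    show "locally_finite_in ?X (b ` J)" unfolding locally_finite_in_def
    proof (intro conjI ballI)
      show "\<Union> (b ` J) \<subseteq> topspace ?X" by (auto simp: b_def closed_ball_edist)
    next
      fix y assume y: "y \<in> topspace ?X"
      define R where "R = edist n (origin n) y + 1"
      let ?V = "{z \<in> topspace ?X. edist n (origin n) z \<in> {..<R}}"
      have "openin ?X ?V" by (rule openin_continuous_map_preimage[OF continuous_map_edist]) simp
      moreover have "y \<in> ?V" using y by (simp add: R_def)
      moreover have "{W \<in> b ` J. W \<inter> ?V \<noteq> {}} \<subseteq> b ` {i. edist n (origin n) (c i) \<le> R + r i}"
      proof
        fix W assume "W \<in> {W \<in> b ` J. W \<inter> ?V \<noteq> {}}"
        then obtain i z where i: "W = b i" "z \<in> b i" "z \<in> ?V" by blast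
        then have "edist n (origin n) (c i) \<le> R + r i"
          using edist_triangle[of n "origin n" "c i" z] edist_commute[of n z "c i"]
          by (simp add: b_def closed_ball_edist)
        then show "W \<in> b ` {i. edist n (origin n) (c i) \<le> R + r i}" using i by blast
      qed
      moreover have "finite (b ` {i. edist n (origin n) (c i) \<le> R + r i})" using lf by (rule finite_imageI)
      ultimately show "\<exists>V. openin ?X V \<and> y \<in> V \<and> finite {U \<in> b ` J. U \<inter> V \<noteq> {}}"
        by (intro exI[of _ ?V] conjI) (auto intro: finite_subset)
    qed
  qed
  have model: "palm_boolean_model n t x x0 = U \<union> V"
  proof -
    have "palm_boolean_model n t x x0 = (\<Union>i. b i)"
      unfolding UNIV_option_conv by (simp add: palm_boolean_model_def boolean_model_def b_def c_def r_def image_image)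
    then show ?thesis by (auto simp: U_def V_def)
  qed
  have none: "None \<in> S" by (simp add: S_def touching_cluster_def)
  have step: "j \<in> S" if "i \<in> S" "b i \<inter> b j \<noteq> {}" for i j
    using that touch[of i j] by (auto simp: S_def touching_cluster_def intro: rtranclp.rtrancl_into_rtrancl)
  have UV: "U \<inter> V = {}" using step by (fastforce simp: U_def V_def)
  let ?Y = "subtopology ?X (palm_boolean_model n t x x0)"
  have comp: "connected_component_of ?Y (origin n) p \<longleftrightarrow> p \<in> U" for p
  proof
    assume "connected_component_of ?Y (origin n) p"
    then obtain T where T: "connectedin ?Y T" "origin n \<in> T" "p \<in> T"
      by (auto simp: connected_component_of_def)
    have T': "connectedin ?X T" "T \<subseteq> U \<union> V" using T model by (auto simp: connectedin_subtopology)
    have "closedin ?X U" "closedin ?X V" unfolding U_def V_def by (rule closedU)+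
    then have "U \<inter> T = {} \<or> V \<inter> T = {}"
      using T' UV unfolding connectedin_closedin by blast
    moreover have "origin n \<in> U" using cb[of None] none by (auto simp: U_def c_def)
    ultimately show "p \<in> U" using T T' by blast
  next
    assume "p \<in> U"
    then obtain i where i: "i \<in> S" "p \<in> b i" by (auto simp: U_def)
    have "(touching n t x x0)\<^sup>*\<^sup>* None i" using i by (simp add: S_def touching_cluster_def)
    then have "\<exists>T. connectedin ?X T \<and> T \<subseteq> U \<union> V \<and> origin n \<in> T \<and> b i \<subseteq> T"
    proof (induction rule: rtranclp_induct)
      case base
      have "b None \<subseteq> U \<union> V" using none by (auto simp: U_def)
      then show ?case using cb[of None] connectedin_closed_ball unfolding b_def c_def
        by (intro exI[of _ "b None"]) (auto simp: b_def c_def)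
    next
      case (step i j)
      then obtain T where T: "connectedin ?X T" "T \<subseteq> U \<union> V" "origin n \<in> T" "b i \<subseteq> T" by blast
      have "connectedin ?X (T \<union> b j)"
      proof (rule connectedin_Un)
        show "T \<inter> b j \<noteq> {}" using T step(2) touch by blast
      qed (use T in \<open>auto simp: b_def connectedin_closed_ball\<close>)
      moreover have "b j \<subseteq> U \<union> V" by (auto simp: U_def V_def)
      ultimately show ?case using T by (intro exI[of _ "T \<union> b j"]) auto
    qed
    then show "connected_component_of ?Y (origin n) p"
      using i model by (auto simp: connected_component_of_def connectedin_subtopology)
  qed
  have mem: "c i \<in> U \<longleftrightarrow> i \<in> S" for i
    using cb step by (fastforce simp: U_def)
  have "insert (origin n) (range t) = range c"
    unfolding UNIV_option_conv by (simp add: c_def image_image)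
  then have cluster: "origin_cluster n t x x0 = c ` S"
    unfolding origin_cluster_def comp using mem by auto
  \<comment> \<open>Distinct indices may share a centre, but only finitely many do; so the set of
    points is finite exactly when the set of indices is.\<close>
  have fib: "finite {i \<in> S. c i = p}" for p
    by (rule finite_subset[OF _ lf[of "edist n (origin n) p"]]) (use r0 in auto)
  have "finite S" if "finite (c ` S)"
    by (rule finite_subset[OF _ finite_UN_I[OF that fib]]) auto
  then have "finite (c ` S) \<longleftrightarrow> finite S" by blast
  then show ?thesis using cluster by (simp add: S_def)
qed

section \<open>Volumes\<close>

interpretation lborel_family: product_sigma_finite "\<lambda>_::nat. lborel :: real measure"
  by standard

abbreviation leb :: "nat set \<Rightarrow> (nat \<Rightarrow> real) measure" where
  "leb J \<equiv> PiM J (\<lambda>_. lborel)"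

lemma measurable_L2_set_leb [measurable]:
  assumes "K \<subseteq> J"
  shows "(\<lambda>y. L2_set (\<lambda>i. y i - t i) K) \<in> borel_measurable (leb J)"
  unfolding L2_set_def using assms
  by (intro borel_measurable_sqrt[THEN measurable_compose[rotated]] borel_measurable_sum
      borel_measurable_power borel_measurable_diff borel_measurable_const
      measurable_component_singleton[THEN measurable_compose, of _ _ _ "\<lambda>x. x"]) auto

lemma emeasure_leb_ball0:
  assumes "finite J" "0 \<le> r" "J \<noteq> {}"
  shows "emeasure (leb J) {y \<in> space (leb J). L2_set y J \<le> r} = ennreal (unit_ball_vol (real (card J)) * r ^ card J)"
proof (cases "r = 0")
  case False
  then show ?thesis using emeasure_cball_aux[of J r] assms by (simp add: L2_set_def Int_def conj_commute)
next
  case True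
  obtain j where j: "j \<in> J" using assms by auto
  have "{y \<in> space (leb J). L2_set y J \<le> r} \<subseteq> (\<Pi>\<^sub>E i\<in>J. {0})"
    using True assms by (auto simp: L2_set_def sum_nonneg_eq_0_iff space_PiM PiE_iff
        sum_nonneg real_sqrt_le_iff[of _ 0, simplified] order_antisym_conv
        extensional_def fun_eq_iff)
  moreover have "emeasure (leb J) (\<Pi>\<^sub>E i\<in>J. {0}) = 0"
    using assms j by (subst lborel_family.emeasure_PiM) auto
  ultimately have "emeasure (leb J) {y \<in> space (leb J). L2_set y J \<le> r} = 0"
    using emeasure_mono[of "{y \<in> space (leb J). L2_set y J \<le> r}" "\<Pi>\<^sub>E i\<in>J. {0}" "leb J"]
      sets_PiM_I_finite[OF assms(1), of "\<lambda>_. {0}" "\<lambda>_. lborel"] by (simp only: sets_lborel) simp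
  then show ?thesis using True assms by (simp add: card_gt_0_iff power_0_left)
qed

text \<open>The case \<open>c = 1\<close> is a translation; \<open>c = -1\<close> is a point
  reflection, which will exchange the two halves of a ball.\<close>

lemma distr_leb_affine:
  assumes J: "finite J" and c: "\<bar>c\<bar> = 1"
  shows "distr (leb J) (leb J) (\<lambda>y. \<lambda>i\<in>J. t i + c * y i) = leb J"
proof (rule lborel_family.PiM_eqI[OF J])
  have c0: "c \<noteq> 0" using c by auto
  have meas: "(\<lambda>y. \<lambda>i\<in>J. t i + c * y i) \<in> measurable (leb J) (leb J)"
    by (intro measurable_restrict) measurable
  show "sets (distr (leb J) (leb J) (\<lambda>y. \<lambda>i\<in>J. t i + c * y i)) = sets (leb J)" by simp
  fix A :: "nat \<Rightarrow> real set" assume A: "\<And>i. i \<in> J \<Longrightarrow> A i \<in> sets lborel"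
  have eq: "(\<lambda>y. \<lambda>i\<in>J. t i + c * y i) -` Pi\<^sub>E J A \<inter> space (leb J) = (\<Pi>\<^sub>E i\<in>J. (\<lambda>x. t i + c * x) -` A i)"
    by (auto simp: space_PiM PiE_iff)
  have "emeasure (distr (leb J) (leb J) (\<lambda>y. \<lambda>i\<in>J. t i + c * y i)) (Pi\<^sub>E J A) =
      emeasure (leb J) (\<Pi>\<^sub>E i\<in>J. (\<lambda>x. t i + c * x) -` A i)"
    using A J meas by (subst emeasure_distr) (auto simp: eq intro!: sets_PiM_I_finite)
  also have "\<dots> = (\<Prod>i\<in>J. emeasure lborel ((\<lambda>x. t i + c * x) -` A i))"
    using A J by (intro lborel_family.emeasure_PiM) (auto intro!: measurable_sets_borel[where M = borel])
  also have "\<dots> = (\<Prod>i\<in>J. emeasure lborel (A i))"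
  proof (intro prod.cong refl)
    fix i assume "i \<in> J"
    then have "A i \<in> sets borel" using A by simp
    have "emeasure lborel (A i) = emeasure (density (distr lborel borel (\<lambda>x. t i + c * x)) (\<lambda>_. ennreal \<bar>c\<bar>)) (A i)"
      using lborel_real_affine[OF c0] by metis
    also have "\<dots> = emeasure (distr lborel borel (\<lambda>x. t i + c * x)) (A i)"
      using c \<open>A i \<in> sets borel\<close> by (simp add: emeasure_density)
    also have "\<dots> = emeasure lborel ((\<lambda>x. t i + c * x) -` A i)"
      using \<open>A i \<in> sets borel\<close> by (subst emeasure_distr) auto
    finally show "emeasure lborel ((\<lambda>x. t i + c * x) -` A i) = emeasure lborel (A i)" ..
  qed
  finally show "emeasure (distr (leb J) (leb J) (\<lambda>y. \<lambda>i\<in>J. t i + c * y i)) (Pi\<^sub>E J A) = (\<Prod>i\<in>J. emeasure lborel (A i))" .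
qed

lemma emeasure_leb_affine:
  assumes J: "finite J" and c: "\<bar>c\<bar> = 1" and P: "{y \<in> space (leb J). P y} \<in> sets (leb J)"
  shows "emeasure (leb J) {y \<in> space (leb J). P (\<lambda>i\<in>J. t i + c * y i)} = emeasure (leb J) {y \<in> space (leb J). P y}"
proof -
  have meas: "(\<lambda>y. \<lambda>i\<in>J. t i + c * y i) \<in> measurable (leb J) (leb J)"
    by (intro measurable_restrict) measurable
  have "emeasure (leb J) {y \<in> space (leb J). P y} =
      emeasure (distr (leb J) (leb J) (\<lambda>y. \<lambda>i\<in>J. t i + c * y i)) {y \<in> space (leb J). P y}"
    using distr_leb_affine[OF J c] by simp
  also have "\<dots> = emeasure (leb J) ((\<lambda>y. \<lambda>i\<in>J. t i + c * y i) -` {y \<in> space (leb J). P y} \<inter> space (leb J))"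
    using meas P by (rule emeasure_distr)
  also have "(\<lambda>y. \<lambda>i\<in>J. t i + c * y i) -` {y \<in> space (leb J). P y} \<inter> space (leb J) =
      {y \<in> space (leb J). P (\<lambda>i\<in>J. t i + c * y i)}"
    by (auto simp: space_PiM)
  finally show ?thesis ..
qed

lemma emeasure_leb_ball:
  assumes "finite J" "0 \<le> r" "J \<noteq> {}"
  shows "emeasure (leb J) {y \<in> space (leb J). L2_set (\<lambda>i. y i - t i) J \<le> r} =
    ennreal (unit_ball_vol (real (card J)) * r ^ card J)"
proof -
  have "{y \<in> space (leb J). L2_set (\<lambda>i. (y i - 0)) J \<le> r} \<in> sets (leb J)" by measurable
  then have m: "{y \<in> space (leb J). L2_set y J \<le> r} \<in> sets (leb J)" by simp
  have "{y \<in> space (leb J). L2_set (\<lambda>i. y i - t i) J \<le> r} =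
      {y \<in> space (leb J). L2_set (\<lambda>i\<in>J. - t i + 1 * y i) J \<le> r}"
    by (auto simp: L2_set_def)
  then show ?thesis
    using emeasure_leb_affine[OF assms(1) _ m, of 1 "\<lambda>i. - t i"] emeasure_leb_ball0[OF assms] by simp
qed

lemma ennreal_half_le:
  assumes "ennreal v \<le> 2 * x" "0 \<le> v" shows "ennreal (v / 2) \<le> x"
proof -
  have "ennreal v / 2 \<le> x * 2 / 2" using assms(1) by (intro divide_right_mono_ennreal) (simp add: mult.commute)
  then show ?thesis using assms(2) mult_divide_eq_ennreal[of 2 x] divide_ennreal[of v 2] by simp
qed

text \<open>A ball of radius \<open>q\<close> shifted slightly towards the origin: the half of it that faces
  the origin stays in the ball of radius \<open>A\<close>, and the two halves have the same volume.\<close>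

lemma emeasure_leb_lens:
  assumes J: "finite J" "J \<noteq> {}" and w: "L2_set w J \<le> A" and r: "0 \<le> s" "s \<le> 1" "0 \<le> q" "0 \<le> A"
    and "q + s * A \<le> r" "q\<^sup>2 \<le> s * A\<^sup>2"
  shows "ennreal (unit_ball_vol (real (card J)) * q ^ card J / 2) \<le>
    emeasure (leb J) {y \<in> space (leb J). L2_set (\<lambda>i. y i - w i) J \<le> r \<and> L2_set y J \<le> A}"
proof -
  \<comment> \<open>\<open>?H\<close> is the part of the ball around \<open>(1 - s) w\<close> that
    stays within distance \<open>A\<close> of the origin. \<open>?f\<close> reflects in the centre
    of that ball, so \<open>?H'\<close> is the mirror image of \<open>?H\<close>, and it suffices
    that the two cover the ball.\<close>
  define P where "P y \<longleftrightarrow> L2_set (\<lambda>i. y i - (1 - s) * w i) J \<le> q \<and> L2_set (\<lambda>i. y i - 0) J \<le> A" for y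
  let ?B = "{y \<in> space (leb J). L2_set (\<lambda>i. y i - (1 - s) * w i) J \<le> q}"
  let ?H = "{y \<in> space (leb J). P y}"
  let ?f = "\<lambda>y. \<lambda>i\<in>J. 2 * (1 - s) * w i + (-1) * y i"
  let ?H' = "{y \<in> space (leb J). P (?f y)}"
  have m: "?H \<in> sets (leb J)" unfolding P_def by measurable
  have "?H' = {y \<in> space (leb J). L2_set (\<lambda>i. y i - (1 - s) * w i) J \<le> q \<and> L2_set (\<lambda>i. y i - 2 * (1 - s) * w i) J \<le> A}"
    unfolding P_def L2_set_def
    by (intro Collect_cong conj_cong refl arg_cong2[where f="(\<le>)"] arg_cong[where f=sqrt] sum.cong)
       (auto simp: algebra_simps power2_eq_square)
  also have "\<dots> \<in> sets (leb J)" by measurable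
  finally have m': "?H' \<in> sets (leb J)" .
  have sub: "?B \<subseteq> ?H \<union> ?H'"
  proof
    fix y assume y: "y \<in> ?B"
    define u where "u i = y i - (1 - s) * w i" for i
    have u: "L2_set u J \<le> q" using y by (simp add: u_def[abs_def])
    then have u2: "(\<Sum>i\<in>J. (u i)\<^sup>2) \<le> q\<^sup>2"
      by (simp add: L2_set_def sqrt_le_D)
    have w2: "(\<Sum>i\<in>J. (w i)\<^sup>2) \<le> A\<^sup>2" using w by (simp add: L2_set_def sqrt_le_D)
    \<comment> \<open>For one of the signs \<open>e\<close> the cross term in the square of
      \<open>(1 - s) w + e u\<close> is nonpositive. What remains is at most
      \<open>(1 - s)^2 A^2 + q^2\<close>, which is at most
      \<open>(1 - s) A^2 + s A^2\<close>.\<close>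
    have key: "L2_set (\<lambda>i. (1 - s) * w i + e * u i) J \<le> A" if e: "\<bar>e\<bar> = 1" "e * (\<Sum>i\<in>J. w i * u i) \<le> 0" for e
    proof -
      have e2: "e\<^sup>2 = 1" using e by (metis power2_abs one_power2)
      have "(\<Sum>i\<in>J. ((1 - s) * w i + e * u i)\<^sup>2) =
          (1 - s)\<^sup>2 * (\<Sum>i\<in>J. (w i)\<^sup>2) + 2 * (1 - s) * (e * (\<Sum>i\<in>J. w i * u i)) + (\<Sum>i\<in>J. (u i)\<^sup>2)"
      proof -
        have "((1 - s) * w i + e * u i)\<^sup>2 = (1 - s)\<^sup>2 * (w i)\<^sup>2 + 2 * (1 - s) * (e * (w i * u i)) + (u i)\<^sup>2" for i
        proof -
          have "((1 - s) * w i + e * u i)\<^sup>2 = (1 - s)\<^sup>2 * (w i)\<^sup>2 + 2 * (1 - s) * (e * (w i * u i)) + e\<^sup>2 * (u i)\<^sup>2"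
            by algebra
          then show ?thesis using e2 by simp
        qed
        then show ?thesis by (simp add: sum.distrib sum_distrib_left)
      qed
      also have "\<dots> \<le> (1 - s)\<^sup>2 * A\<^sup>2 + 0 + q\<^sup>2"
        using w2 u2 e(2) r by (intro add_mono mult_left_mono mult_nonneg_nonpos[of "2 * (1 - s)"]) auto
      also have "\<dots> \<le> (1 - s) * A\<^sup>2 + s * A\<^sup>2"
        using assms by (intro add_mono) (auto intro!: mult_right_mono simp: power2_eq_square mult_left_le_one_le)
      also have "\<dots> = A\<^sup>2" by (simp add: algebra_simps)
      finally show ?thesis using r by (simp add: L2_set_def real_le_lsqrt)
    qed
    show "y \<in> ?H \<union> ?H'"
    proof (cases "(\<Sum>i\<in>J. w i * u i) \<le> 0")
      case True
      then have "L2_set (\<lambda>i. (1 - s) * w i + 1 * u i) J \<le> A" by (intro key) auto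
      then have "P y" using y by (simp add: P_def u_def)
      then show ?thesis using y by simp
    next
      case False
      then have "L2_set (\<lambda>i. (1 - s) * w i + (-1) * u i) J \<le> A" by (intro key) auto
      moreover have "L2_set (\<lambda>i. ?f y i - (1 - s) * w i) J = L2_set u J"
        unfolding L2_set_def u_def
        by (intro arg_cong[where f=sqrt] sum.cong refl) (auto simp: algebra_simps power2_eq_square)
      moreover have "L2_set (\<lambda>i. ?f y i - 0) J = L2_set (\<lambda>i. (1 - s) * w i + (-1) * u i) J"
        unfolding L2_set_def u_def
        by (intro arg_cong[where f=sqrt] sum.cong refl) (auto simp: algebra_simps)
      ultimately have "P (?f y)" using u unfolding P_def by simp
      then show ?thesis using y by simp
    qed
  qed
  have "emeasure (leb J) ?B = ennreal (unit_ball_vol (real (card J)) * q ^ card J)"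
    using J r by (intro emeasure_leb_ball)
  moreover have "emeasure (leb J) ?B \<le> emeasure (leb J) (?H \<union> ?H')"
    using sub m m' by (intro emeasure_mono) auto
  moreover have "emeasure (leb J) (?H \<union> ?H') \<le> emeasure (leb J) ?H + emeasure (leb J) ?H'"
    using m m' by (rule emeasure_subadditive)
  moreover have "emeasure (leb J) ?H' = emeasure (leb J) ?H"
    using J m by (intro emeasure_leb_affine) auto
  ultimately have "ennreal (unit_ball_vol (real (card J)) * q ^ card J) \<le> 2 * emeasure (leb J) ?H"
    by (simp flip: mult_2)
  then have "ennreal (unit_ball_vol (real (card J)) * q ^ card J / 2) \<le> emeasure (leb J) ?H"
    using r by (intro ennreal_half_le) auto
  also have "\<dots> \<le> emeasure (leb J) {y \<in> space (leb J). L2_set (\<lambda>i. y i - w i) J \<le> r \<and> L2_set y J \<le> A}"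
  proof (rule emeasure_mono)
    have "{y \<in> space (leb J). L2_set (\<lambda>i. y i - w i) J \<le> r \<and> L2_set (\<lambda>i. y i - 0) J \<le> A} \<in> sets (leb J)" by measurable
    then show "{y \<in> space (leb J). L2_set (\<lambda>i. y i - w i) J \<le> r \<and> L2_set y J \<le> A} \<in> sets (leb J)" by simp
    show "?H \<subseteq> {y \<in> space (leb J). L2_set (\<lambda>i. y i - w i) J \<le> r \<and> L2_set y J \<le> A}"
    proof
      fix y assume y: "y \<in> ?H"
      \<comment> \<open>Returning from the shifted centre to \<open>w\<close> costs the length
        \<open>s * A\<close>, which the assumption \<open>q + s * A \<le> r\<close> provides
        for.\<close>
      have "L2_set (\<lambda>i. y i - w i) J = L2_set (\<lambda>i. (y i - (1 - s) * w i) + (- s) * w i) J"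
        by (intro L2_set_cong refl) (simp add: algebra_simps)
      also have "\<dots> \<le> L2_set (\<lambda>i. y i - (1 - s) * w i) J + L2_set (\<lambda>i. (- s) * w i) J" by (rule L2_set_triangle_ineq)
      finally have 1: "L2_set (\<lambda>i. y i - w i) J \<le> L2_set (\<lambda>i. y i - (1 - s) * w i) J + L2_set (\<lambda>i. (- s) * w i) J" .
      have 2: "L2_set (\<lambda>i. (- s) * w i) J = s * L2_set w J"
        using r(1) by (subst L2_set_right_distrib) (simp_all add: L2_set_def)
      have 3: "L2_set (\<lambda>i. y i - (1 - s) * w i) J \<le> q" "L2_set y J \<le> A" using y by (simp_all add: P_def)
      have "s * L2_set w J \<le> s * A" using w r(1) by (rule mult_left_mono)
      with 1 2 3 have "L2_set (\<lambda>i. y i - w i) J \<le> r" using \<open>q + s * A \<le> r\<close> by linarith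
      then show "y \<in> {y \<in> space (leb J). L2_set (\<lambda>i. y i - w i) J \<le> r \<and> L2_set y J \<le> A}"
        using y 3 by simp
    qed
  qed
  finally show ?thesis .
qed

section \<open>Exponential growth rate of the volume of the ball of radius
  \<open>sqrt m\<close>\<close>

definition log_ball :: "nat \<Rightarrow> real" where
  "log_ball m = ln (unit_ball_vol (real m) * sqrt (real m) ^ m)"

text \<open>The functional equation of the Gamma function at \<open>m / 2 + 1\<close>; a step of two
  in the dimension is a step of one in its argument.\<close>

lemma unit_ball_vol_rec: "unit_ball_vol (real (Suc (Suc m))) = unit_ball_vol (real m) * (2 * pi / real (m + 2))"
proof -
  have "Gamma (real m / 2 + 1 + 1) = (real m / 2 + 1) * Gamma (real m / 2 + 1)"
    using nonpos_Ints_nonpos[of "real m / 2 + 1"] by (intro Gamma_plus1) (auto simp: add_nonneg_pos not_le)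
  moreover have "pi powr (real m / 2 + 1) = pi powr (real m / 2) * pi"
    by (simp add: powr_add)
  moreover have "real (Suc (Suc m)) / 2 = real m / 2 + 1" by simp
  ultimately have "unit_ball_vol (real (Suc (Suc m))) =
      pi powr (real m / 2) * pi / ((real m / 2 + 1) * Gamma (real m / 2 + 1))"
    unfolding unit_ball_vol_def by (simp only:)
  also have "\<dots> = pi powr (real m / 2) / Gamma (real m / 2 + 1) * (pi / (real m / 2 + 1))"
    by (simp only: times_divide_times_eq mult.commute)
  also have "pi / (real m / 2 + 1) = 2 * pi / real (m + 2)" by (simp add: field_simps)
  finally show ?thesis by (simp only: unit_ball_vol_def)
qed

lemma log_ball_rec:
  assumes "m > 0"
  shows "log_ball (Suc (Suc m)) - log_ball m = ln (2 * pi) + real m / 2 * ln (1 + 2 / real m)"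
proof -
  have s: "ln (sqrt (real k) ^ k) = real k / 2 * ln (real k)" if "k > 0" for k
    using that by (simp add: ln_realpow ln_sqrt)
  have L: "log_ball k = ln (unit_ball_vol (real k)) + real k / 2 * ln (real k)" if "k > 0" for k
    using that unit_ball_vol_pos[of "real k"] by (simp add: log_ball_def ln_mult_pos s)
  have "ln (unit_ball_vol (real (Suc (Suc m)))) = ln (unit_ball_vol (real m)) + ln (2 * pi) - ln (real m + 2)"
    unfolding unit_ball_vol_rec using unit_ball_vol_pos[of "real m"] by (subst ln_mult_pos) (auto simp: ln_div add.commute)
  note V = this
  have l: "ln (1 + 2 / real m) = ln (real m + 2) - ln (real m)"
  proof -
    have "1 + 2 / real m = (real m + 2) / real m" using assms by (simp add: field_simps)
    then show ?thesis using assms by (simp add: ln_div)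
  qed
  have arith: "(v + c - a + (x + 2) / 2 * a) - (v + x / 2 * b) = c + x / 2 * (a - b)" for v c a b x :: real
    by (simp add: add_divide_distrib distrib_right right_diff_distrib)
  have "real (Suc (Suc m)) = real m + 2" by simp
  then show ?thesis unfolding L[OF assms] L[of "Suc (Suc m)", OF zero_less_Suc] V l
    by (simp only: arith)
qed

text \<open>A Stolz-Cesaro argument for steps of two, as the recursion of the ball volumes relates
  \<open>m\<close> to \<open>m + 2\<close>.\<close>

lemma ratio_tendsto_of_increments:
  fixes L :: "nat \<Rightarrow> real"
  assumes "(\<lambda>m. L (m + 2) - L m) \<longlonglongrightarrow> c"
  shows "(\<lambda>m. L m / real m) \<longlonglongrightarrow> c / 2"
proof (rule LIMSEQ_I)
  fix e :: real assume e: "e > 0"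
  obtain m0 where m0: "\<And>m. m \<ge> m0 \<Longrightarrow> \<bar>L (m + 2) - L m - c\<bar> < e"
    using LIMSEQ_D[OF assms e] by auto
  \<comment> \<open>Two starting values, one for each parity.\<close>
  define K where "K = \<bar>L m0 - real m0 * c / 2\<bar> + \<bar>L (m0 + 1) - real (m0 + 1) * c / 2\<bar>"
  have bound: "\<bar>L m - real m * c / 2\<bar> \<le> K + real m * e / 2" if "m \<ge> m0" for m
    using that
  proof (induction m rule: less_induct)
    case (less m)
    consider "m = m0" | "m = m0 + 1" | "m \<ge> m0 + 2" using less.prems by linarith
    then show ?case
    proof cases
      case 3
      define k where "k = m - 2"
      have k: "m = k + 2" "m0 \<le> k" using 3 by (auto simp: k_def)
      have "\<bar>L k - real k * c / 2\<bar> \<le> K + real k * e / 2" using k by (intro less.IH) auto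
      moreover have "\<bar>L (k + 2) - L k - c\<bar> < e" using m0 k by simp
      ultimately show ?thesis using k by (simp add: field_simps abs_le_iff abs_less_iff)
    qed (use e in \<open>auto simp: K_def\<close>)
  qed
  obtain m1 where m1: "K / e * 4 < real m1" using reals_Archimedean2 by blast
  have "norm (L m / real m - c / 2) < e" if m: "m \<ge> max m0 (Suc m1)" for m
  proof -
    have mp: "real m > 0" using m by simp
    have "K * 4 < real m1 * e" using m1 e by (simp add: field_simps)
    also have "real m1 * e \<le> real m * e" using m e by (intro mult_right_mono) auto
    finally have "K * 4 < real m * e" .
    moreover have "\<bar>L m - real m * c / 2\<bar> \<le> K + real m * e / 2" using bound m by simp
    moreover have "K \<ge> 0" by (simp add: K_def)
    ultimately have "\<bar>L m - real m * c / 2\<bar> < real m * e" using mp e by simp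
    moreover have "L m / real m - c / 2 = (L m - real m * c / 2) / real m" using mp by (simp add: field_simps)
    ultimately show ?thesis using mp by (simp add: field_simps abs_divide)
  qed
  then show "\<exists>no. \<forall>m\<ge>no. norm (L m / real m - c / 2) < e" by blast
qed

text \<open>The increment tends to \<open>ln (2 pi) + 1\<close>, because
  \<open>m / 2 * ln (1 + 2 / m)\<close> tends to 1. This is the origin of the term with
  \<open>2 pi e\<close> in the threshold.\<close>

lemma log_ball_limit: "(\<lambda>m. log_ball m / real m) \<longlonglongrightarrow> ln (2 * pi * exp 1) / 2"
proof (rule ratio_tendsto_of_increments)
  have "(\<lambda>m. ln (2 * pi) + real m / 2 * ln (1 + 2 / real m)) \<longlonglongrightarrow> ln (2 * pi) + 1"
    by (intro tendsto_add tendsto_const) real_asymp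
  also have "ln (2 * pi) + 1 = ln (2 * pi * exp 1)" by (simp add: ln_mult)
  finally have lim: "(\<lambda>m. ln (2 * pi) + real m / 2 * ln (1 + 2 / real m)) \<longlonglongrightarrow> ln (2 * pi * exp 1)" .
  show "(\<lambda>m. log_ball (m + 2) - log_ball m) \<longlonglongrightarrow> ln (2 * pi * exp 1)"
    by (rule Lim_transform_eventually[OF lim], rule eventually_sequentiallyI[of 1]) (simp add: log_ball_rec)
qed

lemma exp_log_ball: "exp (log_ball m) = unit_ball_vol (real m) * sqrt (real m) ^ m"
  by (cases "m = 0") (auto simp: log_ball_def)

section \<open>Marked Poisson processes\<close>

lemma num_points_suminf: "num_points T A \<omega> = (\<Sum>k. indicator A (T k \<omega>))"
proof -
  have "num_points T A \<omega> = (\<integral>\<^sup>+k. indicator {k. T k \<omega> \<in> A} k \<partial>count_space UNIV)"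
    by (simp add: num_points_def)
  also have "\<dots> = (\<Sum>k. indicator A (T k \<omega>))"
    by (subst nn_integral_count_space_nat) (auto intro!: suminf_cong simp: indicator_def)
  finally show ?thesis .
qed

lemma measurable_num_points:
  assumes [measurable]: "\<And>k. T k \<in> measurable M N" "A \<in> sets N"
  shows "num_points T A \<in> borel_measurable M"
  unfolding num_points_suminf[abs_def] by measurable

lemma exp_sums_real: "(\<lambda>j. x ^ j / fact j) sums exp (x :: real)"
  using exp_converges[of x] by (simp add: field_simps)

text \<open>The prescribed probabilities add up to 1, hence the extended count is almost surely a
  natural number and the integral is a sum over its values.\<close>

lemma (in prob_space) poisson_nn_integral:
  fixes N :: "'a \<Rightarrow> ennreal" and f :: "ennreal \<Rightarrow> ennreal"
  assumes [measurable]: "N \<in> borel_measurable M" "f \<in> borel_measurable borel"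
    and N: "\<And>j :: nat. prob {\<omega> \<in> space M. N \<omega> = of_nat j} = v ^ j / fact j * exp (- v)"
  shows "(\<integral>\<^sup>+\<omega>. f (N \<omega>) \<partial>M) = (\<Sum>j. f (of_nat j) * ennreal (v ^ j / fact j * exp (- v)))"
    and "AE \<omega> in M. \<exists>j :: nat. N \<omega> = of_nat j"
proof -
  let ?A = "\<lambda>j :: nat. {\<omega> \<in> space M. N \<omega> = of_nat j}"
  have A [measurable]: "?A j \<in> events" for j by measurable
  have "(\<lambda>j. prob (?A j)) sums prob (\<Union>j. ?A j)"
    by (rule finite_measure_UNION) (auto simp: disjoint_family_on_def)
  moreover have "(\<lambda>j. prob (?A j)) sums (exp v * exp (- v))"
    unfolding N by (intro sums_mult2 exp_sums_real)
  ultimately have "prob (\<Union>j. ?A j) = 1" by (simp add: sums_iff flip: exp_add)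
  then have "AE \<omega> in M. \<omega> \<in> (\<Union>j. ?A j)" by (intro AE_prob_1)
  then show ae: "AE \<omega> in M. \<exists>j :: nat. N \<omega> = of_nat j" by eventually_elim auto
  have "(\<integral>\<^sup>+\<omega>. f (N \<omega>) \<partial>M) = (\<integral>\<^sup>+\<omega>. (\<Sum>j. f (of_nat j) * indicator (?A j) \<omega>) \<partial>M)"
  proof (intro nn_integral_cong_AE)
    show "AE \<omega> in M. f (N \<omega>) = (\<Sum>j. f (of_nat j) * indicator (?A j) \<omega>)"
      using ae AE_space
    proof eventually_elim
      case (elim \<omega>)
      then obtain j where j: "N \<omega> = of_nat j" by auto
      have "(\<Sum>i. f (of_nat i) * indicator (?A i) \<omega>) = (\<Sum>i\<in>{j}. f (of_nat i) * indicator (?A i) \<omega>)"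
        using j elim by (intro suminf_finite) (auto simp: indicator_def)
      then show ?case using j elim by simp
    qed
  qed
  also have "\<dots> = (\<Sum>j. \<integral>\<^sup>+\<omega>. f (of_nat j) * indicator (?A j) \<omega> \<partial>M)"
    by (intro nn_integral_suminf) measurable
  also have "\<dots> = (\<Sum>j. f (of_nat j) * ennreal (v ^ j / fact j * exp (- v)))"
    by (intro suminf_cong) (simp add: nn_integral_cmult_indicator emeasure_eq_measure N)
  finally show "(\<integral>\<^sup>+\<omega>. f (N \<omega>) \<partial>M) = (\<Sum>j. f (of_nat j) * ennreal (v ^ j / fact j * exp (- v)))" .
qed

lemma (in prob_space) poisson_expectation:
  fixes N :: "'a \<Rightarrow> ennreal"
  assumes "N \<in> borel_measurable M" "v \<ge> 0"
    and N: "\<And>j :: nat. prob {\<omega> \<in> space M. N \<omega> = of_nat j} = v ^ j / fact j * exp (- v)"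
  shows "(\<integral>\<^sup>+\<omega>. N \<omega> \<partial>M) = ennreal v"
proof -
  have "(\<integral>\<^sup>+\<omega>. N \<omega> \<partial>M) = (\<Sum>j. of_nat j * ennreal (v ^ j / fact j * exp (- v)))"
    using poisson_nn_integral(1)[OF assms(1) _ N, of "\<lambda>x. x"] by simp
  also have "\<dots> = (\<Sum>j. ennreal (real j * (v ^ j / fact j * exp (- v))))"
    using assms(2) by (intro suminf_cong) (subst ennreal_mult, auto simp: ennreal_of_nat_eq_real_of_nat)
  also have "(\<lambda>j. real j * (v ^ j / fact j * exp (- v))) sums v"
  proof -
    have "(\<lambda>j. v ^ j / fact j * (v * exp (- v))) sums (exp v * (v * exp (- v)))"
      by (intro sums_mult2 exp_sums_real)
    moreover have "exp v * (v * exp (- v)) = v" by (simp add: exp_minus)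
    moreover have "v ^ j / fact j * (v * exp (- v)) = real (Suc j) * (v ^ Suc j / fact (Suc j) * exp (- v))" for j
      by (simp add: fact_Suc divide_simps)
    ultimately have "(\<lambda>j. real (Suc j) * (v ^ Suc j / fact (Suc j) * exp (- v))) sums v" by (simp only:)
    from sums_Suc[OF this] show ?thesis by simp
  qed
  then have "(\<Sum>j. ennreal (real j * (v ^ j / fact j * exp (- v)))) = ennreal v"
    using assms(2) by (intro suminf_ennreal_eq) auto
  finally show ?thesis .
qed

text \<open>The Laplace transform is \<open>exp (v * (exp (- p) - 1))\<close>, and
  \<open>exp (- p) \<le> 1 / (1 + p) \<le> 1 - p / 2\<close> on the unit interval. In the
  application \<open>p\<close> is the probability of a set of marks.\<close>

lemma (in prob_space) poisson_exp_moment: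
  fixes N :: "'a \<Rightarrow> ennreal"
  assumes "N \<in> borel_measurable M" "v \<ge> 0" "0 \<le> p" "p \<le> 1"
    and N: "\<And>j :: nat. prob {\<omega> \<in> space M. N \<omega> = of_nat j} = v ^ j / fact j * exp (- v)"
  shows "(\<integral>\<^sup>+\<omega>. ennreal (exp (- p * enn2real (N \<omega>))) \<partial>M) \<le> ennreal (exp (- (v * p / 2)))"
proof -
  have "(\<integral>\<^sup>+\<omega>. ennreal (exp (- p * enn2real (N \<omega>))) \<partial>M) =
      (\<Sum>j. ennreal (exp (- p * enn2real (of_nat j))) * ennreal (v ^ j / fact j * exp (- v)))"
    using poisson_nn_integral(1)[OF assms(1) _ N, of "\<lambda>x. ennreal (exp (- p * enn2real x))"] by simp
  also have "\<dots> = (\<Sum>j. ennreal ((v * exp (- p)) ^ j / fact j * exp (- v)))"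
    using assms(2)
    by (intro suminf_cong) (simp add: ennreal_mult[symmetric] power_mult_distrib exp_of_nat_mult[symmetric] mult_ac)
  also have "\<dots> = ennreal (exp (v * exp (- p)) * exp (- v))"
    using assms(2) by (intro suminf_ennreal_eq sums_mult2 exp_sums_real) auto
  also have "\<dots> \<le> ennreal (exp (- (v * p / 2)))"
  proof (intro ennreal_leI)
    have "exp (- p) \<le> 1 / (1 + p)"
      using exp_ge_add_one_self[of p] assms by (simp add: exp_minus field_simps)
    also have "\<dots> \<le> 1 - p / 2"
      using assms mult_left_le_one_le[of p p] by (simp add: field_simps)
    finally have "v * exp (- p) \<le> v * (1 - p / 2)" using assms by (intro mult_left_mono) auto
    then show "exp (v * exp (- p)) * exp (- v) \<le> exp (- (v * p / 2))"
      by (simp flip: exp_add add: algebra_simps)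
  qed
  finally show ?thesis .
qed

context
  fixes M :: "'w measure" and n :: nat and lam :: real and T :: "nat \<Rightarrow> 'w \<Rightarrow> point"
  assumes process: "poisson_process M n lam T" and lam: "lam \<ge> 0"
begin

lemma poisson_prob_space: "prob_space M"
  using process by (simp add: poisson_process_def)

lemma measurable_poisson_point [measurable]: "T k \<in> measurable M (lebesgue_n n)"
  using process by (simp add: poisson_process_def)

lemma poisson_probability:
  assumes "A \<in> sets (lebesgue_n n)" "emeasure (lebesgue_n n) A < \<infinity>"
  shows "measure M {\<omega> \<in> space M. num_points T A \<omega> = of_nat j} =
    (lam * measure (lebesgue_n n) A) ^ j / fact j * exp (- (lam * measure (lebesgue_n n) A))"
  using process assms by (simp add: poisson_process_def)

text \<open>Summing over the enumeration exchanges with the expectation, so the left side is the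
  mean of the Poisson count of \<open>A\<close>.\<close>

lemma campbell:
  assumes A: "A \<in> sets (lebesgue_n n)" "emeasure (lebesgue_n n) A < \<infinity>"
  shows "(\<Sum>k. emeasure M (T k -` A \<inter> space M)) = ennreal lam * emeasure (lebesgue_n n) A"
proof -
  interpret prob_space M by (rule poisson_prob_space)
  have "(\<Sum>k. emeasure M (T k -` A \<inter> space M)) = (\<Sum>k. \<integral>\<^sup>+\<omega>. indicator A (T k \<omega>) \<partial>M)"
  proof (intro suminf_cong)
    fix k
    have "(\<integral>\<^sup>+\<omega>. indicator A (T k \<omega>) \<partial>M) = (\<integral>\<^sup>+\<omega>. indicator (T k -` A \<inter> space M) \<omega> \<partial>M)"
      by (intro nn_integral_cong) (auto simp: indicator_def)
    then show "emeasure M (T k -` A \<inter> space M) = (\<integral>\<^sup>+\<omega>. indicator A (T k \<omega>) \<partial>M)"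
      using A(1) measurable_poisson_point[of k] by (simp add: measurable_sets)
  qed
  also have "\<dots> = (\<integral>\<^sup>+\<omega>. num_points T A \<omega> \<partial>M)"
    unfolding num_points_suminf using A(1) measurable_poisson_point
    by (intro nn_integral_suminf[symmetric]) (auto intro: measurable_compose[OF _ borel_measurable_indicator])
  also have "\<dots> = ennreal (lam * measure (lebesgue_n n) A)"
    using A lam by (intro poisson_expectation poisson_probability measurable_num_points[OF measurable_poisson_point]) auto
  also have "\<dots> = ennreal lam * emeasure (lebesgue_n n) A"
    using A(2) lam by (simp add: ennreal_mult' emeasure_eq_ennreal_measure)
  finally show ?thesis .
qed

end

declare measurable_poisson_point [measurable del]

lemma indep_random_elements_distr:
  assumes M: "prob_space M" and I: "indep_random_elements M N Y N' Y'"
  shows "distr M (N \<Otimes>\<^sub>M N') (\<lambda>\<omega>. (Y \<omega>, Y' \<omega>)) = distr M N Y \<Otimes>\<^sub>M distr M N' Y'"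
proof -
  interpret prob_space M by fact
  have [measurable]: "Y \<in> measurable M N" "Y' \<in> measurable M N'"
    using I by (auto simp: indep_random_elements_def)
  interpret Y: prob_space "distr M N Y" by (rule prob_space_distr) measurable
  interpret Y': prob_space "distr M N' Y'" by (rule prob_space_distr) measurable
  show ?thesis
  proof (rule pair_measure_eqI[symmetric])
    fix A B assume "A \<in> sets (distr M N Y)" "B \<in> sets (distr M N' Y')"
    then have AB [measurable]: "A \<in> sets N" "B \<in> sets N'" by auto
    have "prob ((Y -` A \<inter> space M) \<inter> (Y' -` B \<inter> space M)) = prob (Y -` A \<inter> space M) * prob (Y' -` B \<inter> space M)"
      using I AB by (intro indep_setD[of "{Y -` A \<inter> space M |A. A \<in> sets N}" "{Y' -` B \<inter> space M |B. B \<in> sets N'}"])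
        (auto simp: indep_random_elements_def)
    moreover have "(\<lambda>\<omega>. (Y \<omega>, Y' \<omega>)) -` (A \<times> B) \<inter> space M = (Y -` A \<inter> space M) \<inter> (Y' -` B \<inter> space M)"
      by auto
    ultimately show "emeasure (distr M N Y) A * emeasure (distr M N' Y') B =
        emeasure (distr M (N \<Otimes>\<^sub>M N') (\<lambda>\<omega>. (Y \<omega>, Y' \<omega>))) (A \<times> B)"
      by (simp add: emeasure_distr emeasure_eq_measure ennreal_mult)
  qed (auto simp: Y.sigma_finite_measure Y'.sigma_finite_measure Y.sigma_finite_measure_axioms Y'.sigma_finite_measure_axioms intro!: sets_pair_measure_cong)
qed

context
  fixes M :: "'w measure" and n :: nat and lam :: real and \<mu> :: "real measure"
    and T :: "nat \<Rightarrow> 'w \<Rightarrow> point" and X :: "nat \<Rightarrow> 'w \<Rightarrow> real"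
  assumes process: "marked_poisson_process M n lam \<mu> T X" and lam: "lam \<ge> 0"
begin

lemma marked_poisson: "poisson_process M n lam T"
  using process by (simp add: marked_poisson_process_def)

lemma marked_prob_space: "prob_space M"
  by (rule poisson_prob_space[OF marked_poisson lam])

lemma measurable_marked_point [measurable]: "T k \<in> measurable M (lebesgue_n n)"
  by (rule measurable_poisson_point[OF marked_poisson lam])

lemma indep_marks: "prob_space.indep_vars M (\<lambda>_. borel) X UNIV"
  using process by (simp add: marked_poisson_process_def)

lemma measurable_mark [measurable]: "X k \<in> borel_measurable M"
  using indep_marks by (auto simp: prob_space.indep_vars_def[OF marked_prob_space])

lemma distr_mark: "distr M borel (X k) = \<mu>"
  using process by (simp add: marked_poisson_process_def)

lemma mark_prob_space: "prob_space \<mu>"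
  unfolding distr_mark[of 0, symmetric]
  by (rule prob_space.prob_space_distr[OF marked_prob_space]) measurable

lemma sets_mark_law [simp]: "sets \<mu> = sets borel"
  unfolding distr_mark[of 0, symmetric] by simp

lemma point_mark_indep: "indep_random_elements M (lebesgue_n n) (T k) borel (X k)"
proof -
  interpret prob_space M by (rule marked_prob_space)
  have I: "indep_set {(\<lambda>\<omega> k. T k \<omega>) -` A \<inter> space M |A. A \<in> sets (PiM UNIV (\<lambda>_. lebesgue_n n))}
      {(\<lambda>\<omega> k. X k \<omega>) -` B \<inter> space M |B. B \<in> sets (PiM UNIV (\<lambda>_. borel))}"
    using process by (simp add: marked_poisson_process_def indep_random_elements_def)
  show ?thesis unfolding indep_random_elements_def
  proof (intro conjI indep_setI)
    fix a b assume "a \<in> {T k -` A \<inter> space M |A. A \<in> sets (lebesgue_n n)}" "b \<in> {X k -` B \<inter> space M |B. B \<in> sets borel}"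
    then obtain A B where AB [measurable]: "A \<in> sets (lebesgue_n n)" "B \<in> sets borel"
      and ab: "a = T k -` A \<inter> space M" "b = X k -` B \<inter> space M" by blast
    have "a = (\<lambda>\<omega> k. T k \<omega>) -` ((\<lambda>t. t k) -` A \<inter> space (PiM UNIV (\<lambda>_. lebesgue_n n))) \<inter> space M"
      using measurable_space[OF measurable_marked_point] by (auto simp: ab space_PiM)
    moreover have "b = (\<lambda>\<omega> k. X k \<omega>) -` ((\<lambda>t. t k) -` B \<inter> space (PiM UNIV (\<lambda>_. borel))) \<inter> space M"
      by (auto simp: ab space_PiM)
    moreover have "(\<lambda>t. t k) -` A \<inter> space (PiM UNIV (\<lambda>_. lebesgue_n n)) \<in> sets (PiM UNIV (\<lambda>_. lebesgue_n n))"
      "(\<lambda>t. t k) -` B \<inter> space (PiM UNIV (\<lambda>_. borel)) \<in> sets (PiM UNIV (\<lambda>_. borel))" by measurable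
    ultimately show "prob (a \<inter> b) = prob a * prob b"
      by (intro indep_setD[OF I]) blast+
  qed (auto intro: measurable_sets[OF measurable_marked_point] measurable_sets[OF measurable_mark])
qed

text \<open>For each \<open>k\<close>, point and mark are independent, so Fubini reduces the event
  to the slices of \<open>C\<close> at fixed mark \<open>x\<close>. The sum over \<open>k\<close> is
  then taken inside the integral, where the unmarked formula applies to each slice.\<close>

lemma campbell_marked:
  assumes C [measurable]: "C \<in> sets (lebesgue_n n \<Otimes>\<^sub>M borel)"
    and fin: "\<And>x. emeasure (lebesgue_n n) {t \<in> space (lebesgue_n n). (t, x) \<in> C} < \<infinity>"
  shows "(\<Sum>k. emeasure M {\<omega> \<in> space M. (T k \<omega>, X k \<omega>) \<in> C}) =
    (\<integral>\<^sup>+x. ennreal lam * emeasure (lebesgue_n n) {t \<in> space (lebesgue_n n). (t, x) \<in> C} \<partial>\<mu>)"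
proof -
  interpret prob_space M by (rule marked_prob_space)
  interpret mu: prob_space \<mu> by (rule mark_prob_space)
  note [measurable_cong] = sets_mark_law
  let ?S = "\<lambda>x. {t \<in> space (lebesgue_n n). (t, x) \<in> C}"
  have S [measurable]: "?S x \<in> sets (lebesgue_n n)" for x by measurable
  have "emeasure M {\<omega> \<in> space M. (T k \<omega>, X k \<omega>) \<in> C} = (\<integral>\<^sup>+x. emeasure M (T k -` ?S x \<inter> space M) \<partial>\<mu>)" for k
  proof -
    interpret Tk: prob_space "distr M (lebesgue_n n) (T k)" by (rule prob_space_distr) measurable
    interpret P: pair_sigma_finite "distr M (lebesgue_n n) (T k)" \<mu> ..
    have sets: "sets (distr M (lebesgue_n n) (T k) \<Otimes>\<^sub>M \<mu>) = sets (lebesgue_n n \<Otimes>\<^sub>M borel)"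
      by (intro sets_pair_measure_cong) auto
    have "emeasure M {\<omega> \<in> space M. (T k \<omega>, X k \<omega>) \<in> C} = emeasure (distr M (lebesgue_n n \<Otimes>\<^sub>M borel) (\<lambda>\<omega>. (T k \<omega>, X k \<omega>))) C"
      by (subst emeasure_distr) (auto intro!: arg_cong[where f="emeasure M"])
    also have "\<dots> = emeasure (distr M (lebesgue_n n) (T k) \<Otimes>\<^sub>M \<mu>) C"
      unfolding indep_random_elements_distr[OF marked_prob_space point_mark_indep] distr_mark ..
    also have "\<dots> = (\<integral>\<^sup>+x. emeasure (distr M (lebesgue_n n) (T k)) ((\<lambda>t. (t, x)) -` C) \<partial>\<mu>)"
      using C sets by (intro P.emeasure_pair_measure_alt2) auto
    also have "\<dots> = (\<integral>\<^sup>+x. emeasure M (T k -` ?S x \<inter> space M) \<partial>\<mu>)"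
    proof (intro nn_integral_cong)
      fix x
      have "(\<lambda>t. (t, x)) -` C = ?S x"
        using sets.sets_into_space[OF C] by (auto simp: space_pair_measure)
      then show "emeasure (distr M (lebesgue_n n) (T k)) ((\<lambda>t. (t, x)) -` C) = emeasure M (T k -` ?S x \<inter> space M)"
        using S by (simp add: emeasure_distr)
    qed
    finally show ?thesis .
  qed
  note eq = this
  have meas: "(\<lambda>x. emeasure M (T k -` ?S x \<inter> space M)) \<in> borel_measurable \<mu>" for k
  proof -
    interpret Tk: prob_space "distr M (lebesgue_n n) (T k)" by (rule prob_space_distr) measurable
    have "(\<lambda>x. emeasure (distr M (lebesgue_n n) (T k)) {t \<in> space (distr M (lebesgue_n n) (T k)). (t, x) \<in> C}) \<in> borel_measurable \<mu>"
      by measurable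
    then show ?thesis by (simp add: emeasure_distr)
  qed
  have "(\<Sum>k. emeasure M {\<omega> \<in> space M. (T k \<omega>, X k \<omega>) \<in> C}) = (\<integral>\<^sup>+x. (\<Sum>k. emeasure M (T k -` ?S x \<inter> space M)) \<partial>\<mu>)"
    unfolding eq using meas by (intro nn_integral_suminf[symmetric]) auto
  also have "\<dots> = (\<integral>\<^sup>+x. ennreal lam * emeasure (lebesgue_n n) (?S x) \<partial>\<mu>)"
    by (intro nn_integral_cong campbell[OF marked_poisson lam] S fin)
  finally show ?thesis .
qed

section \<open>Void probabilities for points with marks in prescribed sets\<close>

lemma distr_marks: "distr M (PiM UNIV (\<lambda>_. borel)) (\<lambda>\<omega> k. X k \<omega>) = PiM UNIV (\<lambda>_. \<mu>)"
proof -
  interpret prob_space M by (rule marked_prob_space)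
  show ?thesis using indep_marks
    by (subst (asm) indep_vars_iff_distr_eq_PiM) (auto simp: distr_mark restrict_def)
qed

text \<open>\<open>K z\<close> stands for the indices of the points in the region of
  \<open>z\<close>, at fixed positions. The marks are i.i.d., and each index in \<open>K z\<close>
  contributes a factor \<open>1 - p \<le> exp (- p)\<close> with \<open>p\<close> the probability of
  \<open>B z\<close>.\<close>

lemma prob_marks_avoid:
  fixes B :: "'z \<Rightarrow> real set" and K :: "'z \<Rightarrow> nat set"
  assumes F: "finite F" and K: "\<And>z. z \<in> F \<Longrightarrow> finite (K z)" "disjoint_family_on K F"
    and B [measurable]: "\<And>z. z \<in> F \<Longrightarrow> B z \<in> sets borel"
  shows "emeasure (PiM UNIV (\<lambda>_. \<mu>)) {x \<in> space (PiM UNIV (\<lambda>_. \<mu>)). \<forall>z\<in>F. \<forall>k\<in>K z. x k \<notin> B z} \<le>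
    (\<Prod>z\<in>F. ennreal (exp (- measure \<mu> (B z) * real (card (K z)))))"
proof -
  interpret mu: prob_space \<mu> by (rule mark_prob_space)
  note [measurable_cong] = sets_mark_law
  interpret product_prob_space "\<lambda>_. \<mu>" "UNIV :: nat set" ..
  \<comment> \<open>The constraint on the mark with index \<open>k\<close>; by disjointness of the
    \<open>K z\<close> at most one \<open>z\<close> is involved.\<close>
  define D where "D k = {x. \<forall>z\<in>F. k \<in> K z \<longrightarrow> x \<notin> B z}" for k
  have spm: "space \<mu> = UNIV" using sets_eq_imp_space_eq[OF sets_mark_law] by simp
  have D: "D k \<in> sets \<mu>" for k
  proof -
    have eq: "D k = (\<Inter>z\<in>{z\<in>F. k \<in> K z}. - B z)" by (auto simp: D_def)
    show ?thesis
    proof (cases "{z\<in>F. k \<in> K z} = {}")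
      case True
      show ?thesis unfolding eq True by simp
    next
      case False
      then show ?thesis unfolding eq using F B by (simp only: sets_mark_law) (intro sets.finite_INT; auto)
    qed
  qed
  have Dle: "emeasure \<mu> (D k) \<le> ennreal (exp (- measure \<mu> (B z)))" if "z \<in> F" "k \<in> K z" for z k
  proof -
    have "emeasure \<mu> (D k) \<le> emeasure \<mu> (space \<mu> - B z)"
      using that B spm by (intro emeasure_mono) (auto simp: D_def)
    also have "\<dots> = ennreal (1 - measure \<mu> (B z))"
      using that B by (simp add: mu.emeasure_eq_measure mu.prob_compl)
    also have "\<dots> \<le> ennreal (exp (- measure \<mu> (B z)))"
      using exp_ge_add_one_self[of "- measure \<mu> (B z)"] by (intro ennreal_leI) simp
    finally show ?thesis .
  qed
  have "{x \<in> space (PiM UNIV (\<lambda>_. \<mu>)). \<forall>z\<in>F. \<forall>k\<in>K z. x k \<notin> B z} =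
      {x \<in> space (PiM UNIV (\<lambda>_. \<mu>)). \<forall>k\<in>(\<Union>z\<in>F. K z). x k \<in> D k}"
    by (auto simp: D_def)
  also have "emeasure (PiM UNIV (\<lambda>_. \<mu>)) \<dots> = (\<Prod>k\<in>(\<Union>z\<in>F. K z). emeasure \<mu> (D k))"
    using D F K by (intro emeasure_PiM_Collect) auto
  also have "\<dots> = (\<Prod>z\<in>F. \<Prod>k\<in>K z. emeasure \<mu> (D k))"
    using F K by (intro prod.UNION_disjoint) (auto simp: disjoint_family_on_def)
  also have "\<dots> \<le> (\<Prod>z\<in>F. \<Prod>k\<in>K z. ennreal (exp (- measure \<mu> (B z))))"
    using Dle by (intro prod_mono_ennreal) auto
  also have "\<dots> = (\<Prod>z\<in>F. ennreal (exp (- measure \<mu> (B z) * real (card (K z)))))"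
    by (intro prod.cong refl) (simp add: ennreal_power exp_of_nat_mult[symmetric] mult.commute)
  finally show ?thesis .
qed

text \<open>The marks are integrated first, at fixed positions, which leaves a product of
  exponentials of the counts. The counts of disjoint regions are independent Poisson variables, so
  the product of their exponential moments finishes. The factor \<open>1 / 2\<close> in the exponent
  comes from \<open>poisson_exp_moment\<close>.\<close>

lemma void_probability_bound_nat:
  fixes S :: "nat \<Rightarrow> point set" and B :: "nat \<Rightarrow> real set"
  assumes F: "finite F" and S [measurable]: "\<And>z. z \<in> F \<Longrightarrow> S z \<in> sets (lebesgue_n n)"
    and Sfin: "\<And>z. z \<in> F \<Longrightarrow> emeasure (lebesgue_n n) (S z) < \<infinity>"
    and disj: "disjoint_family_on S F" and B [measurable]: "\<And>z. z \<in> F \<Longrightarrow> B z \<in> sets borel"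
  shows "measure M {\<omega> \<in> space M. \<forall>z\<in>F. \<forall>k. \<not> (T k \<omega> \<in> S z \<and> X k \<omega> \<in> B z)} \<le>
    (\<Prod>z\<in>F. exp (- (lam * measure (lebesgue_n n) (S z) * measure \<mu> (B z) / 2)))"
proof -
  interpret prob_space M by (rule marked_prob_space)
  interpret mu: prob_space \<mu> by (rule mark_prob_space)
  note [measurable_cong] = sets_mark_law
  let ?NT = "PiM (UNIV :: nat set) (\<lambda>_. lebesgue_n n)" and ?NX = "PiM (UNIV :: nat set) (\<lambda>_. borel :: real measure)"
  let ?PX = "PiM (UNIV :: nat set) (\<lambda>_. \<mu>)"
  let ?Ts = "\<lambda>\<omega> k. T k \<omega>" and ?Xs = "\<lambda>\<omega> k. X k \<omega>"
  have Ts [measurable]: "?Ts \<in> measurable M ?NT" by (rule measurable_PiM_single') (auto simp: measurable_space[OF measurable_marked_point])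
  have Xs [measurable]: "?Xs \<in> measurable M ?NX" by (rule measurable_PiM_single') auto
  have setsPX: "sets ?PX = sets ?NX" by (intro sets_PiM_cong) auto
  interpret PX: prob_space ?PX by (intro prob_space_PiM mark_prob_space)
  interpret PT: prob_space "distr M ?NT ?Ts" by (rule prob_space_distr) measurable
  interpret P: pair_sigma_finite "distr M ?NT ?Ts" ?PX ..
  define V where "V = {(t, x) \<in> space (?NT \<Otimes>\<^sub>M ?NX). \<forall>z\<in>F. \<forall>k. \<not> (t k \<in> S z \<and> x k \<in> B z)}"
  have Veq: "V = {p \<in> space (?NT \<Otimes>\<^sub>M ?NX). \<forall>z\<in>F. \<forall>k. \<not> (fst p k \<in> S z \<and> snd p k \<in> B z)}"
    by (auto simp: V_def)
  have V: "V \<in> sets (?NT \<Otimes>\<^sub>M ?NX)"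
    unfolding Veq
  proof (intro sets.sets_Collect_finite_All F sets.sets_Collect_countable_All)
    fix z k assume [simp]: "z \<in> F"
    show "{p \<in> space (?NT \<Otimes>\<^sub>M ?NX). \<not> (fst p k \<in> S z \<and> snd p k \<in> B z)} \<in> sets (?NT \<Otimes>\<^sub>M ?NX)"
      using S[of z] B[of z] by measurable
  qed
  have joint: "distr M (?NT \<Otimes>\<^sub>M ?NX) (\<lambda>\<omega>. (?Ts \<omega>, ?Xs \<omega>)) = distr M ?NT ?Ts \<Otimes>\<^sub>M ?PX"
    using process by (simp add: marked_poisson_process_def indep_random_elements_distr[OF marked_prob_space] flip: distr_marks)
  let ?N = "\<lambda>z. num_points T (S z)"
  have N [measurable]: "?N z \<in> borel_measurable M" if "z \<in> F" for z
    by (rule measurable_num_points[OF measurable_marked_point S[OF that]])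
  have Npois: "prob {\<omega> \<in> space M. ?N z \<omega> = of_nat j} =
      (lam * measure (lebesgue_n n) (S z)) ^ j / fact j * exp (- (lam * measure (lebesgue_n n) (S z)))" if "z \<in> F" for z j
    using that by (intro poisson_probability[OF marked_poisson lam] S Sfin)
  have ae: "AE \<omega> in M. \<forall>z\<in>F. \<exists>j :: nat. ?N z \<omega> = of_nat j"
    using F N Npois by (intro AE_finite_allI poisson_nn_integral(2)[where f="\<lambda>x. x"]) auto
  \<comment> \<open>The section of \<open>V\<close> at \<open>t\<close> is an event about the marks
    alone; finite counts are required for the finite product over indices.\<close>
  have avoid: "emeasure ?PX (Pair t -` V) \<le> (\<Prod>z\<in>F. ennreal (exp (- measure \<mu> (B z) * real (card {k. t k \<in> S z}))))"
    if "t \<in> space ?NT" "\<And>z. z \<in> F \<Longrightarrow> finite {k. t k \<in> S z}" for t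
  proof -
    have "Pair t -` V = {x \<in> space ?PX. \<forall>z\<in>F. \<forall>k\<in>{k. t k \<in> S z}. x k \<notin> B z}"
      using that(1) sets_eq_imp_space_eq[OF setsPX] by (auto simp: V_def space_pair_measure)
    moreover have disjK: "disjoint_family_on (\<lambda>z. {k. t k \<in> S z}) F"
      using disj unfolding disjoint_family_on_def by blast
    ultimately show ?thesis
      using that(2) B by (simp only:) (intro prob_marks_avoid F disjK; auto)
  qed
  have cN: "enn2real (?N z \<omega>) = real (card {k. T k \<omega> \<in> S z}) \<and> finite {k. T k \<omega> \<in> S z}"
    if "?N z \<omega> = of_nat j" for z \<omega> j
    using that by (cases "finite {k. T k \<omega> \<in> S z}") (auto simp: num_points_def)
  have "emeasure M {\<omega> \<in> space M. \<forall>z\<in>F. \<forall>k. \<not> (T k \<omega> \<in> S z \<and> X k \<omega> \<in> B z)} =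
      emeasure (distr M (?NT \<Otimes>\<^sub>M ?NX) (\<lambda>\<omega>. (?Ts \<omega>, ?Xs \<omega>))) V"
    using V by (subst emeasure_distr)
      (auto simp: V_def space_pair_measure measurable_space[OF Ts] measurable_space[OF Xs] intro!: arg_cong[where f="emeasure M"])
  also have "\<dots> = (\<integral>\<^sup>+t. emeasure ?PX (Pair t -` V) \<partial>distr M ?NT ?Ts)"
    unfolding joint using V setsPX
    by (intro PX.emeasure_pair_measure_alt) (simp cong: sets_pair_measure_cong)
  also have "\<dots> = (\<integral>\<^sup>+\<omega>. emeasure ?PX (Pair (?Ts \<omega>) -` V) \<partial>M)"
  proof (rule nn_integral_distr[OF Ts])
    have "V \<in> sets (?NT \<Otimes>\<^sub>M ?PX)" using V setsPX by (simp cong: sets_pair_measure_cong)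
    then have "(\<lambda>t. emeasure ?PX (Pair t -` V)) \<in> borel_measurable ?NT" by (rule PX.measurable_emeasure_Pair)
    then show "(\<lambda>t. emeasure ?PX (Pair t -` V)) \<in> borel_measurable (distr M ?NT ?Ts)" by simp
  qed
  also have "\<dots> \<le> (\<integral>\<^sup>+\<omega>. (\<Prod>z\<in>F. ennreal (exp (- measure \<mu> (B z) * enn2real (?N z \<omega>)))) \<partial>M)"
  proof (intro nn_integral_mono_AE)
    show "AE \<omega> in M. emeasure ?PX (Pair (?Ts \<omega>) -` V) \<le> (\<Prod>z\<in>F. ennreal (exp (- measure \<mu> (B z) * enn2real (?N z \<omega>))))"
      using ae AE_space
    proof eventually_elim
      case (elim \<omega>)
      then have c: "enn2real (?N z \<omega>) = real (card {k. T k \<omega> \<in> S z})" "finite {k. T k \<omega> \<in> S z}" if "z \<in> F" for z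
        using that cN by blast+
      have "emeasure ?PX (Pair (?Ts \<omega>) -` V) \<le> (\<Prod>z\<in>F. ennreal (exp (- measure \<mu> (B z) * real (card {k. T k \<omega> \<in> S z}))))"
        using elim c(2) measurable_space[OF Ts] by (intro avoid) auto
      also have "\<dots> = (\<Prod>z\<in>F. ennreal (exp (- measure \<mu> (B z) * enn2real (?N z \<omega>))))"
        using c(1) by (intro prod.cong) auto
      finally show ?case .
    qed
  qed
  also have "\<dots> = (\<Prod>z\<in>F. \<integral>\<^sup>+\<omega>. ennreal (exp (- measure \<mu> (B z) * enn2real (?N z \<omega>))) \<partial>M)"
  proof (intro indep_vars_nn_integral F)
    have "indep_vars (\<lambda>_. borel) ?N F" using marked_poisson disj F S Sfin
      unfolding poisson_process_def by blast
    then show "indep_vars (\<lambda>_. borel) (\<lambda>z \<omega>. ennreal (exp (- measure \<mu> (B z) * enn2real (?N z \<omega>)))) F"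
      by (rule indep_vars_compose2) measurable
  qed auto
  also have "\<dots> \<le> (\<Prod>z\<in>F. ennreal (exp (- (lam * measure (lebesgue_n n) (S z) * measure \<mu> (B z) / 2))))"
    using lam N Npois by (intro prod_mono_ennreal poisson_exp_moment) auto
  also have "\<dots> = ennreal (\<Prod>z\<in>F. exp (- (lam * measure (lebesgue_n n) (S z) * measure \<mu> (B z) / 2)))"
    by (intro prod_ennreal) auto
  finally show ?thesis by (subst (asm) emeasure_eq_measure) (simp add: prod_nonneg)
qed

text \<open>The definition of a Poisson process indexes families of regions by naturals; here the
  index set is enumerated so that it may consist of sites.\<close>

lemma void_probability_bound:
  fixes S :: "'z \<Rightarrow> point set" and B :: "'z \<Rightarrow> real set"
  assumes F: "finite F" and S: "\<And>z. z \<in> F \<Longrightarrow> S z \<in> sets (lebesgue_n n)"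
    and Sfin: "\<And>z. z \<in> F \<Longrightarrow> emeasure (lebesgue_n n) (S z) < \<infinity>"
    and disj: "disjoint_family_on S F" and B: "\<And>z. z \<in> F \<Longrightarrow> B z \<in> sets borel"
  shows "measure M {\<omega> \<in> space M. \<forall>z\<in>F. \<forall>k. \<not> (T k \<omega> \<in> S z \<and> X k \<omega> \<in> B z)} \<le>
    (\<Prod>z\<in>F. exp (- (lam * measure (lebesgue_n n) (S z) * measure \<mu> (B z) / 2)))"
proof -
  obtain f where f: "bij_betw f {0..<card F} F" using ex_bij_betw_nat_finite[OF F] by blast
  then have img: "f ` {0..<card F} = F" by (rule bij_betw_imp_surj_on)
  then have mem: "i < card F \<Longrightarrow> f i \<in> F" for i by auto
  have "disjoint_family_on (\<lambda>i. S (f i)) {0..<card F}"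
    using disj f mem unfolding disjoint_family_on_def bij_betw_def inj_on_def by (metis atLeastLessThan_iff)
  then have "measure M {\<omega> \<in> space M. \<forall>i\<in>{0..<card F}. \<forall>k. \<not> (T k \<omega> \<in> S (f i) \<and> X k \<omega> \<in> B (f i))} \<le>
    (\<Prod>i\<in>{0..<card F}. exp (- (lam * measure (lebesgue_n n) (S (f i)) * measure \<mu> (B (f i)) / 2)))"
    using mem S Sfin B by (intro void_probability_bound_nat) auto
  also have "\<dots> = (\<Prod>z\<in>F. exp (- (lam * measure (lebesgue_n n) (S z) * measure \<mu> (B z) / 2)))"
    using f by (rule prod.reindex_bij_betw)
  also have "{\<omega> \<in> space M. \<forall>i\<in>{0..<card F}. \<forall>k. \<not> (T k \<omega> \<in> S (f i) \<and> X k \<omega> \<in> B (f i))} =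
      {\<omega> \<in> space M. \<forall>z\<in>f ` {0..<card F}. \<forall>k. \<not> (T k \<omega> \<in> S z \<and> X k \<omega> \<in> B z)}"
    by simp
  finally show ?thesis unfolding img .
qed

end

declare measurable_marked_point [measurable del] measurable_mark [measurable del] sets_mark_law [simp del]

section \<open>Consequences of the large deviations principle\<close>

locale radius_laws =
  fixes \<mu> :: "nat \<Rightarrow> real measure" and I :: "real \<Rightarrow> ereal" and Rs \<gamma> :: real
  assumes law: "\<And>n. n \<ge> 1 \<Longrightarrow> real_distribution (\<mu> n)"
    and nonneg: "\<And>n. n \<ge> 1 \<Longrightarrow> AE x in \<mu> n. 0 \<le> x"
    and Rs_pos: "0 < Rs"
    and in_probability:
      "\<And>\<epsilon>. \<epsilon> > 0 \<Longrightarrow> (\<lambda>n. measure (\<mu> n) {x. \<bar>x - Rs\<bar> > \<epsilon>}) \<longlonglongrightarrow> 0"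
    and rate: "good_rate_function I"
    and ldp: "large_deviations_principle \<mu> I"
    and moments: "\<gamma> > 1"
      "limsup (\<lambda>n. ennreal_power (\<integral>\<^sup>+x. ennreal (x powr (\<gamma> * real n)) \<partial>\<mu> n) (1 / real n)) < \<infinity>"
begin

lemma sets_law [simp]: "n \<ge> 1 \<Longrightarrow> sets (\<mu> n) = sets borel"
  using real_distribution.events_eq_borel[OF law] by simp

lemma space_law [simp]: "n \<ge> 1 \<Longrightarrow> space (\<mu> n) = UNIV"
  using real_distribution.space_eq_univ[OF law] by simp

lemma prob_space_law: "n \<ge> 1 \<Longrightarrow> prob_space (\<mu> n)"
  using law by (simp add: real_distribution_def)

lemma rate_nonneg: "0 \<le> I x"
  using rate by (simp add: good_rate_function_def)

lemma log_prob_le_iff: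
  assumes "n \<ge> (1::nat)" "0 \<le> p"
  shows "ereal (1 / real n) * ereal_log p \<le> ereal b \<longleftrightarrow> p \<le> exp (real n * b)"
proof (cases "p > 0")
  case True
  have "ln p / real n \<le> b \<longleftrightarrow> ln p \<le> real n * b" using assms by (simp add: field_simps)
  also have "\<dots> \<longleftrightarrow> p \<le> exp (real n * b)" using True by (metis exp_le_cancel_iff exp_ln)
  finally show ?thesis using True by (simp add: ereal_log_def)
next
  case False
  then have "p = 0" using assms by simp
  then show ?thesis using assms by (simp add: ereal_log_def)
qed

lemma ldp_upper:
  assumes F: "closed F" and b: "\<And>x. x \<in> F \<Longrightarrow> ereal b \<le> I x" and e: "e > 0"
  shows "\<forall>\<^sub>F n in sequentially. measure (\<mu> n) F \<le> exp (real n * (e - b))"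
proof -
  have "limsup (\<lambda>n. ereal (1 / real n) * ereal_log (measure (\<mu> n) F)) \<le> - (INF x\<in>F. I x)"
    using ldp F by (simp add: large_deviations_principle_def)
  also have "\<dots> \<le> - ereal b" by (simp only: ereal_minus_le_minus) (rule INF_greatest, rule b)
  also have "\<dots> < ereal (e - b)" using e by simp
  finally have "\<forall>\<^sub>F n in sequentially. ereal (1 / real n) * ereal_log (measure (\<mu> n) F) < ereal (e - b)"
    by (rule Limsup_lessD)
  then show ?thesis using eventually_ge_at_top[of 1]
    by eventually_elim (simp add: log_prob_le_iff[symmetric])
qed

lemma ldp_lower:
  assumes G: "open G" "x \<in> G" and b: "I x < ereal b"
  shows "\<forall>\<^sub>F n in sequentially. exp (- (real n * b)) \<le> measure (\<mu> n) G"
proof -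
  have "- ereal b < - I x" using b by (simp only: ereal_minus_less_minus)
  also have "\<dots> \<le> - (INF x\<in>G. I x)" using G by (simp only: ereal_minus_le_minus) (rule INF_lower)
  also have "\<dots> \<le> liminf (\<lambda>n. ereal (1 / real n) * ereal_log (measure (\<mu> n) G))"
    using ldp G by (simp add: large_deviations_principle_def)
  finally have "ereal (- b) < liminf (\<lambda>n. ereal (1 / real n) * ereal_log (measure (\<mu> n) G))" by simp
  then have "\<forall>\<^sub>F n in sequentially. ereal (- b) < ereal (1 / real n) * ereal_log (measure (\<mu> n) G)"
    by (rule less_LiminfD)
  then show ?thesis using eventually_ge_at_top[of 1]
  proof eventually_elim
    case (elim n)
    then have "\<not> ereal (1 / real n) * ereal_log (measure (\<mu> n) G) \<le> ereal (- b)" by (simp only: not_le)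
    then have "\<not> (measure (\<mu> n) G \<le> exp (real n * (- b)))"
      using log_prob_le_iff[of n "measure (\<mu> n) G" "- b"] elim(2) by simp
    then show ?case by simp
  qed
qed

lemma prob_near_Rs:
  assumes "e > 0" shows "(\<lambda>n. measure (\<mu> n) {Rs - e..Rs + e}) \<longlonglongrightarrow> 1"
proof -
  have "\<forall>\<^sub>F n in sequentially. 1 - measure (\<mu> n) {x. \<bar>x - Rs\<bar> > e} = measure (\<mu> n) {Rs - e..Rs + e}"
    using eventually_ge_at_top[of 1]
  proof eventually_elim
    case (elim n)
    interpret prob_space "\<mu> n" by (rule prob_space_law) fact
    have "{x. \<bar>x - Rs\<bar> > e} \<in> sets borel" by measurable
    moreover have "space (\<mu> n) - {x. \<bar>x - Rs\<bar> > e} = {Rs - e..Rs + e}" using elim by auto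
    ultimately show ?case using elim prob_compl[of "{x. \<bar>x - Rs\<bar> > e}"] by simp
  qed
  moreover have "(\<lambda>n. 1 - measure (\<mu> n) {x. \<bar>x - Rs\<bar> > e}) \<longlonglongrightarrow> 1 - 0"
    using assms by (intro tendsto_diff tendsto_const in_probability)
  ultimately show ?thesis using Lim_transform_eventually by fastforce
qed

text \<open>If \<open>I Rs\<close> were positive, lower semicontinuity would bound \<open>I\<close>
  below by some \<open>c > 0\<close> near \<open>Rs\<close>. The upper bound of the large deviations
  principle would make a neighbourhood of \<open>Rs\<close> exponentially unlikely, whereas its
  probability tends to 1.\<close>

lemma rate_Rs: "I Rs = 0"
proof (rule ccontr)
  assume "I Rs \<noteq> 0"
  then have "0 < I Rs" using rate_nonneg[of Rs] by (simp add: order_less_le)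
  then obtain c where c: "0 < ereal c" "ereal c < I Rs" using ereal_dense2 by blast
  have "ereal c < Liminf (at Rs) I"
    using c rate unfolding good_rate_function_def by (meson less_le_trans)
  then have "\<forall>\<^sub>F x in at Rs. ereal c < I x" by (rule less_LiminfD)
  then obtain d where d: "d > 0" "\<And>x. x \<noteq> Rs \<Longrightarrow> dist x Rs < d \<Longrightarrow> ereal c < I x"
    unfolding eventually_at by blast
  have "ereal c \<le> I x" if "x \<in> {Rs - d / 2..Rs + d / 2}" for x
  proof (cases "x = Rs")
    case False
    then show ?thesis using that d by (auto simp: dist_real_def abs_if intro!: less_imp_le)
  qed (use c in simp)
  then have "\<forall>\<^sub>F n in sequentially. measure (\<mu> n) {Rs - d / 2..Rs + d / 2} \<le> exp (real n * (c / 2 - c))"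
    using c by (intro ldp_upper) auto
  moreover have "\<forall>\<^sub>F n in sequentially. measure (\<mu> n) {Rs - d / 2..Rs + d / 2} > exp (- c / 2)"
    using d c by (intro order_tendstoD(1)[OF prob_near_Rs]) auto
  ultimately have "\<forall>\<^sub>F n::nat in sequentially. False" using eventually_ge_at_top[of 1]
  proof eventually_elim
    case (elim n)
    then have "exp (- c / 2) < exp (real n * (c / 2 - c))" by linarith
    then have "- c / 2 < real n * (c / 2 - c)" by (simp only: exp_less_cancel_iff)
    then have "real n * c < c" by (simp add: algebra_simps)
    moreover have "1 * c \<le> real n * c" using elim c by (intro mult_right_mono) auto
    ultimately show ?case by simp
  qed
  then show False by simp
qed

lemma moment_bound:
  obtains K where "K > 0" "\<forall>\<^sub>F n in sequentially. (\<integral>\<^sup>+x. ennreal (x powr (\<gamma> * real n)) \<partial>\<mu> n) \<le> ennreal (K ^ n)"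
proof -
  let ?m = "\<lambda>n. \<integral>\<^sup>+x. ennreal (x powr (\<gamma> * real n)) \<partial>\<mu> n"
  obtain L where L: "limsup (\<lambda>n. ennreal_power (?m n) (1 / real n)) = ennreal L" "L \<ge> 0"
    using moments(2) by (cases "limsup (\<lambda>n. ennreal_power (?m n) (1 / real n))") auto
  then have "limsup (\<lambda>n. ennreal_power (?m n) (1 / real n)) < ennreal (L + 1)" by (simp add: ennreal_less_iff)
  then have "\<forall>\<^sub>F n in sequentially. ennreal_power (?m n) (1 / real n) < ennreal (L + 1)" by (rule Limsup_lessD)
  then have "\<forall>\<^sub>F n in sequentially. ?m n \<le> ennreal ((L + 1) ^ n)" using eventually_ge_at_top[of 1]
  proof eventually_elim
    case (elim n)
    then obtain y where y: "?m n = ennreal y" "y \<ge> 0"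
      by (cases "?m n") (auto simp: ennreal_power_def)
    then have "y powr (1 / real n) \<le> L + 1"
      using elim by (auto simp: ennreal_power_def ennreal_less_iff)
    then have "(y powr (1 / real n)) powr real n \<le> (L + 1) powr real n" by (intro powr_mono2) auto
    then have "y \<le> (L + 1) ^ n" using y elim L by (simp add: powr_powr powr_realpow)
    then show ?case using y by (simp add: ennreal_leI)
  qed
  then show ?thesis using that[of "L + 1"] L by simp
qed

text \<open>Markov's inequality for the moment of order \<open>\<gamma> * n\<close> bounds the mass
  of \<open>{r<..}\<close> by \<open>(K / r powr \<gamma>) ^ n\<close>, and the large deviations
  lower bound forces it to be at least \<open>exp (- (n * b))\<close> whenever
  \<open>b > I R\<close>. So \<open>I\<close> grows at least like \<open>\<gamma> * ln R\<close>,
  faster than \<open>ln (R + Rs)\<close>.\<close>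

lemma rate_lower_bound:
  obtains k where "\<And>r R. 0 < r \<Longrightarrow> r < R \<Longrightarrow> ereal (\<gamma> * ln r - k) \<le> I R"
proof -
  obtain K where K: "K > 0" "\<forall>\<^sub>F n in sequentially. (\<integral>\<^sup>+x. ennreal (x powr (\<gamma> * real n)) \<partial>\<mu> n) \<le> ennreal (K ^ n)"
    by (rule moment_bound)
  have "ereal (\<gamma> * ln r - ln K) \<le> I R" if r: "0 < r" "r < R" for r R
  proof (rule ccontr)
    assume "\<not> ereal (\<gamma> * ln r - ln K) \<le> I R"
    then obtain b where b: "I R < ereal b" "b < \<gamma> * ln r - ln K"
      using ereal_dense2[of "I R" "ereal (\<gamma> * ln r - ln K)"] by (auto simp: not_le)
    have "\<forall>\<^sub>F n in sequentially. exp (- (real n * b)) \<le> measure (\<mu> n) {r<..}"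
      using b r by (intro ldp_lower) auto
    then have "\<forall>\<^sub>F n::nat in sequentially. False" using K(2) eventually_ge_at_top[of 1]
    proof eventually_elim
      case (elim n)
      interpret prob_space "\<mu> n" by (rule prob_space_law) fact
      have "ennreal (r powr (\<gamma> * real n) * prob {r<..}) = (\<integral>\<^sup>+x. ennreal (r powr (\<gamma> * real n)) * indicator {r<..} x \<partial>\<mu> n)"
        using elim by (subst nn_integral_cmult_indicator) (auto simp: emeasure_eq_measure ennreal_mult)
      also have "\<dots> \<le> (\<integral>\<^sup>+x. ennreal (x powr (\<gamma> * real n)) \<partial>\<mu> n)"
        using r moments(1) by (intro nn_integral_mono) (auto simp: indicator_def intro!: ennreal_leI powr_mono2)
      also have "\<dots> \<le> ennreal (K ^ n)" by fact
      finally have "r powr (\<gamma> * real n) * prob {r<..} \<le> K ^ n" using K by simp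
      moreover have "r powr (\<gamma> * real n) * exp (- (real n * b)) \<le> r powr (\<gamma> * real n) * prob {r<..}"
        using elim by (intro mult_left_mono) auto
      moreover have "r powr (\<gamma> * real n) * exp (- (real n * b)) = exp (real n * (\<gamma> * ln r - b))"
        using r by (simp add: powr_def algebra_simps flip: exp_add)
      moreover have "K ^ n = exp (real n * ln K)" using K by (simp add: exp_of_nat_mult)
      ultimately have "exp (real n * (\<gamma> * ln r - b)) \<le> exp (real n * ln K)" by linarith
      then have "real n * (\<gamma> * ln r - b) \<le> real n * ln K" by (simp only: exp_le_cancel_iff)
      then show ?case using elim b by simp
    qed
    then show False by simp
  qed
  then show ?thesis using that by blast
qed

text \<open>The infimum is finite: \<open>R = Rs\<close> bounds it above, the growth of
  \<open>I\<close> below. The inequality extends from \<open>R \<ge> Rs\<close> to all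
  \<open>R \<ge> 0\<close>, since for smaller \<open>R\<close> its left side is at most
  \<open>ln (2 * Rs) + v \<le> 0\<close>.\<close>

lemma threshold_value:
  obtains v where "(INF R\<in>{Rs..}. I R - ereal (ln (R + Rs))) = ereal v"
    "\<And>R. 0 \<le> R \<Longrightarrow> ereal (ln (R + Rs) + v) \<le> I R"
proof -
  let ?J = "INF R\<in>{Rs..}. I R - ereal (ln (R + Rs))"
  obtain k where k: "\<And>r R. 0 < r \<Longrightarrow> r < R \<Longrightarrow> ereal (\<gamma> * ln r - k) \<le> I R" by (rule rate_lower_bound) blast
  have upper: "?J \<le> ereal (- ln (2 * Rs))"
    using INF_lower[of Rs "{Rs..}" "\<lambda>R. I R - ereal (ln (R + Rs))"] by (simp add: rate_Rs)
  have lower: "ereal ((\<gamma> - 1) * ln Rs - (\<gamma> + 1) * ln 2 - k) \<le> ?J"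
  proof (rule INF_greatest)
    fix R assume "R \<in> {Rs..}"
    then have R: "R \<ge> Rs" "R > 0" using Rs_pos by auto
    have "ln (R + Rs) \<le> ln (2 * R)" using R Rs_pos by simp
    also have "\<dots> = ln 2 + ln R" using R by (simp add: ln_mult)
    finally have 1: "ln (R + Rs) \<le> ln 2 + ln R" .
    have "(\<gamma> - 1) * ln Rs \<le> (\<gamma> - 1) * ln R" using R Rs_pos moments(1) by (intro mult_left_mono) auto
    moreover have "\<gamma> * ln (R / 2) = \<gamma> * ln R - \<gamma> * ln 2" using R by (simp add: ln_div right_diff_distrib)
    ultimately have "(\<gamma> - 1) * ln Rs - (\<gamma> + 1) * ln 2 - k \<le> (\<gamma> * ln (R / 2) - k) - ln (R + Rs)"
      using 1 unfolding left_diff_distrib distrib_right by linarith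
    then have "ereal ((\<gamma> - 1) * ln Rs - (\<gamma> + 1) * ln 2 - k) \<le> ereal (\<gamma> * ln (R / 2) - k) - ereal (ln (R + Rs))" by simp
    \<comment> \<open>The radius \<open>R / 2\<close> provides the strict inequality
      \<open>r < R\<close> of \<open>rate_lower_bound\<close>.\<close>
    also have "\<dots> \<le> I R - ereal (ln (R + Rs))" using k[of "R / 2" R] R by (intro ereal_minus_mono) auto
    finally show "ereal ((\<gamma> - 1) * ln Rs - (\<gamma> + 1) * ln 2 - k) \<le> I R - ereal (ln (R + Rs))" .
  qed
  obtain v where v: "?J = ereal v" using upper lower by (cases ?J) auto
  have vle: "v \<le> - ln (2 * Rs)" using upper v by simp
  have "ereal (ln (R + Rs) + v) \<le> I R" if "0 \<le> R" for R
  proof (cases "R \<ge> Rs")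
    case True
    then have "ereal v \<le> I R - ereal (ln (R + Rs))" unfolding v[symmetric] by (intro INF_lower) auto
    then show ?thesis by (cases "I R") (auto simp: algebra_simps)
  next
    case False
    then have "ln (R + Rs) \<le> ln (2 * Rs)" using that Rs_pos by simp
    then have "ereal (ln (R + Rs) + v) \<le> 0" using vle by simp
    then show ?thesis using rate_nonneg order_trans by blast
  qed
  with v show ?thesis using that by blast
qed

text \<open>A bounded range of radii is cut into \<open>m\<close> intervals of length
  \<open>d\<close>, each controlled by the large deviations principle, and the tail is controlled by
  the moment of order \<open>\<gamma> * n\<close>. Mesh, large deviations error and number of terms
  each use \<open>e / 4\<close> of the exponent. Having \<open>c\<close> strictly above
  \<open>Rs\<close> leaves room for the radius of the ball at the origin.\<close>

lemma laplace_upper_bound: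
  assumes v: "\<And>R. 0 \<le> R \<Longrightarrow> ereal (ln (R + Rs) + v) \<le> I R" and e: "e > 0"
  obtains c where "c > Rs" "\<forall>\<^sub>F n in sequentially. (\<integral>\<^sup>+x. ennreal ((c + x) ^ n) \<partial>\<mu> n) \<le> ennreal (exp (real n * (e - v)))"
proof -
  obtain K where K: "K > 0" "\<forall>\<^sub>F n in sequentially. (\<integral>\<^sup>+x. ennreal (x powr (\<gamma> * real n)) \<partial>\<mu> n) \<le> ennreal (K ^ n)"
    by (rule moment_bound)
  \<comment> \<open>With this mesh \<open>c + a (Suc i) = a i + Rs + 2 * d\<close> is at most
    \<open>(a i + Rs) * exp (2 * d / Rs)\<close>, that is
    \<open>(a i + Rs) * exp (e / 4)\<close>.\<close>
  define d where "d = e * Rs / 8"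
  define c where "c = Rs + d"
  have d: "d > 0" using e Rs_pos by (simp add: d_def)
  \<comment> \<open>Beyond \<open>a m = m * d\<close> one has \<open>c + x \<le> 2 * x\<close>, and
    each factor of the tail bound \<open>(2 * K / a m powr (\<gamma> - 1)) ^ n\<close> is at most
    \<open>exp (- v)\<close>.\<close>
  have "filterlim (\<lambda>m. (real m * d) powr (\<gamma> - 1)) at_top sequentially"
    using d moments(1) by real_asymp
  then have "\<forall>\<^sub>F m in sequentially. 2 * K * exp v \<le> (real m * d) powr (\<gamma> - 1)"
    by (simp add: filterlim_at_top)
  moreover have "\<forall>\<^sub>F m in sequentially. c \<le> real m * d" using d by real_asymp
  ultimately have "\<forall>\<^sub>F m in sequentially. 2 * K * exp v \<le> (real m * d) powr (\<gamma> - 1) \<and> c \<le> real m * d"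
    by (rule eventually_conj)
  then obtain m :: nat where m: "2 * K * exp v \<le> (real m * d) powr (\<gamma> - 1)" "c \<le> real m * d"
    using eventually_happens'[OF sequentially_bot] by blast
  define a where "a i = real i * d" for i
  have a0: "0 \<le> a i" for i using d by (simp add: a_def)
  \<comment> \<open>Closed half-lines replace the intervals: the lower bound
    \<open>ln (x + Rs) + v\<close> of the rate increases in \<open>x\<close>, so its least value is
    at the left end.\<close>
  have "\<forall>\<^sub>F n in sequentially. measure (\<mu> n) {a i..} \<le> exp (real n * (e / 4 - (ln (a i + Rs) + v)))" for i
    using e a0[of i] order_trans[OF _ v] Rs_pos by (intro ldp_upper) (auto intro!: order_trans[OF _ v])
  then have P: "\<forall>\<^sub>F n in sequentially. \<forall>i\<in>{..<m}. measure (\<mu> n) {a i..} \<le> exp (real n * (e / 4 - (ln (a i + Rs) + v)))"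
    by (intro eventually_ball_finite) auto
  have "\<forall>\<^sub>F n in sequentially. real m + 1 \<le> exp (real n * (e / 4))" using e by real_asymp
  with P K(2) eventually_ge_at_top[of 1]
  have "\<forall>\<^sub>F n in sequentially. (\<integral>\<^sup>+x. ennreal ((c + x) ^ n) \<partial>\<mu> n) \<le> ennreal (exp (real n * (e - v)))"
  proof eventually_elim
    case (elim n)
    interpret prob_space "\<mu> n" by (rule prob_space_law) fact
    have [measurable_cong]: "sets (\<mu> n) = sets borel" using elim(3) by simp
    let ?tail = "\<lambda>x. ennreal ((2 / (a m) powr (\<gamma> - 1)) ^ n) * ennreal (x powr (\<gamma> * real n))"
    have am: "a m > 0" "a m \<ge> c" using m d Rs_pos by (auto simp: a_def c_def)
    have pw: "ennreal ((c + x) ^ n) \<le> (\<Sum>i<m. ennreal ((c + a (Suc i)) ^ n) * indicator {a i..} x) + ?tail x"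
      if x: "0 \<le> x" for x
    proof (cases "x < a m")
      case True
      define i where "i = nat \<lfloor>x / d\<rfloor>"
      have "real i \<le> x / d" "x / d < real i + 1" using x d by (auto simp: i_def)
      then have i: "a i \<le> x" "x \<le> a (Suc i)" using d by (auto simp: a_def field_simps)
      have "real i * d < real m * d" using i True by (simp add: a_def)
      then have im: "i < m" using d by simp
      have "ennreal ((c + x) ^ n) \<le> ennreal ((c + a (Suc i)) ^ n) * indicator {a i..} x"
        using i x d Rs_pos by (auto simp: c_def intro!: ennreal_leI power_mono)
      also have "\<dots> \<le> (\<Sum>i<m. ennreal ((c + a (Suc i)) ^ n) * indicator {a i..} x)"
        using im by (intro member_le_sum) auto
      finally show ?thesis by (rule order_trans) simp
    next
      case False
      then have xm: "x \<ge> a m" by simp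
      have "(c + x) ^ n \<le> (2 * x) ^ n" using xm am x d Rs_pos by (intro power_mono) (auto simp: c_def)
      also have "\<dots> = 2 ^ n * x powr real n" using xm am by (simp add: power_mult_distrib powr_realpow)
      also have "\<dots> \<le> 2 ^ n * (x powr (\<gamma> * real n) / (a m powr (\<gamma> - 1)) ^ n)"
      proof (intro mult_left_mono)
        have "(a m powr (\<gamma> - 1)) ^ n = a m powr ((\<gamma> - 1) * real n)"
          using am by (simp add: powr_powr flip: powr_realpow)
        also have "\<dots> \<le> x powr ((\<gamma> - 1) * real n)" using xm am moments(1) by (intro powr_mono2) auto
        finally have "x powr real n * (a m powr (\<gamma> - 1)) ^ n \<le> x powr real n * x powr ((\<gamma> - 1) * real n)"
          by (intro mult_left_mono) auto
        also have "\<dots> = x powr (\<gamma> * real n)" by (simp add: algebra_simps flip: powr_add)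
        finally show "x powr real n \<le> x powr (\<gamma> * real n) / (a m powr (\<gamma> - 1)) ^ n"
          using am by (simp add: field_simps)
      qed auto
      also have "\<dots> = (2 / (a m) powr (\<gamma> - 1)) ^ n * x powr (\<gamma> * real n)" by (simp add: power_divide)
      finally have "ennreal ((c + x) ^ n) \<le> ?tail x" by (simp add: ennreal_leI flip: ennreal_mult)
      then show ?thesis by (rule order_trans) simp
    qed
    have "(\<integral>\<^sup>+x. ennreal ((c + x) ^ n) \<partial>\<mu> n) \<le>
        (\<integral>\<^sup>+x. (\<Sum>i<m. ennreal ((c + a (Suc i)) ^ n) * indicator {a i..} x) + ?tail x \<partial>\<mu> n)"
    proof (rule nn_integral_mono_AE)
      show "AE x in \<mu> n. ennreal ((c + x) ^ n) \<le> (\<Sum>i<m. ennreal ((c + a (Suc i)) ^ n) * indicator {a i..} x) + ?tail x"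
        using nonneg[OF elim(3)] by eventually_elim (rule pw)
    qed
    also have "\<dots> = (\<integral>\<^sup>+x. (\<Sum>i<m. ennreal ((c + a (Suc i)) ^ n) * indicator {a i..} x) \<partial>\<mu> n) + (\<integral>\<^sup>+x. ?tail x \<partial>\<mu> n)"
      by (intro nn_integral_add) measurable
    also have "(\<integral>\<^sup>+x. (\<Sum>i<m. ennreal ((c + a (Suc i)) ^ n) * indicator {a i..} x) \<partial>\<mu> n) =
        (\<Sum>i<m. ennreal ((c + a (Suc i)) ^ n) * emeasure (\<mu> n) {a i..})"
      using elim(3) by (subst nn_integral_sum) (measurable, simp add: nn_integral_cmult_indicator)
    also have "\<dots> \<le> (\<Sum>i<m. ennreal (exp (real n * (e / 2 - v))))"
    proof (intro sum_mono)
      fix i assume i: "i \<in> {..<m}"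
      have "c + a (Suc i) = (a i + Rs) * (1 + 2 * d / (a i + Rs))"
        using a0[of i] Rs_pos by (simp add: c_def a_def field_simps)
      also have "\<dots> \<le> (a i + Rs) * exp (2 * d / Rs)"
      proof (intro mult_left_mono)
        have "1 + 2 * d / (a i + Rs) \<le> 1 + 2 * d / Rs"
          using a0[of i] Rs_pos d by (intro add_left_mono divide_left_mono) auto
        also have "\<dots> \<le> exp (2 * d / Rs)" by simp
        finally show "1 + 2 * d / (a i + Rs) \<le> exp (2 * d / Rs)" .
      qed (use a0[of i] Rs_pos in simp)
      also have "\<dots> = exp (ln (a i + Rs) + e / 4)" using a0[of i] Rs_pos by (simp add: exp_add d_def)
      finally have "(c + a (Suc i)) ^ n \<le> exp (ln (a i + Rs) + e / 4) ^ n"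
        using a0[of "Suc i"] d Rs_pos by (intro power_mono) (auto simp: c_def)
      then have "(c + a (Suc i)) ^ n * prob {a i..} \<le>
          exp (real n * (ln (a i + Rs) + e / 4)) * exp (real n * (e / 4 - (ln (a i + Rs) + v)))"
        using elim(1) i by (intro mult_mono) (auto simp: exp_of_nat_mult)
      also have "\<dots> = exp (real n * (e / 2 - v))" by (simp add: algebra_simps flip: exp_add)
      finally show "ennreal ((c + a (Suc i)) ^ n) * emeasure (\<mu> n) {a i..} \<le> ennreal (exp (real n * (e / 2 - v)))"
        using a0[of "Suc i"] d Rs_pos
        by (subst emeasure_eq_measure, subst ennreal_mult[symmetric]) (auto simp: c_def intro!: ennreal_leI)
    qed
    also have "(\<integral>\<^sup>+x. ?tail x \<partial>\<mu> n) \<le> ennreal (exp (real n * (e / 2 - v)))"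
    proof -
      have "(\<integral>\<^sup>+x. ?tail x \<partial>\<mu> n) = ennreal ((2 / (a m) powr (\<gamma> - 1)) ^ n) * (\<integral>\<^sup>+x. ennreal (x powr (\<gamma> * real n)) \<partial>\<mu> n)"
        using elim(3) by (intro nn_integral_cmult) (auto simp: measurable_cong_sets[OF sets_law refl])
      also have "\<dots> \<le> ennreal ((2 / (a m) powr (\<gamma> - 1)) ^ n) * ennreal (K ^ n)"
        using elim by (intro mult_left_mono) auto
      also have "\<dots> = ennreal ((2 * K / (a m) powr (\<gamma> - 1)) ^ n)"
        using K by (simp add: power_divide power_mult_distrib flip: ennreal_mult)
      also have "\<dots> \<le> ennreal (exp (real n * (e / 2 - v)))"
      proof (intro ennreal_leI)
        have "2 * K / (a m) powr (\<gamma> - 1) \<le> exp (- v)"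
        proof -
          have P: "0 < a m powr (\<gamma> - 1)" using am by simp
          moreover have "2 * K * exp v \<le> a m powr (\<gamma> - 1)" using m(1) by (simp add: a_def)
          then have "2 * K \<le> exp (- v) * a m powr (\<gamma> - 1)" by (simp add: exp_minus field_simps)
          ultimately show ?thesis by (simp only: pos_divide_le_eq)
        qed
        also have "\<dots> \<le> exp (e / 2 - v)" using e by simp
        finally have "(2 * K / (a m) powr (\<gamma> - 1)) ^ n \<le> exp (e / 2 - v) ^ n" using K by (intro power_mono) auto
        then show "(2 * K / (a m) powr (\<gamma> - 1)) ^ n \<le> exp (real n * (e / 2 - v))" by (simp add: exp_of_nat_mult)
      qed
      finally show ?thesis .
    qed
    finally have "(\<integral>\<^sup>+x. ennreal ((c + x) ^ n) \<partial>\<mu> n) \<le>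
        (\<Sum>i<m. ennreal (exp (real n * (e / 2 - v)))) + ennreal (exp (real n * (e / 2 - v)))"
      by (simp add: add_mono)
    also have "\<dots> = ennreal ((real m + 1) * exp (real n * (e / 2 - v)))"
      by (simp add: ennreal_of_nat_eq_real_of_nat distrib_right flip: ennreal_mult ennreal_plus)
    also have "\<dots> \<le> ennreal (exp (real n * (e - v)))"
    proof (intro ennreal_leI)
      have "(real m + 1) * exp (real n * (e / 2 - v)) \<le> exp (real n * (e / 4)) * exp (real n * (e / 2 - v))"
        using elim by (intro mult_right_mono) auto
      also have "\<dots> = exp (real n * (3 * e / 4 - v))" by (simp add: algebra_simps flip: exp_add)
      also have "\<dots> \<le> exp (real n * (e - v))" using e by (simp add: mult_left_mono)
      finally show "(real m + 1) * exp (real n * (e / 2 - v)) \<le> exp (real n * (e - v))" .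
    qed
    finally show ?case .
  qed
  then show ?thesis using that[of c] d by (simp add: c_def)
qed

end

section \<open>The percolation event\<close>

lemma completion_AE_eq:
  assumes A: "A \<in> sets M" and B: "B \<subseteq> space M" and ae: "AE \<omega> in M. \<omega> \<in> A \<longleftrightarrow> \<omega> \<in> B"
  shows "measure (completion M) B = measure M A"
proof -
  obtain N where N: "N \<in> null_sets M" "{\<omega> \<in> space M. \<not> (\<omega> \<in> A \<longleftrightarrow> \<omega> \<in> B)} \<subseteq> N"
    using ae unfolding eventually_ae_filter by blast
  have AM: "A \<subseteq> space M" using A by (rule sets.sets_into_space)
  have NM: "N \<in> sets M" using N by auto
  have "B = (A - N) \<union> (B \<inter> N)" using N AM B by blast
  then have "B \<in> sets (completion M)"
    by (rule sets_completionI[OF _ _ N(1)]) (use A NM in auto)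
  then have "measure (completion M) A = measure (completion M) B"
    using A ae by (intro measure_eq_AE AE_completion) auto
  then show ?thesis using A by simp
qed

lemma space_lebesgue_n: "space (lebesgue_n n) = space_n n"
  by (simp add: lebesgue_n_def space_PiM space_n_def)

lemma measurable_edist [measurable]:
  "(\<lambda>p. edist n (fst p) (snd p)) \<in> borel_measurable (lebesgue_n n \<Otimes>\<^sub>M lebesgue_n n)"
proof -
  have coord: "(\<lambda>t. t i) \<in> measurable (lebesgue_n n) lborel" if "i < n" for i
    using that unfolding lebesgue_n_def by (intro measurable_component_singleton) simp
  have [measurable]: "(\<lambda>p. fst p i) \<in> borel_measurable (lebesgue_n n \<Otimes>\<^sub>M lebesgue_n n)"
    "(\<lambda>p. snd p i) \<in> borel_measurable (lebesgue_n n \<Otimes>\<^sub>M lebesgue_n n)" if "i < n" for i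
    using measurable_compose[OF measurable_fst coord[OF that]]
      measurable_compose[OF measurable_snd coord[OF that]] by simp_all
  show ?thesis unfolding edist_def L2_set_def
    by (intro borel_measurable_sqrt[THEN measurable_compose[rotated]] borel_measurable_sum
        borel_measurable_power borel_measurable_diff) auto
qed

lemma measurable_edist2:
  assumes "f \<in> measurable M (lebesgue_n n)" "g \<in> measurable M (lebesgue_n n)"
  shows "(\<lambda>\<omega>. edist n (f \<omega>) (g \<omega>)) \<in> borel_measurable M"
  using measurable_compose[OF measurable_Pair[OF assms] measurable_edist] by simp

lemma origin_measurable: "(\<lambda>_. origin n) \<in> measurable M (lebesgue_n n)"
  by (rule measurable_const) (simp add: space_lebesgue_n)

context
  fixes M :: "'w measure" and n :: nat and lam :: real and \<mu> :: "real measure"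
    and T :: "nat \<Rightarrow> 'w \<Rightarrow> point" and X :: "nat \<Rightarrow> 'w \<Rightarrow> real" and X0 :: "'w \<Rightarrow> real"
  assumes palm: "palm_marked_process M n lam \<mu> T X X0" and lam: "lam \<ge> 0" and n: "n \<ge> 1"
    and nonneg: "AE x in \<mu>. 0 \<le> x"
begin

lemma palm_marked: "marked_poisson_process M n lam \<mu> T X"
  using palm by (simp add: palm_marked_process_def)

lemmas palm_point_measurable [measurable] = measurable_marked_point[OF palm_marked lam]
lemmas palm_mark_measurable [measurable] = measurable_mark[OF palm_marked lam]

lemma palm_origin_mark_measurable [measurable]: "X0 \<in> borel_measurable M"
  using palm by (simp add: palm_marked_process_def)

lemma distr_origin_mark: "distr M borel X0 = \<mu>"
  using palm by (simp add: palm_marked_process_def)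

lemma palm_prob_space: "prob_space M"
  by (rule marked_prob_space[OF palm_marked lam])

lemma AE_marks_nonneg: "AE \<omega> in M. 0 \<le> X0 \<omega> \<and> (\<forall>k. 0 \<le> X k \<omega>)"
proof -
  have "AE \<omega> in M. 0 \<le> Y \<omega>" if "Y \<in> borel_measurable M" "distr M borel Y = \<mu>" for Y
    using nonneg that by (subst (asm) that(2)[symmetric], subst (asm) AE_distr_iff) auto
  then show ?thesis
    using distr_origin_mark distr_mark[OF palm_marked lam] by (simp add: AE_all_countable)
qed

text \<open>A ball with mark \<open>x\<close> meets the ball of radius \<open>c * sqrt n\<close>
  around the origin exactly when its centre is within \<open>(c + x) * sqrt n\<close>. The count
  serves both the isolation of the origin and, for arbitrary \<open>c\<close>, local finiteness. The
  clause on the sign of the mark empties the slices at negative \<open>x\<close>, where the volume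
  formula could fail.\<close>

lemma expected_ball_count:
  assumes c: "0 \<le> c"
  shows "(\<Sum>k. emeasure M {\<omega> \<in> space M. edist n (origin n) (T k \<omega>) \<le> (c + X k \<omega>) * sqrt (real n) \<and> 0 \<le> X k \<omega>}) =
    ennreal (lam * (unit_ball_vol (real n) * sqrt (real n) ^ n)) * (\<integral>\<^sup>+x. ennreal ((c + x) ^ n) \<partial>\<mu>)"
proof -
  let ?L = "lebesgue_n n"
  define C where "C = {p \<in> space (?L \<Otimes>\<^sub>M borel). edist n (origin n) (fst p) \<le> (c + snd p) * sqrt (real n) \<and> 0 \<le> (snd p :: real)}"
  have [measurable]: "(\<lambda>p. edist n (origin n) (fst p)) \<in> borel_measurable (?L \<Otimes>\<^sub>M borel)"
    by (intro measurable_edist2 origin_measurable measurable_fst)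
  have C: "C \<in> sets (?L \<Otimes>\<^sub>M borel)" unfolding C_def by measurable
  have vol: "emeasure ?L {t \<in> space ?L. (t, x) \<in> C} =
      (if 0 \<le> x then ennreal (unit_ball_vol (real n) * ((c + x) * sqrt (real n)) ^ n) else 0)" for x
  proof (cases "0 \<le> x")
    case True
    then have "{t \<in> space ?L. (t, x) \<in> C} = {t \<in> space (leb {..<n}). L2_set (\<lambda>i. t i - origin n i) {..<n} \<le> (c + x) * sqrt (real n)}"
      by (auto simp: C_def edist_def space_pair_measure lebesgue_n_def)
    then show ?thesis
      using emeasure_leb_ball[of "{..<n}" "(c + x) * sqrt (real n)" "origin n"] True c n
      by (auto simp: lebesgue_n_def lessThan_empty_iff)
  qed (simp add: C_def)
  have "(\<Sum>k. emeasure M {\<omega> \<in> space M. edist n (origin n) (T k \<omega>) \<le> (c + X k \<omega>) * sqrt (real n) \<and> 0 \<le> X k \<omega>}) =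
      (\<Sum>k. emeasure M {\<omega> \<in> space M. (T k \<omega>, X k \<omega>) \<in> C})"
    using measurable_space[OF palm_point_measurable]
    by (intro suminf_cong arg_cong[where f="emeasure M"]) (auto simp: C_def space_pair_measure)
  also have "\<dots> = (\<integral>\<^sup>+x. ennreal lam * emeasure ?L {t \<in> space ?L. (t, x) \<in> C} \<partial>\<mu>)"
    by (intro campbell_marked[OF palm_marked lam] C) (simp add: vol)
  also have "\<dots> = (\<integral>\<^sup>+x. ennreal (lam * (unit_ball_vol (real n) * sqrt (real n) ^ n)) * ennreal ((c + x) ^ n) \<partial>\<mu>)"
  proof (rule nn_integral_cong_AE)
    show "AE x in \<mu>. ennreal lam * emeasure ?L {t \<in> space ?L. (t, x) \<in> C} =
        ennreal (lam * (unit_ball_vol (real n) * sqrt (real n) ^ n)) * ennreal ((c + x) ^ n)"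
      using nonneg
    proof eventually_elim
      case (elim x)
      then show ?case using lam c by (simp add: vol power_mult_distrib mult_ac flip: ennreal_mult)
    qed
  qed
  also have "\<dots> = ennreal (lam * (unit_ball_vol (real n) * sqrt (real n) ^ n)) * (\<integral>\<^sup>+x. ennreal ((c + x) ^ n) \<partial>\<mu>)"
    using sets_mark_law[OF palm_marked lam] by (intro nn_integral_cmult) (simp cong: measurable_cong_sets)
  finally show ?thesis .
qed

lemma measurable_touching:
  "{\<omega> \<in> space M. touching n (\<lambda>k. T k \<omega>) (\<lambda>k. X k \<omega>) (X0 \<omega>) i j} \<in> sets M"
proof -
  have [measurable]: "(\<lambda>\<omega>. case_option (origin n) (\<lambda>k. T k \<omega>) i) \<in> measurable M (lebesgue_n n)" for i
    by (cases i) (auto intro: origin_measurable)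
  have [measurable]: "(\<lambda>\<omega>. case_option (X0 \<omega>) (\<lambda>k. X k \<omega>) i) \<in> borel_measurable M" for i
    by (cases i) auto
  have [measurable]: "(\<lambda>\<omega>. edist n (case_option (origin n) (\<lambda>k. T k \<omega>) i) (case_option (origin n) (\<lambda>k. T k \<omega>) j)) \<in> borel_measurable M"
    by (intro measurable_edist2) measurable
  show ?thesis unfolding touching_def by measurable
qed

text \<open>Reachability is a countable union over path lengths, and a set of indices is infinite
  iff it is unbounded, again a countable condition.\<close>

lemma measurable_infinite_cluster:
  "{\<omega> \<in> space M. infinite (touching_cluster n (\<lambda>k. T k \<omega>) (\<lambda>k. X k \<omega>) (X0 \<omega>))} \<in> sets M"
proof -
  let ?R = "\<lambda>\<omega>. touching n (\<lambda>k. T k \<omega>) (\<lambda>k. X k \<omega>) (X0 \<omega>)"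
  have m: "{\<omega> \<in> space M. (?R \<omega> ^^ m) None i} \<in> sets M" for m i
  proof (induction m arbitrary: i)
    case 0
    then show ?case by simp
  next
    case (Suc m)
    have "{\<omega> \<in> space M. (?R \<omega> ^^ Suc m) None i} = {\<omega> \<in> space M. \<exists>j. (?R \<omega> ^^ m) None j \<and> ?R \<omega> j i}"
      by auto
    also have "\<dots> \<in> sets M"
      by (intro sets.sets_Collect_countable_Ex sets.sets_Collect_conj Suc measurable_touching)
    finally show ?case .
  qed
  have inf: "infinite S \<longleftrightarrow> (\<forall>m. \<exists>k. k \<ge> m \<and> Some k \<in> S)" for S :: "nat option set"
  proof -
    have "S \<subseteq> insert None (Some ` {k. Some k \<in> S})" by (auto, metis not_None_eq rangeI image_iff mem_Collect_eq)
    then have "finite S \<longleftrightarrow> finite {k. Some k \<in> S}"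
      using finite_vimageI[of S Some] by (auto simp: vimage_def intro: finite_subset)
    then show ?thesis by (simp add: infinite_nat_iff_unbounded_le)
  qed
  have "{\<omega> \<in> space M. infinite (touching_cluster n (\<lambda>k. T k \<omega>) (\<lambda>k. X k \<omega>) (X0 \<omega>))} =
      {\<omega> \<in> space M. \<forall>m. \<exists>k. k \<ge> m \<and> (\<exists>j. (?R \<omega> ^^ j) None (Some k))}"
    unfolding inf touching_cluster_def mem_Collect_eq rtranclp_power ..
  also have "\<dots> \<in> sets M"
    by (intro sets.sets_Collect_countable_All sets.sets_Collect_countable_Ex sets.sets_Collect_conj m sets.sets_Collect_const)
  finally show ?thesis .
qed

text \<open>One finite integral with \<open>q > 0\<close> suffices, since
  \<open>c + x \<le> max 1 (c / q) * (q + x)\<close>. Then the mean number of balls that meet any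
  given ball around the origin is finite, and Borel-Cantelli gives local finiteness almost
  surely.\<close>

lemma percolation_probability_eq:
  assumes q: "q > 0" and fin: "(\<integral>\<^sup>+x. ennreal ((q + x) ^ n) \<partial>\<mu>) < \<infinity>"
  shows "percolation_probability M n T X X0 =
    measure M {\<omega> \<in> space M. infinite (touching_cluster n (\<lambda>k. T k \<omega>) (\<lambda>k. X k \<omega>) (X0 \<omega>))}"
proof -
  interpret prob_space M by (rule palm_prob_space)
  have fin': "(\<integral>\<^sup>+x. ennreal ((c + x) ^ n) \<partial>\<mu>) < \<infinity>" if c: "c \<ge> 0" for c
  proof -
    define d where "d = max 1 (c / q)"
    have "(\<integral>\<^sup>+x. ennreal ((c + x) ^ n) \<partial>\<mu>) \<le> (\<integral>\<^sup>+x. ennreal (d ^ n) * ennreal ((q + x) ^ n) \<partial>\<mu>)"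
    proof (rule nn_integral_mono_AE)
      show "AE x in \<mu>. ennreal ((c + x) ^ n) \<le> ennreal (d ^ n) * ennreal ((q + x) ^ n)"
        using nonneg
      proof eventually_elim
        case (elim x)
        have "c \<le> d * q" using q by (simp add: d_def max_def field_simps)
        moreover have "x \<le> d * x" using elim mult_right_mono[of 1 d x] by (simp add: d_def)
        ultimately have "c + x \<le> d * (q + x)" by (simp add: distrib_left)
        then have "(c + x) ^ n \<le> (d * (q + x)) ^ n" using c elim by (intro power_mono) auto
        then show ?case using q elim by (simp add: power_mult_distrib ennreal_leI d_def flip: ennreal_mult)
      qed
    qed
    also have "\<dots> = ennreal (d ^ n) * (\<integral>\<^sup>+x. ennreal ((q + x) ^ n) \<partial>\<mu>)"
      using sets_mark_law[OF palm_marked lam] by (intro nn_integral_cmult) (simp cong: measurable_cong_sets)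
    also have "\<dots> < \<infinity>" using fin by (simp add: ennreal_mult_less_top)
    finally show ?thesis .
  qed
  have "AE \<omega> in M. finite {k. edist n (origin n) (T k \<omega>) \<le> real R + X k \<omega> * sqrt (real n)}" for R :: nat
  proof -
    define c where "c = real R / sqrt (real n)"
    let ?A = "\<lambda>k. {\<omega> \<in> space M. edist n (origin n) (T k \<omega>) \<le> (c + X k \<omega>) * sqrt (real n) \<and> 0 \<le> X k \<omega>}"
    have cs: "(c + x) * sqrt (real n) = real R + x * sqrt (real n)" for x
      using n by (simp add: c_def distrib_right)
    have c: "c \<ge> 0" by (simp add: c_def)
    have [measurable]: "(\<lambda>\<omega>. edist n (origin n) (T k \<omega>)) \<in> borel_measurable M" for k
      by (intro measurable_edist2 origin_measurable palm_point_measurable)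
    have A: "?A k \<in> events" for k by measurable
    have "(\<Sum>k. emeasure M (?A k)) < \<infinity>"
      unfolding expected_ball_count[OF c] using fin'[OF c] by (simp add: ennreal_mult_less_top)
    then have "(\<Sum>k. ennreal (prob (?A k))) \<noteq> top" by (simp add: emeasure_eq_measure)
    then have "summable (\<lambda>k. prob (?A k))" by (intro summable_suminf_not_top) auto
    then have "AE \<omega> in M. \<forall>\<^sub>F k in sequentially. \<omega> \<in> space M - ?A k"
      using A by (intro borel_cantelli_AE1) (auto simp: emeasure_eq_measure)
    then show ?thesis using AE_marks_nonneg
    proof eventually_elim
      case (elim \<omega>)
      then obtain m where m: "\<And>k. k \<ge> m \<Longrightarrow> \<omega> \<in> space M - ?A k" by (auto simp: eventually_sequentially)
      have "{k. edist n (origin n) (T k \<omega>) \<le> real R + X k \<omega> * sqrt (real n)} \<subseteq> {..<m}"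
      proof
        fix k assume "k \<in> {k. edist n (origin n) (T k \<omega>) \<le> real R + X k \<omega> * sqrt (real n)}"
        then show "k \<in> {..<m}" using m[of k] elim by (auto simp: cs not_le[symmetric])
      qed
      then show ?case by (rule finite_subset) simp
    qed
  qed
  then have "AE \<omega> in M. \<forall>R :: nat. finite {k. edist n (origin n) (T k \<omega>) \<le> real R + X k \<omega> * sqrt (real n)}"
    by (simp add: AE_all_countable)
  then have "AE \<omega> in M. infinite (origin_cluster n (\<lambda>k. T k \<omega>) (\<lambda>k. X k \<omega>) (X0 \<omega>)) \<longleftrightarrow>
      infinite (touching_cluster n (\<lambda>k. T k \<omega>) (\<lambda>k. X k \<omega>) (X0 \<omega>))"
    using AE_marks_nonneg AE_space
  proof eventually_elim
    case (elim \<omega>)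
    then show ?case using measurable_space[OF palm_point_measurable]
      by (intro infinite_origin_cluster_iff) (auto simp: space_lebesgue_n)
  qed
  then show ?thesis unfolding percolation_probability_def
    by (intro completion_AE_eq measurable_infinite_cluster) auto
qed

text \<open>An infinite cluster requires a ball that touches the one at the origin. Unless the
  latter has mark above \<open>c\<close>, the probability of this is at most the mean number of
  balls that meet the ball of radius \<open>c * sqrt n\<close>.\<close>

lemma infinite_cluster_prob_le:
  assumes c: "0 \<le> c" and B: "(\<integral>\<^sup>+x. ennreal ((c + x) ^ n) \<partial>\<mu>) \<le> ennreal b" "b \<ge> 0"
  shows "measure M {\<omega> \<in> space M. infinite (touching_cluster n (\<lambda>k. T k \<omega>) (\<lambda>k. X k \<omega>) (X0 \<omega>))} \<le>
    measure \<mu> {c<..} + lam * (unit_ball_vol (real n) * sqrt (real n) ^ n) * b"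
proof -
  interpret prob_space M by (rule palm_prob_space)
  let ?E = "{\<omega> \<in> space M. infinite (touching_cluster n (\<lambda>k. T k \<omega>) (\<lambda>k. X k \<omega>) (X0 \<omega>))}"
  let ?A = "\<lambda>k. {\<omega> \<in> space M. edist n (origin n) (T k \<omega>) \<le> (c + X k \<omega>) * sqrt (real n) \<and> 0 \<le> X k \<omega>}"
  let ?B = "{\<omega> \<in> space M. X0 \<omega> \<in> {c<..}}"
  have [measurable]: "(\<lambda>\<omega>. edist n (origin n) (T k \<omega>)) \<in> borel_measurable M" for k
    by (intro measurable_edist2 origin_measurable palm_point_measurable)
  have A: "?A k \<in> events" for k by measurable
  have "emeasure M ?E \<le> emeasure M (?B \<union> (\<Union>k. ?A k))"
  proof (rule emeasure_mono_AE)
    show "AE \<omega> in M. \<omega> \<in> ?E \<longrightarrow> \<omega> \<in> ?B \<union> (\<Union>k. ?A k)"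
      using AE_marks_nonneg
    proof eventually_elim
      case (elim \<omega>)
      show ?case
      proof
        assume w: "\<omega> \<in> ?E"
        let ?R = "touching n (\<lambda>k. T k \<omega>) (\<lambda>k. X k \<omega>) (X0 \<omega>)"
        have "\<not> touching_cluster n (\<lambda>k. T k \<omega>) (\<lambda>k. X k \<omega>) (X0 \<omega>) \<subseteq> {None}"
          using w finite_subset by blast
        then obtain i where "?R\<^sup>*\<^sup>* None i" "i \<noteq> None" unfolding touching_cluster_def by blast
        \<comment> \<open>A path may return to \<open>None\<close>, so the induction keeps the last
          exit from it or the neighbour found before.\<close>
        then have "\<exists>k. ?R None (Some k)"
        proof (induction rule: rtranclp_induct)
          case (step y z)
          then show ?case by (cases "y = None") auto
        qed auto
        then obtain k where "edist n (origin n) (T k \<omega>) \<le> (X0 \<omega> + X k \<omega>) * sqrt (real n)"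
          by (auto simp: touching_def)
        then have "edist n (origin n) (T k \<omega>) \<le> (c + X k \<omega>) * sqrt (real n)" if "X0 \<omega> \<le> c"
          by (rule order_trans) (use that in \<open>intro mult_right_mono; simp\<close>)
        then have "\<omega> \<in> ?A k" if "X0 \<omega> \<le> c" using that w elim by blast
        moreover have "\<omega> \<in> ?B" if "\<not> X0 \<omega> \<le> c" using that w by auto
        ultimately show "\<omega> \<in> ?B \<union> (\<Union>k. ?A k)" by blast
      qed
    qed
  qed (use A in measurable)
  also have "\<dots> \<le> emeasure M ?B + emeasure M (\<Union>k. ?A k)"
    using A by (intro emeasure_subadditive sets.countable_UN) auto
  also have "emeasure M ?B = emeasure \<mu> {c<..}"
    unfolding distr_origin_mark[symmetric] by (subst emeasure_distr) (auto intro!: arg_cong[where f="emeasure M"])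
  also have "emeasure M (\<Union>k. ?A k) \<le> (\<Sum>k. emeasure M (?A k))"
    using A by (intro emeasure_subadditive_countably) auto
  also have "\<dots> = ennreal (lam * (unit_ball_vol (real n) * sqrt (real n) ^ n)) * (\<integral>\<^sup>+x. ennreal ((c + x) ^ n) \<partial>\<mu>)"
    by (rule expected_ball_count[OF c])
  also have "\<dots> \<le> ennreal (lam * (unit_ball_vol (real n) * sqrt (real n) ^ n)) * ennreal b"
    using B by (intro mult_left_mono) auto
  also have "\<dots> = ennreal (lam * (unit_ball_vol (real n) * sqrt (real n) ^ n) * b)"
    using B lam by (simp add: ennreal_mult)
  finally have "emeasure M ?E \<le> emeasure \<mu> {c<..} + ennreal (lam * (unit_ball_vol (real n) * sqrt (real n) ^ n) * b)"
    by (simp add: add_left_mono)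
  moreover have "emeasure \<mu> {c<..} = ennreal (measure \<mu> {c<..})"
    using mark_prob_space[OF palm_marked lam] by (simp add: finite_measure.emeasure_eq_measure prob_space_def)
  ultimately show ?thesis
    using B lam by (simp add: emeasure_eq_measure flip: ennreal_plus)
qed

end

declare palm_point_measurable [measurable del] palm_mark_measurable [measurable del]
  palm_origin_mark_measurable [measurable del]

section \<open>The subcritical regime\<close>

context radius_laws
begin

lemma subcritical:
  fixes M :: "nat \<Rightarrow> 'w measure"
  assumes v: "\<And>R. 0 \<le> R \<Longrightarrow> ereal (ln (R + Rs) + v) \<le> I R"
    and lim: "\<rho>s \<longlonglongrightarrow> \<rho>" and \<rho>: "\<rho> < - (1 / 2) * ln (2 * pi * exp 1) + v"
    and palm: "\<And>n. n \<ge> 1 \<Longrightarrow> palm_marked_process (M n) n (exp (real n * \<rho>s n)) (\<mu> n) (T n) (X n) (X0 n)"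
  shows "(\<lambda>n. percolation_probability (M n) n (T n) (X n) (X0 n)) \<longlonglongrightarrow> 0"
proof -
  define L where "L = ln (2 * pi * exp 1) / 2"
  \<comment> \<open>Half the distance to the threshold: the exponent \<open>g\<close> then tends to
    \<open>- e\<close>.\<close>
  define e where "e = (v - L - \<rho>) / 2"
  have e: "e > 0" using \<rho> by (simp add: e_def L_def)
  obtain c where c: "c > Rs" and lap: "\<forall>\<^sub>F n in sequentially. (\<integral>\<^sup>+x. ennreal ((c + x) ^ n) \<partial>\<mu> n) \<le> ennreal (exp (real n * (e - v)))"
    using laplace_upper_bound[OF v e] by blast
  define g where "g n = \<rho>s n + log_ball n / real n + (e - v)" for n
  define b where "b n = 1 - measure (\<mu> n) {Rs - (c - Rs)..Rs + (c - Rs)} + exp (real n * g n)" for n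
  have "g \<longlonglongrightarrow> \<rho> + L + (e - v)"
    unfolding g_def L_def by (intro tendsto_add lim log_ball_limit tendsto_const)
  moreover have "\<rho> + L + (e - v) = - e" by (simp add: e_def field_simps)
  ultimately have "filterlim (\<lambda>n. g n * real n) at_bot sequentially"
    using e by (intro filterlim_tendsto_neg_mult_at_bot[OF _ _ filterlim_real_sequentially]) auto
  then have "(\<lambda>n. exp (g n * real n)) \<longlonglongrightarrow> 0" by (rule filterlim_compose[OF exp_at_bot])
  then have "(\<lambda>n. exp (real n * g n)) \<longlonglongrightarrow> 0" by (simp only: mult.commute)
  then have "b \<longlonglongrightarrow> 1 - 1 + 0"
    unfolding b_def using c by (intro tendsto_add tendsto_diff tendsto_const prob_near_Rs) auto
  then have b: "b \<longlonglongrightarrow> 0" by simp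
  show ?thesis
  proof (rule tendsto_sandwich[OF _ _ tendsto_const b])
    show "\<forall>\<^sub>F n in sequentially. 0 \<le> percolation_probability (M n) n (T n) (X n) (X0 n)"
      by (simp add: percolation_probability_def)
    show "\<forall>\<^sub>F n in sequentially. percolation_probability (M n) n (T n) (X n) (X0 n) \<le> b n"
      using lap eventually_ge_at_top[of 1]
    proof eventually_elim
      case (elim n)
      note p = palm[OF elim(2)]
      interpret mu: prob_space "\<mu> n" by (rule prob_space_law) fact
      have "percolation_probability (M n) n (T n) (X n) (X0 n) =
          measure (M n) {\<omega> \<in> space (M n). infinite (touching_cluster n (\<lambda>k. T n k \<omega>) (\<lambda>k. X n k \<omega>) (X0 n \<omega>))}"
        using c Rs_pos elim by (intro percolation_probability_eq[OF p _ elim(2) nonneg, where q=c]) (auto intro: le_less_trans)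
      also have "\<dots> \<le> measure (\<mu> n) {c<..} + exp (real n * \<rho>s n) * (unit_ball_vol (real n) * sqrt (real n) ^ n) * exp (real n * (e - v))"
        using c Rs_pos elim by (intro infinite_cluster_prob_le[OF p _ elim(2) nonneg]) auto
      also have "exp (real n * \<rho>s n) * (unit_ball_vol (real n) * sqrt (real n) ^ n) * exp (real n * (e - v)) = exp (real n * g n)"
        using elim(2) unfolding g_def by (simp add: exp_log_ball[symmetric] distrib_left flip: exp_add)
      also have "measure (\<mu> n) {c<..} \<le> 1 - measure (\<mu> n) {Rs - (c - Rs)..Rs + (c - Rs)}"
      proof -
        have "measure (\<mu> n) {c<..} \<le> measure (\<mu> n) (space (\<mu> n) - {Rs - (c - Rs)..Rs + (c - Rs)})"
          using elim(2) by (intro mu.finite_measure_mono) auto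
        also have "\<dots> = 1 - measure (\<mu> n) {Rs - (c - Rs)..Rs + (c - Rs)}"
          using elim(2) by (intro mu.prob_compl) simp
        finally show ?thesis .
      qed
      finally show ?case by (simp add: b_def)
    qed
  qed
qed

end

section \<open>The supercritical regime\<close>

text \<open>As \<open>81 * \<epsilon> \<le> 1 / 2\<close> and \<open>2 ^ k \<ge> k + 1\<close>,
  level \<open>k\<close> contributes at most \<open>\<epsilon> / 2 ^ k\<close>; the geometric series
  gives \<open>2 * \<epsilon>\<close>.\<close>

lemma (in prob_space) prob_bad_block_le:
  assumes \<beta>: "sparse_events M \<beta> \<epsilon>" and \<epsilon>: "0 \<le> \<epsilon>" "162 * \<epsilon> \<le> 1"
  shows "{\<omega> \<in> space M. \<exists>k. bad_block (\<beta> \<omega>) k p} \<in> events"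
    and "prob {\<omega> \<in> space M. \<exists>k. bad_block (\<beta> \<omega>) k p} \<le> 2 * \<epsilon>"
proof -
  let ?A = "\<lambda>k. {\<omega> \<in> space M. bad_block (\<beta> \<omega>) k p}"
  note s = sparse_events_bad_block[OF \<beta> \<epsilon>(1)]
  have A: "?A k \<in> events" for k
    using s[of k] unfolding sparse_events_def by blast
  have eq: "{\<omega> \<in> space M. \<exists>k. bad_block (\<beta> \<omega>) k p} = (\<Union>k. ?A k)" by auto
  show "{\<omega> \<in> space M. \<exists>k. bad_block (\<beta> \<omega>) k p} \<in> events"
    unfolding eq using A by (intro sets.countable_UN) auto
  have le: "prob (?A k) \<le> \<epsilon> * (1 / 2) ^ k" for k
  proof -
    have "prob {\<omega> \<in> space M. \<forall>q\<in>{p}. bad_block (\<beta> \<omega>) k q} \<le> ((81 * \<epsilon>) ^ (2 ^ k) / 81) ^ card {p}"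
      using s[of k] unfolding sparse_events_def by blast
    then have "prob (?A k) \<le> (81 * \<epsilon>) ^ (2 ^ k) / 81" by simp
    also have "\<dots> \<le> (81 * \<epsilon>) ^ Suc k / 81"
      using \<epsilon> less_exp[of k] by (intro divide_right_mono power_decreasing) (auto simp: Suc_le_eq)
    also have "\<dots> = \<epsilon> * (81 * \<epsilon>) ^ k" by simp
    also have "\<dots> \<le> \<epsilon> * (1 / 2) ^ k" using \<epsilon> by (intro mult_left_mono power_mono) auto
    finally show ?thesis .
  qed
  have sums: "(\<lambda>k. \<epsilon> * (1 / 2) ^ k) sums (\<epsilon> * 2)"
    using sums_mult[OF geometric_sums[of "1 / 2 :: real"], of \<epsilon>] by simp
  have summ: "summable (\<lambda>k. prob (?A k))"
    by (rule summable_comparison_test'[OF sums_summable[OF sums]]) (use le in auto)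
  have "prob (\<Union>k. ?A k) \<le> (\<Sum>k. prob (?A k))"
    using A summ by (intro finite_measure_subadditive_countably) auto
  also have "\<dots> \<le> (\<Sum>k. \<epsilon> * (1 / 2) ^ k)"
    using le summ sums_summable[OF sums] by (intro suminf_le)
  also have "\<dots> = 2 * \<epsilon>" using sums by (simp add: sums_iff)
  finally show "prob {\<omega> \<in> space M. \<exists>k. bad_block (\<beta> \<omega>) k p} \<le> 2 * \<epsilon>" unfolding eq .
qed

text \<open>Cells are unit squares in the first two coordinates. The remaining coordinates are indexed by
  \<^term>\<open>rest n\<close> and confined to a ball, which makes the grid finite.\<close>

definition rest :: "nat \<Rightarrow> nat set" where
  "rest n = {2..<n}"

definition in_cell :: "site \<Rightarrow> point \<Rightarrow> bool" where
  "in_cell z y \<longleftrightarrow> real (fst z) \<le> y 0 \<and> y 0 < real (fst z) + 1 \<and> real (snd z) \<le> y 1 \<and> y 1 < real (snd z) + 1"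

definition target :: "nat \<Rightarrow> real \<Rightarrow> real \<Rightarrow> point \<Rightarrow> site \<Rightarrow> point set" where
  "target n r A g z = {y \<in> space_n n. in_cell z y \<and> L2_set (\<lambda>i. y i - g i) (rest n) \<le> r \<and> L2_set y (rest n) \<le> A}"

definition grid :: "nat \<Rightarrow> real \<Rightarrow> real \<Rightarrow> point set" where
  "grid n h A = {g \<in> rest n \<rightarrow>\<^sub>E (\<lambda>k. h * real_of_int k) ` {- \<lceil>A / h\<rceil>..\<lceil>A / h\<rceil>}. L2_set g (rest n) \<le> A}"

text \<open>Rounding is towards 0 in each coordinate, so that the norm does not increase and the
  grid point stays in the ball of radius \<open>A\<close>.\<close>

definition truncate :: "nat \<Rightarrow> real \<Rightarrow> point \<Rightarrow> point" where
  "truncate n h y = (\<lambda>i\<in>rest n. h * real_of_int (if 0 \<le> y i then \<lfloor>y i / h\<rfloor> else - \<lfloor>- y i / h\<rfloor>))"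

section \<open>Discretisation of positions and volumes of targets\<close>

lemma in_cell_unique: "in_cell z y \<Longrightarrow> in_cell z' y \<Longrightarrow> z = z'"
  by (auto simp: in_cell_def prod_eq_iff)

lemma finite_grid: "finite (grid n h A)"
proof (rule finite_subset)
  show "grid n h A \<subseteq> rest n \<rightarrow>\<^sub>E (\<lambda>k. h * real_of_int k) ` {- \<lceil>A / h\<rceil>..\<lceil>A / h\<rceil>}"
    unfolding grid_def by blast
  show "finite (rest n \<rightarrow>\<^sub>E (\<lambda>k. h * real_of_int k) ` {- \<lceil>A / h\<rceil>..\<lceil>A / h\<rceil>})"
    by (intro finite_PiE) (auto simp: rest_def)
qed

text \<open>Applied with \<open>A\<close> proportional to \<open>sqrt n\<close>, this is of order
  \<open>exp (n * ln n)\<close> in the crude sense of logarithms, which the void probabilities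
  outweigh.\<close>

lemma card_grid_le:
  assumes h: "h > 0" and A: "A \<ge> 0" and n: "n \<ge> 1"
  shows "real (card (grid n h A)) \<le> (2 * A / h + 3) ^ n"
proof -
  let ?K = "{- \<lceil>A / h\<rceil>..\<lceil>A / h\<rceil>}"
  have "0 \<le> A / h" using h A by simp
  then have c0: "\<lceil>A / h\<rceil> \<ge> 0" by linarith
  then have "0 \<le> \<lceil>A / h\<rceil> - (- \<lceil>A / h\<rceil>) + 1" by linarith
  then have "real (card ?K) = real_of_int (\<lceil>A / h\<rceil> - (- \<lceil>A / h\<rceil>) + 1)"
    by (simp only: card_atLeastAtMost_int of_nat_nat)
  then have cardK: "real (card ?K) = 2 * real_of_int \<lceil>A / h\<rceil> + 1" by simp
  have "2 * A / h = 2 * (A / h)" by simp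
  moreover have "0 \<le> real_of_int \<lceil>A / h\<rceil>" using c0 by (simp only: of_int_0_le_iff)
  ultimately have K: "1 \<le> real (card ?K)" "real (card ?K) \<le> 2 * A / h + 3"
    using cardK ceiling_correct[of "A / h"] by linarith+
  have "card (grid n h A) \<le> card (rest n \<rightarrow>\<^sub>E (\<lambda>k. h * real_of_int k) ` ?K)"
    unfolding grid_def by (intro card_mono finite_PiE) (auto simp: rest_def)
  also have "\<dots> = card ((\<lambda>k. h * real_of_int k) ` ?K) ^ (n - 2)"
    by (simp add: card_PiE rest_def)
  also have "\<dots> \<le> card ?K ^ (n - 2)" by (intro power_mono card_image_le) auto
  finally have "real (card (grid n h A)) \<le> real (card ?K) ^ (n - 2)"
    by (metis of_nat_le_iff of_nat_power)
  also have "\<dots> \<le> real (card ?K) ^ n" by (rule power_increasing[OF _ K(1)]) simp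
  also have "\<dots> \<le> (2 * A / h + 3) ^ n" using K(2) of_nat_0_le_iff by (rule power_mono)
  finally show ?thesis .
qed

lemma truncate_coordinate:
  fixes x :: real
  assumes h: "h > 0"
  defines "k \<equiv> (if 0 \<le> x then \<lfloor>x / h\<rfloor> else - \<lfloor>- x / h\<rfloor>)"
  shows "\<bar>h * real_of_int k\<bar> \<le> \<bar>x\<bar>" "\<bar>x - h * real_of_int k\<bar> \<le> h" "\<bar>x\<bar> \<le> A \<Longrightarrow> \<bar>k\<bar> \<le> \<lceil>A / h\<rceil>"
proof -
  define m where "m = \<lfloor>\<bar>x\<bar> / h\<rfloor>"
  have m: "0 \<le> m" "h * real_of_int m \<le> \<bar>x\<bar>" "\<bar>x\<bar> - h * real_of_int m \<le> h"
  proof -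
    show "0 \<le> m" using h by (simp add: m_def)
    have "real_of_int m \<le> \<bar>x\<bar> / h" "\<bar>x\<bar> / h < real_of_int m + 1" by (auto simp: m_def)
    then show "h * real_of_int m \<le> \<bar>x\<bar>" "\<bar>x\<bar> - h * real_of_int m \<le> h" using h by (auto simp: field_simps)
  qed
  have k: "k = (if 0 \<le> x then m else - m)" by (simp add: k_def m_def)
  have p: "0 \<le> h * real_of_int m" using h m by simp
  define w where "w = h * real_of_int m"
  have "h * real_of_int k = (if 0 \<le> x then w else - w)" by (simp add: k w_def)
  then show "\<bar>h * real_of_int k\<bar> \<le> \<bar>x\<bar>" "\<bar>x - h * real_of_int k\<bar> \<le> h"
    using m(2,3) p unfolding w_def[symmetric] by (auto simp: abs_if split: if_splits)
  assume "\<bar>x\<bar> \<le> A"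
  then have "m \<le> \<lfloor>A / h\<rfloor>" unfolding m_def using h by (intro floor_mono divide_right_mono) auto
  then have "m \<le> \<lceil>A / h\<rceil>" using floor_le_ceiling[of "A / h"] by linarith
  then show "\<bar>k\<bar> \<le> \<lceil>A / h\<rceil>" using m by (simp add: k)
qed

lemma L2_set_coordinate_le: "finite J \<Longrightarrow> i \<in> J \<Longrightarrow> \<bar>y i\<bar> \<le> L2_set y J"
  using member_le_L2_set[of J i "\<lambda>i. \<bar>y i\<bar>"] by (simp add: L2_set_def)

lemma truncate_grid:
  assumes h: "h > 0" and y: "L2_set y (rest n) \<le> A"
  shows "truncate n h y \<in> grid n h A"
    and "L2_set (\<lambda>i. y i - truncate n h y i) (rest n) \<le> h * sqrt (real n)"
proof -
  have fin: "finite (rest n)" by (simp add: rest_def)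
  have co: "\<bar>y i\<bar> \<le> A" if "i \<in> rest n" for i
    using L2_set_coordinate_le[OF fin that, of y] y by simp
  have "L2_set (truncate n h y) (rest n) = L2_set (\<lambda>i. \<bar>truncate n h y i\<bar>) (rest n)"
    by (simp add: L2_set_def)
  also have "\<dots> \<le> L2_set (\<lambda>i. \<bar>y i\<bar>) (rest n)"
    using truncate_coordinate(1)[OF h] by (intro L2_set_mono) (auto simp: truncate_def)
  also have "\<dots> = L2_set y (rest n)" by (simp add: L2_set_def)
  finally have "L2_set (truncate n h y) (rest n) \<le> A" using y by simp
  moreover have "truncate n h y i \<in> (\<lambda>k. h * real_of_int k) ` {- \<lceil>A / h\<rceil>..\<lceil>A / h\<rceil>}" if i: "i \<in> rest n" for i
  proof -
    define k where "k = (if 0 \<le> y i then \<lfloor>y i / h\<rfloor> else - \<lfloor>- y i / h\<rfloor>)"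
    have "\<bar>k\<bar> \<le> \<lceil>A / h\<rceil>" unfolding k_def by (rule truncate_coordinate(3)[OF h co[OF i]])
    then have "k \<in> {- \<lceil>A / h\<rceil>..\<lceil>A / h\<rceil>}" by auto
    moreover have "truncate n h y i = h * real_of_int k" using i by (simp add: truncate_def k_def)
    ultimately show ?thesis by blast
  qed
  ultimately show "truncate n h y \<in> grid n h A"
    unfolding grid_def by (auto simp: PiE_iff truncate_def)
  have "L2_set (\<lambda>i. y i - truncate n h y i) (rest n) = L2_set (\<lambda>i. \<bar>y i - truncate n h y i\<bar>) (rest n)"
    by (simp add: L2_set_def)
  also have "\<dots> \<le> L2_set (\<lambda>i. h) (rest n)"
    using truncate_coordinate(2)[OF h] by (intro L2_set_mono) (auto simp: truncate_def)
  also have "\<dots> = h * sqrt (real (n - 2))" using h by (simp add: L2_set_def rest_def real_sqrt_mult mult.commute)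
  also have "\<dots> \<le> h * sqrt (real n)" using h by (intro mult_left_mono) auto
  finally show "L2_set (\<lambda>i. y i - truncate n h y i) (rest n) \<le> h * sqrt (real n)" .
qed

lemma lessThan_split: "n \<ge> 2 \<Longrightarrow> {..<n} = {0, 1} \<union> rest n"
  by (auto simp: rest_def)

text \<open>A target is the product of a unit square and a set in the remaining coordinates, so its
  volume does not depend on the cell.\<close>

lemma emeasure_target:
  assumes n: "n \<ge> 3"
  shows "target n r A g z \<in> sets (lebesgue_n n)"
    and "emeasure (lebesgue_n n) (target n r A g z) =
      emeasure (leb (rest n)) {y \<in> space (leb (rest n)). L2_set (\<lambda>i. y i - g i) (rest n) \<le> r \<and> L2_set y (rest n) \<le> A}"
proof -
  let ?I = "{0, 1} :: nat set" and ?J = "rest n"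
  let ?Q = "{y \<in> space (leb ?J). L2_set (\<lambda>i. y i - g i) ?J \<le> r \<and> L2_set (\<lambda>i. y i - 0) ?J \<le> A}"
  let ?F = "\<lambda>i :: nat. if i = 0 then {real (fst z)..<real (fst z) + 1} else {real (snd z)..<real (snd z) + 1}"
  let ?B = "Pi\<^sub>E ?I ?F"
  have IJ: "?I \<inter> ?J = {}" "finite ?I" "finite ?J" by (auto simp: rest_def)
  have split: "lebesgue_n n = leb (?I \<union> ?J)" using lessThan_split[of n] n by (simp add: lebesgue_n_def)
  have teq: "target n r A g z = {y \<in> space (leb (?I \<union> ?J)).
      y 0 \<in> {real (fst z)..<real (fst z) + 1} \<and> y 1 \<in> {real (snd z)..<real (snd z) + 1} \<and> L2_set (\<lambda>i. y i - g i) ?J \<le> r \<and> L2_set (\<lambda>i. y i - 0) ?J \<le> A}"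
    unfolding split[symmetric] space_lebesgue_n by (auto simp: target_def in_cell_def)
  have coord: "(\<lambda>y. y i) \<in> measurable (leb (?I \<union> ?J)) lborel" if "i \<in> ?I \<union> ?J" for i
    using that by (rule measurable_component_singleton)
  have coord_in: "{y \<in> space (leb (?I \<union> ?J)). y i \<in> S} \<in> sets (leb (?I \<union> ?J))"
    if "i \<in> ?I \<union> ?J" "S \<in> sets borel" for i S
    using measurable_sets[OF coord[OF that(1)], of S] that(2) by (simp add: vimage_def Int_def conj_commute)
  have L: "(\<lambda>y. L2_set (\<lambda>i. y i - f i) ?J) \<in> borel_measurable (leb (?I \<union> ?J))" for f
    by (rule measurable_L2_set_leb) blast
  have ball: "{y \<in> space (leb (?I \<union> ?J)). L2_set (\<lambda>i. y i - f i) ?J \<le> q} \<in> sets (leb (?I \<union> ?J))" for f q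
    using measurable_sets[OF L, of "{..q}" f] by (simp add: vimage_def Int_def conj_commute)
  have m: "target n r A g z \<in> sets (leb (?I \<union> ?J))"
    unfolding teq by (intro sets.sets_Collect_conj coord_in ball) auto
  then show "target n r A g z \<in> sets (lebesgue_n n)" unfolding split .
  have Q: "?Q \<in> sets (leb ?J)" by measurable
  have B: "?B \<in> sets (leb ?I)" by (intro sets_PiM_I_finite) auto
  interpret J: sigma_finite_measure "leb ?J" using IJ(3) by (rule lborel_family.sigma_finite)
  have "emeasure (leb (?I \<union> ?J)) (target n r A g z) =
      emeasure (distr (leb ?I \<Otimes>\<^sub>M leb ?J) (leb (?I \<union> ?J)) (merge ?I ?J)) (target n r A g z)"
    using lborel_family.distr_merge[OF IJ] by simp
  also have "\<dots> = emeasure (leb ?I \<Otimes>\<^sub>M leb ?J) (merge ?I ?J -` target n r A g z \<inter> space (leb ?I \<Otimes>\<^sub>M leb ?J))"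
    using m by (intro emeasure_distr measurable_merge)
  also have "merge ?I ?J -` target n r A g z \<inter> space (leb ?I \<Otimes>\<^sub>M leb ?J) = ?B \<times> ?Q"
  proof -
    have L: "L2_set (\<lambda>i. merge ?I ?J (a, b) i - f i) ?J = L2_set (\<lambda>i. b i - f i) ?J" for a b f
      using IJ by (intro L2_set_cong) (auto simp: merge_def)
    have mem: "merge ?I ?J (a, b) \<in> target n r A g z \<longleftrightarrow> a \<in> ?B \<and> b \<in> ?Q" if "a \<in> space (leb ?I)" "b \<in> space (leb ?J)" for a b
    proof -
      have "merge ?I ?J (a, b) \<in> space (leb (?I \<union> ?J))"
        using that by (intro measurable_space[OF measurable_merge]) (simp add: space_pair_measure)
      moreover have "a \<in> ?B \<longleftrightarrow> a 0 \<in> ?F 0 \<and> a 1 \<in> ?F 1" using that by (auto simp: space_PiM PiE_iff)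
      moreover have "merge ?I ?J (a, b) 0 = a 0" "merge ?I ?J (a, b) 1 = a 1" by (simp_all add: merge_def)
      ultimately show ?thesis unfolding teq using that L[of a b g] L[of a b "\<lambda>_. 0"] by simp
    qed
    show ?thesis
    proof (rule set_eqI)
      fix p :: "(nat \<Rightarrow> real) \<times> (nat \<Rightarrow> real)"
      obtain a b where p: "p = (a, b)" by (cases p)
      have "a \<in> ?B \<Longrightarrow> a \<in> space (leb ?I)" using sets.sets_into_space[OF B] by blast
      moreover have "b \<in> ?Q \<Longrightarrow> b \<in> space (leb ?J)" by blast
      ultimately show "p \<in> merge ?I ?J -` target n r A g z \<inter> space (leb ?I \<Otimes>\<^sub>M leb ?J) \<longleftrightarrow> p \<in> ?B \<times> ?Q"
        unfolding p space_pair_measure Int_iff vimage_eq mem_Times_iff fst_conv snd_conv using mem[of a b] by blast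
    qed
  qed
  also have "emeasure (leb ?I \<Otimes>\<^sub>M leb ?J) (?B \<times> ?Q) = emeasure (leb ?I) ?B * emeasure (leb ?J) ?Q"
    using B Q by (rule J.emeasure_pair_measure_Times)
  also have "emeasure (leb ?I) ?B = 1"
    by (subst lborel_family.emeasure_PiM) auto
  finally show "emeasure (lebesgue_n n) (target n r A g z) =
      emeasure (leb ?J) {y \<in> space (leb ?J). L2_set (\<lambda>i. y i - g i) ?J \<le> r \<and> L2_set y ?J \<le> A}"
    unfolding split by simp
qed

lemma measure_target_ge:
  assumes n: "n \<ge> 3" and g: "g \<in> grid n h A" and A: "0 \<le> A" "0 \<le> s" "s \<le> 1" "0 \<le> q"
    and "q + s * A \<le> r" "q\<^sup>2 \<le> s * A\<^sup>2"
  shows "emeasure (lebesgue_n n) (target n r A g z) < \<infinity>"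
    and "unit_ball_vol (real (n - 2)) * q ^ (n - 2) / 2 \<le> measure (lebesgue_n n) (target n r A g z)"
proof -
  have J: "finite (rest n)" "rest n \<noteq> {}" and card: "card (rest n) = n - 2" using n by (auto simp: rest_def)
  have w: "L2_set g (rest n) \<le> A" using g by (simp add: grid_def)
  have r: "0 \<le> r" using assms mult_nonneg_nonneg[of s A] by linarith
  have "emeasure (lebesgue_n n) (target n r A g z) \<le>
      emeasure (leb (rest n)) {y \<in> space (leb (rest n)). L2_set (\<lambda>i. y i - g i) (rest n) \<le> r}"
    unfolding emeasure_target(2)[OF n] by (intro emeasure_mono) auto
  also have "\<dots> < \<infinity>" using J r by (simp add: emeasure_leb_ball)
  finally show fin: "emeasure (lebesgue_n n) (target n r A g z) < \<infinity>" .
  have "ennreal (unit_ball_vol (real (n - 2)) * q ^ (n - 2) / 2) \<le> emeasure (lebesgue_n n) (target n r A g z)"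
    unfolding emeasure_target(2)[OF n] using emeasure_leb_lens[OF J w A(2,3,4,1) assms(7,8)] by (simp add: card)
  then show "unit_ball_vol (real (n - 2)) * q ^ (n - 2) / 2 \<le> measure (lebesgue_n n) (target n r A g z)"
    using fin by (simp add: emeasure_eq_ennreal_measure)
qed

text \<open>In neighbouring unit squares each of the first two coordinates differs by at most 2, and
  \<open>sqrt 8 \<le> 3\<close>. The term with \<open>h\<close> pays for having replaced
  \<open>p\<close> by its grid point.\<close>

lemma edist_target:
  assumes n: "n \<ge> 2" and h: "h > 0" and p: "in_cell z p" "L2_set p (rest n) \<le> A"
    and z: "z' = z \<or> adjacent z z'" and y: "y \<in> target n r A (truncate n h p) z'"
  shows "edist n p y \<le> 3 + r + h * sqrt (real n)"
proof -
  have split: "{..<n} = {0, 1} \<union> rest n" "{0, 1} \<inter> rest n = {}" "finite (rest n)"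
    using n by (auto simp: rest_def)
  have b: "\<bar>y 0 - p 0\<bar> \<le> 2" "\<bar>y 1 - p 1\<bar> \<le> 2"
    using z y p by (auto simp: target_def in_cell_def adjacent_def)
  have "(y 0 - p 0)\<^sup>2 \<le> 2\<^sup>2" "(y 1 - p 1)\<^sup>2 \<le> 2\<^sup>2"
    using b abs_le_square_iff[of "y 0 - p 0" 2] abs_le_square_iff[of "y 1 - p 1" 2] by simp_all
  then have "sqrt ((y 0 - p 0)\<^sup>2 + (y 1 - p 1)\<^sup>2) \<le> 3" by (intro real_le_lsqrt) auto
  moreover have "edist n p y \<le> sqrt ((y 0 - p 0)\<^sup>2 + (y 1 - p 1)\<^sup>2) + L2_set (\<lambda>i. y i - p i) (rest n)"
    unfolding edist_def L2_set_def split(1) using split(2,3)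
    by (subst sum.union_disjoint) (auto intro!: sqrt_add_le_add_sqrt sum_nonneg)
  moreover have "L2_set (\<lambda>i. y i - p i) (rest n) \<le>
      L2_set (\<lambda>i. y i - truncate n h p i) (rest n) + L2_set (\<lambda>i. truncate n h p i - p i) (rest n)"
    using L2_set_triangle_ineq[of "\<lambda>i. y i - truncate n h p i" "\<lambda>i. truncate n h p i - p i" "rest n"] by simp
  moreover have "L2_set (\<lambda>i. y i - truncate n h p i) (rest n) \<le> r" using y by (simp add: target_def)
  moreover have "L2_set (\<lambda>i. truncate n h p i - p i) (rest n) = L2_set (\<lambda>i. p i - truncate n h p i) (rest n)"
    by (simp add: L2_set_def power2_commute)
  ultimately show ?thesis using truncate_grid(2)[OF h p(2)] by linarith
qed

text \<open>Every grid position is tested, whether or not a ball sits there: goodness then depends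
  only on the points inside the cell, and distinct cells involve disjoint regions.\<close>

definition bad_cell ::
  "nat \<Rightarrow> real \<Rightarrow> real \<Rightarrow> real \<Rightarrow> real set set \<Rightarrow> (nat \<Rightarrow> point) \<Rightarrow> (nat \<Rightarrow> real) \<Rightarrow> site \<Rightarrow> bool" where
  "bad_cell n r A h \<B> t x z \<longleftrightarrow> (\<exists>c\<in>grid n h A \<times> \<B>. \<forall>k. \<not> (t k \<in> target n r A (fst c) z \<and> x k \<in> snd c))"

text \<open>From a ball of radius about \<open>Rs\<close> one reaches a neighbouring good cell in two
  steps, the first to a ball of radius about \<open>R\<close>, the second back to a ball of radius about \<open>Rs\<close>.\<close>

lemma infinite_touching_cluster:
  assumes n: "n \<ge> 2" and h: "h > 0" and A: "0 \<le> A"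
    and good: "\<And>k. \<not> bad_block (bad_cell n r A h {{a<..}, {b<..}} t x) k (0, 0)"
    and x0: "x0 > b" and ab: "3 + r + h * sqrt (real n) \<le> (a + b) * sqrt (real n)"
  shows "infinite (touching_cluster n t x x0)"
proof -
  let ?\<beta> = "bad_cell n r A h {{a<..}, {b<..}} t x"
  define c where "c = case_option (origin n) t"
  define m where "m = case_option x0 x"
  \<comment> \<open>The invariant of the walk: a reached ball with mark above \<open>b\<close>,
    centred over the cell \<open>z\<close> and inside the confinement ball, so that it can be
    truncated to the grid again. The ball at the origin satisfies it through
    \<open>x0 > b\<close>.\<close>
  define P where "P z i \<longleftrightarrow> i \<in> touching_cluster n t x x0 \<and> m i > b \<and> in_cell z (c i) \<and> L2_set (c i) (rest n) \<le> A" for z i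
  have reach: "\<exists>k. t k \<in> target n r A (truncate n h (c i)) z' \<and> x k \<in> B \<and> Some k \<in> touching_cluster n t x x0"
    if i: "i \<in> touching_cluster n t x x0" "in_cell z (c i)" "L2_set (c i) (rest n) \<le> A"
      and z: "z' = z \<or> adjacent z z'" "\<not> ?\<beta> z'" and B: "B \<in> {{a<..}, {b<..}}"
      and s: "\<And>w. w \<in> B \<Longrightarrow> a + b \<le> m i + w" for i z z' B
  proof -
    have "truncate n h (c i) \<in> grid n h A" by (rule truncate_grid(1)[OF h i(3)])
    then obtain k where k: "t k \<in> target n r A (truncate n h (c i)) z'" "x k \<in> B"
      using z(2) B unfolding bad_cell_def by fastforce
    have "edist n (c i) (t k) \<le> 3 + r + h * sqrt (real n)"
      by (rule edist_target[OF n h i(2,3) z(1) k(1)])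
    also have "\<dots> \<le> (a + b) * sqrt (real n)" by (rule ab)
    also have "\<dots> \<le> (m i + x k) * sqrt (real n)" using s[OF k(2)] by (intro mult_right_mono) auto
    finally have "touching n t x x0 i (Some k)" by (simp add: touching_def c_def m_def)
    then have "Some k \<in> touching_cluster n t x x0"
      using i(1) by (auto simp: touching_cluster_def intro: rtranclp.rtrancl_into_rtrancl)
    then show ?thesis using k by blast
  qed
  have "\<exists>i. P z i" if "good_connected ?\<beta> (0, 0) z" for z
    using that unfolding good_connected_def
  proof (induction rule: rtranclp_induct)
    case base
    have "P (0, 0) None"
      using x0 n A by (auto simp: P_def touching_cluster_def m_def c_def in_cell_def origin_def rest_def L2_set_def)
    then show ?case ..
  next
    case (step z z')
    then obtain i where i: "P z i" by blast
    have z: "adjacent z z'" "\<not> ?\<beta> z'" using step by auto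
    obtain k where k: "t k \<in> target n r A (truncate n h (c i)) z'" "x k \<in> {a<..}" "Some k \<in> touching_cluster n t x x0"
      using reach[of i z z' "{a<..}"] i z by (auto simp: P_def)
    obtain l where l: "t l \<in> target n r A (truncate n h (c (Some k))) z'" "x l \<in> {b<..}" "Some l \<in> touching_cluster n t x x0"
      using reach[of "Some k" z' z' "{b<..}"] k z by (auto simp: c_def m_def target_def)
    have "P z' (Some l)" using l by (auto simp: P_def c_def m_def target_def)
    then show ?case ..
  qed
  then obtain f where f: "\<And>z. good_connected ?\<beta> (0, 0) z \<Longrightarrow> P z (f z)" by metis
  \<comment> \<open>A centre determines its cell, so distinct cells are visited by distinct
    balls.\<close>
  have "inj_on f {z. good_connected ?\<beta> (0, 0) z}"
    using f in_cell_unique unfolding P_def inj_on_def by (metis mem_Collect_eq)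
  then have "infinite (f ` {z. good_connected ?\<beta> (0, 0) z})"
    using infinite_good_cluster[OF good] finite_imageD by blast
  moreover have "f ` {z. good_connected ?\<beta> (0, 0) z} \<subseteq> touching_cluster n t x x0"
    using f by (auto simp: P_def)
  ultimately show ?thesis using finite_subset by blast
qed

text \<open>\<open>m\<close> bounds below the mean number of points of each kind in each target. For
  a fixed choice of one empty target per cell the void bound multiplies over the cells, as their
  targets are disjoint; the prefactor counts the choices for one cell.\<close>

lemma sparse_bad_cells:
  assumes process: "marked_poisson_process M n lam \<mu> T X" and lam: "lam \<ge> 0" and n: "n \<ge> 3"
    and A: "0 \<le> A" "0 \<le> s" "s \<le> 1" "0 \<le> q" "q + s * A \<le> r" "q\<^sup>2 \<le> s * A\<^sup>2"
    and B: "finite \<B>" "\<And>B. B \<in> \<B> \<Longrightarrow> B \<in> sets borel"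
    and m: "\<And>B. B \<in> \<B> \<Longrightarrow> m \<le> lam * (unit_ball_vol (real (n - 2)) * q ^ (n - 2) / 2) * measure \<mu> B"
  shows "sparse_events M (\<lambda>\<omega>. bad_cell n r A h \<B> (\<lambda>k. T k \<omega>) (\<lambda>k. X k \<omega>))
    (real (card (grid n h A) * card \<B>) * exp (- (m / 2)))"
proof -
  interpret prob_space M by (rule marked_prob_space[OF process lam])
  note [measurable] = measurable_marked_point[OF process lam] measurable_mark[OF process lam]
  let ?C = "grid n h A \<times> \<B>"
  let ?E = "\<lambda>z c. {\<omega> \<in> space M. \<forall>k. \<not> (T k \<omega> \<in> target n r A (fst c) z \<and> X k \<omega> \<in> snd c)}"
  have C: "finite ?C" using B finite_grid by blast
  have E: "?E z c \<in> events" if "c \<in> ?C" for z c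
  proof -
    have [measurable]: "target n r A (fst c) z \<in> sets (lebesgue_n n)" "snd c \<in> sets borel"
      using that B emeasure_target(1)[OF n] by auto
    show ?thesis by measurable
  qed
  have bad: "bad_cell n r A h \<B> (\<lambda>k. T k \<omega>) (\<lambda>k. X k \<omega>) z \<longleftrightarrow> (\<exists>c\<in>?C. \<omega> \<in> ?E z c)" if "\<omega> \<in> space M" for \<omega> z
    using that by (simp add: bad_cell_def)
  show ?thesis unfolding sparse_events_def
  proof (intro conjI allI impI)
    fix z
    have "{\<omega> \<in> space M. bad_cell n r A h \<B> (\<lambda>k. T k \<omega>) (\<lambda>k. X k \<omega>) z} = (\<Union>c\<in>?C. ?E z c)"
      using bad[of _ z] by blast
    also have "\<dots> \<in> events" using C E by (intro sets.finite_UN)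
    finally show "{\<omega> \<in> space M. bad_cell n r A h \<B> (\<lambda>k. T k \<omega>) (\<lambda>k. X k \<omega>) z} \<in> events" .
  next
    fix Q :: "site set" assume Q: "finite Q"
    have "{\<omega> \<in> space M. \<forall>q\<in>Q. bad_cell n r A h \<B> (\<lambda>k. T k \<omega>) (\<lambda>k. X k \<omega>) q} =
        {\<omega> \<in> space M. \<forall>q\<in>Q. \<exists>c\<in>?C. \<omega> \<in> ?E q c}"
      by (intro Collect_cong conj_cong refl ball_cong bad)
    also have "prob \<dots> \<le> real (card ?C) ^ card Q * exp (- (m / 2)) ^ card Q"
    proof (rule prob_choice_bound[OF Q C E])
      fix f assume f: "f \<in> Q \<rightarrow>\<^sub>E ?C"
      have fq: "fst (f z) \<in> grid n h A" "snd (f z) \<in> \<B>" if "z \<in> Q" for z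
        using f that by (auto simp: PiE_iff mem_Times_iff)
      have "{\<omega> \<in> space M. \<forall>z\<in>Q. \<omega> \<in> ?E z (f z)} =
          {\<omega> \<in> space M. \<forall>z\<in>Q. \<forall>k. \<not> (T k \<omega> \<in> target n r A (fst (f z)) z \<and> X k \<omega> \<in> snd (f z))}"
        by auto
      also have "prob \<dots> \<le> (\<Prod>z\<in>Q. exp (- (lam * measure (lebesgue_n n) (target n r A (fst (f z)) z) * measure \<mu> (snd (f z)) / 2)))"
      proof (rule void_probability_bound[OF process lam Q])
        show "disjoint_family_on (\<lambda>z. target n r A (fst (f z)) z) Q"
          using in_cell_unique by (fastforce simp: disjoint_family_on_def target_def)
        fix z assume z: "z \<in> Q"
        show "target n r A (fst (f z)) z \<in> sets (lebesgue_n n)" by (rule emeasure_target(1)[OF n])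
        show "emeasure (lebesgue_n n) (target n r A (fst (f z)) z) < \<infinity>"
          by (rule measure_target_ge(1)[OF n fq(1)[OF z] A])
        show "snd (f z) \<in> sets borel" using fq(2)[OF z] B(2) by blast
      qed
      also have "\<dots> \<le> (\<Prod>z\<in>Q. exp (- (m / 2)))"
      proof (intro prod_mono conjI)
        fix z assume z: "z \<in> Q"
        have "m \<le> lam * (unit_ball_vol (real (n - 2)) * q ^ (n - 2) / 2) * measure \<mu> (snd (f z))"
          using fq z by (intro m)
        also have "\<dots> \<le> lam * measure (lebesgue_n n) (target n r A (fst (f z)) z) * measure \<mu> (snd (f z))"
          using lam by (intro mult_right_mono mult_left_mono measure_target_ge(2)[OF n fq(1)[OF z] A]) auto
        finally show "exp (- (lam * measure (lebesgue_n n) (target n r A (fst (f z)) z) * measure \<mu> (snd (f z)) / 2)) \<le> exp (- (m / 2))"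
          by simp
      qed simp
      also have "\<dots> = exp (- (m / 2)) ^ card Q" by simp
      finally show "prob {\<omega> \<in> space M. \<forall>q\<in>Q. \<omega> \<in> ?E q (f q)} \<le> exp (- (m / 2)) ^ card Q" .
    qed
    also have "\<dots> = (real (card (grid n h A) * card \<B>) * exp (- (m / 2))) ^ card Q"
      by (simp add: card_cartesian_product power_mult_distrib)
    finally show "prob {\<omega> \<in> space M. \<forall>q\<in>Q. bad_cell n r A h \<B> (\<lambda>k. T k \<omega>) (\<lambda>k. X k \<omega>) q} \<le>
        (real (card (grid n h A) * card \<B>) * exp (- (m / 2))) ^ card Q" .
  qed
qed

context radius_laws
begin

lemma supercritical:
  fixes M :: "nat \<Rightarrow> 'w measure"
  assumes v: "(INF R\<in>{Rs..}. I R - ereal (ln (R + Rs))) = ereal v"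
    "\<And>R. 0 \<le> R \<Longrightarrow> ereal (ln (R + Rs) + v) \<le> I R"
    and lim: "\<rho>s \<longlonglongrightarrow> \<rho>" and \<rho>: "- (1 / 2) * ln (2 * pi * exp 1) + v < \<rho>"
    and palm: "\<And>n. n \<ge> 1 \<Longrightarrow> palm_marked_process (M n) n (exp (real n * \<rho>s n)) (\<mu> n) (T n) (X n) (X0 n)"
  shows "\<forall>\<^sub>F n in sequentially. 1 / 2 \<le> percolation_probability (M n) n (T n) (X n) (X0 n)"
proof -
  define L where "L = ln (2 * pi * exp 1) / 2"
  have "(INF R\<in>{Rs..}. I R - ereal (ln (R + Rs))) < ereal (\<rho> + L)"
    unfolding v(1) using \<rho> by (simp add: L_def)
  then obtain R where R: "R \<ge> Rs" "I R - ereal (ln (R + Rs)) < ereal (\<rho> + L)"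
    by (auto simp: INF_less_iff)
  then have "I R < ereal (\<rho> + L + ln (R + Rs))" using rate_nonneg[of R] by (cases "I R") auto
  then obtain b where b: "I R < ereal b" "b < \<rho> + L + ln (R + Rs)"
    using ereal_dense2 by (metis less_ereal.simps(1))
  \<comment> \<open>Since \<open>I Rs = 0 < b\<close>, marks above \<open>Rs - h\<close> satisfy the
    same lower bound \<open>exp (- (n * b))\<close> as marks above \<open>R - h\<close>; one
    exponent serves both kinds.\<close>
  have b0: "b > 0" using b(1) rate_nonneg[of R] by (metis ereal_less(2) le_less_trans)
  define \<delta> where "\<delta> = (\<rho> + L + ln (R + Rs) - b) / 2"
  define q where "q = (R + Rs) * exp (- \<delta>)"
  \<comment> \<open>The gap between \<open>q\<close> and \<open>R + Rs\<close> is spent in fifths: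
    one on the shift of the lens, one on rounding to the grid, one on the constant 3 in the distance
    bound, and one on each of the two marks \<open>R - h\<close> and \<open>Rs - h\<close>.\<close>
  define h where "h = (R + Rs - q) / 5"
  have \<delta>: "\<delta> > 0" using b by (simp add: \<delta>_def)
  have RRs: "R + Rs > 0" using R Rs_pos by simp
  have q: "q > 0" "q < R + Rs" using RRs \<delta> by (auto simp: q_def)
  have h: "h > 0" "q = R + Rs - 5 * h"
  proof -
    have "5 * h = R + Rs - q" by (simp add: h_def)
    then show "h > 0" "q = R + Rs - 5 * h" using q by linarith+
  qed
  have lnq: "ln q = ln (R + Rs) - \<delta>" using RRs by (simp add: q_def ln_mult)
  define r where "r = q + h"
  \<comment> \<open>With \<open>s = h / A\<close> the shift \<open>s * A\<close> is exactly
    \<open>h\<close>, while \<open>s * A^2 = h * A\<close> is at least \<open>r^2\<close>, hence at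
    least \<open>q^2\<close>. The summand \<open>h\<close> ensures \<open>s \<le> 1\<close>.\<close>
  define A where "A = r\<^sup>2 / h + h"
  define s where "s = h / A"
  have r0: "r > 0" using q h by (simp add: r_def)
  have A: "A > 0" "h \<le> A" using h by (auto simp: A_def add_nonneg_pos)
  have s: "0 \<le> s" "s \<le> 1" "s * A = h" using A h by (auto simp: s_def)
  have qA: "q\<^sup>2 \<le> s * A\<^sup>2"
  proof -
    have "q\<^sup>2 \<le> r\<^sup>2" using q h by (intro power_mono) (auto simp: r_def)
    also have "\<dots> \<le> h * A" using h by (simp add: A_def distrib_left)
    also have "\<dots> = s * A\<^sup>2" using s by (simp add: power2_eq_square flip: mult.assoc)
    finally show ?thesis .
  qed
  let ?B = "{{R - h<..}, {Rs - h<..}} :: real set set"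
  \<comment> \<open>\<open>exp (n * g n)\<close> is a lower bound for the mean number of points of
    one kind in a ball of radius \<open>q * sqrt n\<close> of the remaining coordinates over a unit
    square; the lens keeps half of it, hence \<open>m\<close>. The exponent tends to
    \<open>\<delta>\<close>.\<close>
  define g where "g n = \<rho>s n + log_ball (n - 2) / real n + real (n - 2) / real n * ln q - b" for n
  define m where "m n = exp (real n * g n) / 2" for n
  define \<epsilon> where "\<epsilon> n = real (card (grid n h (A * sqrt (real n))) * card ?B) * exp (- (m n / 2))" for n
  \<comment> \<open>Here the Laplace bound only supplies the finite integral that allows passing to
    the touching graph.\<close>
  obtain c where c: "c > Rs" and lap: "\<forall>\<^sub>F n in sequentially. (\<integral>\<^sup>+x. ennreal ((c + x) ^ n) \<partial>\<mu> n) \<le> ennreal (exp (real n * (1 - v)))"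
    using laplace_upper_bound[OF v(2), of 1] by auto
  have B1: "\<forall>\<^sub>F n in sequentially. exp (- (real n * b)) \<le> measure (\<mu> n) {R - h<..}"
    using b(1) h by (intro ldp_lower) auto
  have B2: "\<forall>\<^sub>F n in sequentially. exp (- (real n * b)) \<le> measure (\<mu> n) {Rs - h<..}"
    using b0 h by (intro ldp_lower[of _ Rs]) (auto simp: rate_Rs)
  have near: "\<forall>\<^sub>F n in sequentially. 3 / 4 < measure (\<mu> n) {Rs - h / 2..Rs + h / 2}"
    using h by (intro order_tendstoD(1)[OF prob_near_Rs]) auto
  have glim: "g \<longlonglongrightarrow> \<rho> + L + 1 * ln q - b"
  proof -
    have "(\<lambda>n. log_ball (n - 2) / real (n - 2) * (real (n - 2) / real n)) \<longlonglongrightarrow> L * 1"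
    proof (intro tendsto_mult)
      show "(\<lambda>n. log_ball (n - 2) / real (n - 2)) \<longlonglongrightarrow> L"
        unfolding L_def by (rule filterlim_compose[OF log_ball_limit filterlim_minus_const_nat_at_top])
      show "(\<lambda>n. real (n - 2) / real n) \<longlonglongrightarrow> 1" by real_asymp
    qed
    then have prod_lim: "(\<lambda>n. log_ball (n - 2) / real (n - 2) * (real (n - 2) / real n)) \<longlonglongrightarrow> L" by simp
    have "(\<lambda>n. log_ball (n - 2) / real n) \<longlonglongrightarrow> L"
      by (rule Lim_transform_eventually[OF prod_lim], rule eventually_sequentiallyI[of 3]) simp
    moreover have "(\<lambda>n. real (n - 2) / real n) \<longlonglongrightarrow> 1" by real_asymp
    ultimately show ?thesis unfolding g_def by (intro tendsto_add tendsto_diff tendsto_mult tendsto_const lim)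
  qed
  moreover have "\<rho> + L + 1 * ln q - b = \<delta>" by (simp add: lnq \<delta>_def field_simps)
  ultimately have "\<forall>\<^sub>F n in sequentially. \<delta> / 2 < g n" using \<delta> by (intro order_tendstoD(1)) auto
  \<comment> \<open>Grid size against void probability: the former has logarithm of order
    \<open>n * ln n\<close>, the latter has negative logarithm at least
    \<open>exp (n * \<delta> / 2) / 4\<close>.\<close>
  moreover have "(\<lambda>n. 2 * (exp (real n * ln (2 * A * sqrt (real n) / h + 3) - exp (real n * (\<delta> / 2)) / 4))) \<longlonglongrightarrow> 0"
    using A h \<delta> by real_asymp
  then have "\<forall>\<^sub>F n in sequentially. 2 * (exp (real n * ln (2 * A * sqrt (real n) / h + 3) - exp (real n * (\<delta> / 2)) / 4)) < 1 / 162"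
    by (rule order_tendstoD(2)) simp
  ultimately have \<epsilon>: "\<forall>\<^sub>F n in sequentially. 162 * \<epsilon> n \<le> 1" using eventually_ge_at_top[of 1]
  proof eventually_elim
    case (elim n)
    have base: "2 * (A * sqrt (real n)) / h + 3 > 0" using A h by (simp add: add_nonneg_pos)
    have "card ?B \<le> 2" by (simp add: card_insert_if)
    have "real (card (grid n h (A * sqrt (real n)))) \<le> (2 * (A * sqrt (real n)) / h + 3) ^ n"
      using A h elim by (intro card_grid_le) auto
    also have "\<dots> = exp (real n * ln (2 * A * sqrt (real n) / h + 3))"
      using base by (simp add: exp_of_nat_mult mult.assoc)
    finally have "real (card (grid n h (A * sqrt (real n))) * card ?B) \<le> exp (real n * ln (2 * A * sqrt (real n) / h + 3)) * 2"
      using \<open>card ?B \<le> 2\<close> unfolding of_nat_mult by (intro mult_mono) auto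
    moreover have "exp (- (m n / 2)) \<le> exp (- (exp (real n * (\<delta> / 2)) / 4))"
      using elim by (simp add: m_def mult_left_mono)
    ultimately have "\<epsilon> n \<le> exp (real n * ln (2 * A * sqrt (real n) / h + 3)) * 2 * exp (- (exp (real n * (\<delta> / 2)) / 4))"
      unfolding \<epsilon>_def by (intro mult_mono) auto
    also have "\<dots> = 2 * (exp (real n * ln (2 * A * sqrt (real n) / h + 3) - exp (real n * (\<delta> / 2)) / 4))"
      by (simp only: exp_diff exp_minus divide_inverse mult_ac)
    finally show ?case using elim by linarith
  qed
  have large: "\<forall>\<^sub>F n in sequentially. 3 \<le> h * sqrt (real n)" using h by real_asymp
  show ?thesis
    using lap B1 B2 near \<epsilon> large eventually_ge_at_top[of 3]
  proof eventually_elim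
    case (elim n)
    have n1: "n \<ge> 1" using elim by simp
    note p = palm[OF n1]
    note pm = palm_marked[OF p _ n1 nonneg[OF n1], simplified]
    interpret prob_space "M n" by (rule palm_prob_space[OF p _ n1 nonneg[OF n1]]) simp
    interpret mu: prob_space "\<mu> n" by (rule prob_space_law) fact
    let ?w = "sqrt (real n)"
    let ?\<beta> = "\<lambda>\<omega>. bad_cell n (r * ?w) (A * ?w) h ?B (\<lambda>k. T n k \<omega>) (\<lambda>k. X n k \<omega>)"
    let ?E = "{\<omega> \<in> space (M n). infinite (touching_cluster n (\<lambda>k. T n k \<omega>) (\<lambda>k. X n k \<omega>) (X0 n \<omega>))}"
    have sp: "sparse_events (M n) ?\<beta> (\<epsilon> n)"
      unfolding \<epsilon>_def
    proof (rule sparse_bad_cells[OF pm, where s=s and q="q * ?w"])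
      show "q * ?w + s * (A * ?w) \<le> r * ?w"
        using s(3) by (simp add: r_def distrib_right flip: mult.assoc)
      show "(q * ?w)\<^sup>2 \<le> s * (A * ?w)\<^sup>2"
        using mult_right_mono[OF qA, of "?w\<^sup>2"] by (simp add: power_mult_distrib mult.assoc)
      fix B assume B: "B \<in> ?B"
      have "m n = exp (real n * \<rho>s n) * (exp (log_ball (n - 2)) * exp (real (n - 2) * ln q) / 2) * exp (- (real n * b))"
        using n1 by (simp add: m_def g_def algebra_simps flip: exp_add)
      also have "exp (real (n - 2) * ln q) = q ^ (n - 2)" using q by (simp add: exp_of_nat_mult)
      also have "exp (real n * \<rho>s n) * (exp (log_ball (n - 2)) * q ^ (n - 2) / 2) * exp (- (real n * b)) \<le>
          exp (real n * \<rho>s n) * (unit_ball_vol (real (n - 2)) * (q * ?w) ^ (n - 2) / 2) * measure (\<mu> n) B"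
      proof -
        \<comment> \<open>\<open>log_ball\<close> in dimension \<open>n - 2\<close> scales radii by
          \<open>sqrt (n - 2)\<close>, the model by \<open>sqrt n\<close>; the monotonicity of the
          volume bridges the two.\<close>
        have "exp (log_ball (n - 2)) * q ^ (n - 2) = unit_ball_vol (real (n - 2)) * (q * sqrt (real (n - 2))) ^ (n - 2)"
          by (simp add: exp_log_ball power_mult_distrib)
        also have "\<dots> \<le> unit_ball_vol (real (n - 2)) * (q * ?w) ^ (n - 2)"
          using q by (intro mult_left_mono power_mono) auto
        finally have key: "exp (log_ball (n - 2)) * q ^ (n - 2) \<le> unit_ball_vol (real (n - 2)) * (q * ?w) ^ (n - 2)" .
        have mB: "exp (- (real n * b)) \<le> measure (\<mu> n) B" using B elim by auto
        show ?thesis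
          by (rule mult_mono[OF mult_left_mono[OF divide_right_mono[OF key]] mB]) (use q in auto)
      qed
      finally show "m n \<le> exp (real n * \<rho>s n) * (unit_ball_vol (real (n - 2)) * (q * ?w) ^ (n - 2) / 2) * measure (\<mu> n) B" .
    qed (use A s q elim in auto)
    have \<epsilon>0: "0 \<le> \<epsilon> n" by (simp add: \<epsilon>_def)
    let ?D = "{\<omega> \<in> space (M n). \<exists>k. bad_block (?\<beta> \<omega>) k (0, 0)}"
    let ?O = "{\<omega> \<in> space (M n). X0 n \<omega> \<in> {Rs - h<..}}"
    note D = prob_bad_block_le[OF sp \<epsilon>0 elim(5), of "(0, 0)"]
    have X0: "X0 n \<in> borel_measurable (M n)" "distr (M n) borel (X0 n) = \<mu> n"
      using p by (auto simp: palm_marked_process_def)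
    have O: "?O \<in> events" using X0(1) by measurable
    have pO: "3 / 4 \<le> prob ?O"
    proof -
      have "prob ?O = measure (\<mu> n) {Rs - h<..}"
        unfolding X0(2)[symmetric] using X0(1) by (subst measure_distr) (auto intro!: arg_cong[where f=prob])
      also have "\<dots> \<ge> measure (\<mu> n) {Rs - h / 2..Rs + h / 2}"
        using n1 h by (intro mu.finite_measure_mono) auto
      finally show ?thesis using elim by linarith
    qed
    have sub: "?O - ?D \<subseteq> ?E"
    proof
      fix \<omega> assume w: "\<omega> \<in> ?O - ?D"
      have "infinite (touching_cluster n (\<lambda>k. T n k \<omega>) (\<lambda>k. X n k \<omega>) (X0 n \<omega>))"
      proof (rule infinite_touching_cluster[where a="R - h" and b="Rs - h" and h=h and r="r * ?w" and A="A * ?w"])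
        have "3 + r * ?w + h * ?w \<le> (r + 2 * h) * ?w" using elim by (simp add: algebra_simps)
        also have "\<dots> \<le> (R - h + (Rs - h)) * ?w" using h by (intro mult_right_mono) (auto simp: r_def)
        finally show "3 + r * ?w + h * ?w \<le> (R - h + (Rs - h)) * ?w" .
      qed (use w h A elim in auto)
      then show "\<omega> \<in> ?E" using w by simp
    qed
    \<comment> \<open>The mark at the origin is large enough with probability at least
      \<open>3 / 4\<close>, and some corner block is bad with probability at most
      \<open>2 / 162\<close>.\<close>
    have "prob ?O \<le> prob (?O - ?D) + prob ?D"
      using finite_measure_mono[of ?O "(?O - ?D) \<union> ?D"] measure_Un_le[of "?O - ?D" "M n" ?D] O D(1) by auto
    moreover have "prob (?O - ?D) \<le> prob ?E"
      using sub by (intro finite_measure_mono measurable_infinite_cluster[OF p _ n1 nonneg[OF n1]]) auto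
    moreover have "prob ?D \<le> 1 / 4" using D(2) elim(5) by linarith
    moreover have "percolation_probability (M n) n (T n) (X n) (X0 n) = prob ?E"
      using c Rs_pos elim by (intro percolation_probability_eq[OF p _ n1 nonneg[OF n1], where q=c]) (auto intro: le_less_trans)
    ultimately show ?case using pO by linarith
  qed
qed

end

theorem theorem4:
  fixes \<mu> :: "nat \<Rightarrow> real measure" and I :: "real \<Rightarrow> ereal" and Rs \<gamma> :: real
  assumes law: "\<And>n. n \<ge> 1 \<Longrightarrow> real_distribution (\<mu> n)"
    and nonneg: "\<And>n. n \<ge> 1 \<Longrightarrow> AE x in \<mu> n. 0 \<le> x"
    and mean: "(\<lambda>n. \<integral>\<^sup>+x. ennreal x \<partial>\<mu> n) \<longlonglongrightarrow> ennreal Rs"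
    and Rs_pos: "0 < Rs"
    and in_probability:
      "\<And>\<epsilon>. \<epsilon> > 0 \<Longrightarrow> (\<lambda>n. measure (\<mu> n) {x. \<bar>x - Rs\<bar> > \<epsilon>}) \<longlonglongrightarrow> 0"
    and rate: "good_rate_function I" "convex_rate I"
    and ldp: "large_deviations_principle \<mu> I"
    and moments: "\<gamma> > 1"
      "limsup (\<lambda>n. ennreal_power (\<integral>\<^sup>+x. ennreal (x powr (\<gamma> * real n)) \<partial>\<mu> n) (1 / real n)) < \<infinity>"
  shows "\<exists>\<tau>::real.
    ereal \<tau> = ereal (- (1 / 2) * ln (2 * pi * exp 1)) + (INF R\<in>{Rs..}. I R - ereal (ln (R + Rs))) \<and>
    is_percolation_threshold TYPE('w) \<mu> \<tau>"
proof -
  interpret radius_laws \<mu> I Rs \<gamma>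
    by (rule radius_laws.intro) (fact law nonneg Rs_pos in_probability rate(1) ldp moments)+
  obtain v where v: "(INF R\<in>{Rs..}. I R - ereal (ln (R + Rs))) = ereal v"
      "\<And>R. 0 \<le> R \<Longrightarrow> ereal (ln (R + Rs) + v) \<le> I R"
    using threshold_value by blast
  let ?\<tau> = "- (1 / 2) * ln (2 * pi * exp 1) + v"
  have "is_percolation_threshold TYPE('w) \<mu> ?\<tau>"
    unfolding is_percolation_threshold_def Let_def
  proof (intro allI impI conjI)
    fix \<rho>s :: "nat \<Rightarrow> real" and \<rho> :: real and M :: "nat \<Rightarrow> 'w measure" and T X X0
    assume lim: "\<rho>s \<longlonglongrightarrow> \<rho>"
      and palm: "\<forall>n\<ge>1. palm_marked_process (M n) n (exp (real n * \<rho>s n)) (\<mu> n) (T n) (X n) (X0 n)"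
    show "(\<lambda>n. percolation_probability (M n) n (T n) (X n) (X0 n)) \<longlonglongrightarrow> 0" if "\<rho> < ?\<tau>"
      using palm by (intro subcritical[OF v(2) lim that]) auto
    show "0 < liminf (\<lambda>n. ereal (percolation_probability (M n) n (T n) (X n) (X0 n)))" if "?\<tau> < \<rho>"
    proof -
      have "\<forall>\<^sub>F n in sequentially. 1 / 2 \<le> percolation_probability (M n) n (T n) (X n) (X0 n)"
        using palm by (intro supercritical[OF v lim that]) auto
      then have "ereal (1 / 2) \<le> liminf (\<lambda>n. ereal (percolation_probability (M n) n (T n) (X n) (X0 n)))"
        by (intro Liminf_bounded) (simp add: eventually_mono)
      then show ?thesis by (rule less_le_trans[rotated]) simp
    qed
  qed
  then show ?thesis using v(1) by (intro exI[of _ ?\<tau>]) simp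
qed

end
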